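(* Suppose that: (i) (fourth moment lower condition) the fourth moments of the covariates are finite under both distributions and there is a constant $\beta>0$ such that for every PSD matrix (operator) $A$, $$\mathbb E_{\mathrm{src}}[xx^\top Axx^\top]-GAG\succeq\beta\,\mathrm{tr}(GA)\,G,\qquad \mathbb E_{\mathrm{tgt}}[xx^\top Axx^\top]-HAH\succeq\beta\,\mathrm{tr}(HA)\,H;$$ (ii) (well-specified noise) under both distributions $y=x^\top w^*+\epsilon$ with $\epsilon\sim\mathcal N(0,\sigma^2)$ independent of $x$. Let $w_{M+N}$ be the output of the pretraining-finetuning SGD with $M$ source data and $N$ target data, let $M_{\mathrm{eff}}:=M/\log M$, $N_{\mathrm{eff}}:=N/\log N$, and suppose $M_{\mathrm{eff}},N_{\mathrm{eff}}\ge10$. Suppose that $0<\gamma_0<1/\|G\|_2$ and $0<\gamma_M<1/\|H\|_2$. Then $$\mathbb E[\mathcal E(w_{M+N})]=\mathrm{BiasErr}+\mathrm{VarErr}.$$ Moreover, for the index sets $\mathbb J=\{j:\mu_j\ge1/(\gamma_0M_{\mathrm{eff}})\}$ and $\mathbb K=\{k:\lambda_k\ge1/(\gamma_MN_{\mathrm{eff}})\}$, $$\mathrm{VarErr}\gtrsim\sigma^2\Big(\frac{D_{\mathrm{eff}}^{\mathrm{ft}}}{M_{\mathrm{eff}}}+\frac{D_{\mathrm{eff}}}{N_{\mathrm{eff}}}\Big),$$ $$\begin{aligned}\mathrm{BiasErr}\gtrsim{}&\Big\|\prod_{t=M}^{M+N-1}(I-\gamma_tH)\prod_{t=0}^{M-1}(I-\gamma_tG)(w_0-w^*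 )\Big\|_H^2\\&+\beta\,\|w_0-w^*\|^2_{G_{\mathbb J^c}}\cdot\frac{D_{\mathrm{eff}}^{\mathrm{ft}}}{M_{\mathrm{eff}}}+\beta\,\Big\|\prod_{t=0}^{M-1}(I-\gamma_tG)(w_0-w^* )\Big\|^2_{H_{\mathbb K^c}}\cdot\frac{D_{\mathrm{eff}}}{N_{\mathrm{eff}}},\end{aligned}$$ where $$D_{\mathrm{eff}}^{\mathrm{ft}}:=\mathrm{tr}\Big(\prod_{t=0}^{N-1}(I-\gamma_{M+t}H)^2H\cdot\big(G_{\mathbb J}^{-1}+M_{\mathrm{eff}}^2\gamma_0^2\,G_{\mathbb J^c}\big)\Big),\qquad D_{\mathrm{eff}}:=|\mathbb K|+N_{\mathrm{eff}}^2\gamma_M^2\sum_{i\notin\mathbb K}\lambda_i^2 .$$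
   Context: Setting. Covariates $x$ lie in a Hilbert space ($d$-dimensional or countably infinite-dimensional) and responses $y\in\mathbb R$. $\mathcal D_{\mathrm{src}}$ and $\mathcal D_{\mathrm{tgt}}$ are the source and target distributions of $(x,y)$; $\mathbb E_{\mathrm{src}},\mathbb E_{\mathrm{tgt}}$ are expectations under them. $G:=\mathbb E_{\mathrm{src}}[xx^\top]$ and $H:=\mathbb E_{\mathrm{tgt}}[xx^\top]$ have finite entries and finite trace and are strictly positive definite, with eigenvalues $(\mu_i)_{i\ge1}$ and $(\lambda_i)_{i\ge1}$ respectively. Let $\mathrm{risk}_{\mathrm{src}}(w)=\frac12\mathbb E_{\mathrm{src}}(y-w^\top x)^2$, $\mathrm{risk}_{\mathrm{tgt}}(w)=\frac12\mathbb E_{\mathrm{tgt}}(y-w^\top x)^2$; $w^*$ is the unique simultaneous minimizer of both. The target excess risk is $\mathcal E(w):=\mathrm{risk}_{\mathrm{tgt}}(w)-\mathrm{risk}_{\mathrm{tgt}}(w^* )=\frac12(w-w^* )^\top H(w-w^* )$. SGD. Independent data $(x_i,y_i)\sim\mathcal D_{\mathrm{src}}$ for $i=1,\dots,M$ and $(x_i,y_i)\sim\mathcal D_{\mathrm{tgt}}$ for $i=M+1,\dots,M+N$. $w_0=0$ and $w_t=w_{t-1}-\gamma_{t-1}(x_tx_t^\top w_{t-1}-x_ty_t)$ for $t=1,\dots,M+N$, with $\gamma_t=\gamma_0/2^{\lfloor t/M_{\mathrm{eff}}\rfloor}$ for $0\le t<M$ and $\gamma_t=\gamma_M/2^{\lfloor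 (t-M)/N_{\mathrm{eff}}\rfloor}$ for $M\le t<M+N$. Output: $w_{M+N}$. Here $\log$ is base 2. Bias and variance errors. For a symmetric $A$ put $(\mathcal I-\gamma\mathcal T_G(\gamma))\circ A:=A-\gamma(GA+AG)+\gamma^2\mathbb E_{\mathrm{src}}[xx^\top Axx^\top]$ and $(\mathcal I-\gamma\mathcal T_H(\gamma))\circ A:=A-\gamma(HA+AH)+\gamma^2\mathbb E_{\mathrm{tgt}}[xx^\top Axx^\top]$. Let $\Sigma_G:=\mathbb E_{\mathrm{src}}[(y-\langle w^*,x\rangle)^2xx^\top]$, $\Sigma_H:=\mathbb E_{\mathrm{tgt}}[(y-\langle w^*,x\rangle)^2xx^\top]$. Define $B_0=(w_0-w^* )(w_0-w^* )^\top$, $C_0=0$, and, for $1\le t\le M$, $B_t=(\mathcal I-\gamma_{t-1}\mathcal T_G(\gamma_{t-1}))\circ B_{t-1}$, $C_t=(\mathcal I-\gamma_{t-1}\mathcal T_G(\gamma_{t-1}))\circ C_{t-1}+\gamma_{t-1}^2\Sigma_G$; for $M<t\le M+N$ use the same recursions with $H$ in place of $G$. Then, for this lower bound, $\mathrm{BiasErr}:=\frac12\langle H,B_{M+N}\rangle$ and $\mathrm{VarErr}:=\frac12\langle H,C_{M+N}\rangle$, where $\langle A,B\rangle=\mathrm{tr}(A^\top B)$. Notation. $\|v\|_A^2:=v^\top Av$; $\|A\|_2$ is the spectral norm. For an index set $\mathbb K\subset\mathbb N_+$ with complement $\mathbb K^c$, and $(v_i)$ the orthonormal eigenvectors of $H$: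 $H_{\mathbb K}=\sum_{i\in\mathbb K}\lambda_iv_iv_i^\top$, $H_{\mathbb K}^{-1}=\sum_{i\in\mathbb K}\lambda_i^{-1}v_iv_i^\top$; $G_{\mathbb J}$, $G_{\mathbb J}^{-1}$ are defined likewise from the eigenvalues $\mu_i$ and orthonormal eigenvectors of $G$. $f\gtrsim g$ means $f\ge cg$ for an absolute constant $c>0$. *)

theory Defs
  imports "HOL-Probability.Probability"
begin

text \<open>
  A real separable Hilbert space (of finite or countably infinite dimension) is a type
  of sort \<open>{real_inner, banach, second_countable_topology}\<close>. A distribution of
  \<open>(x, y)\<close> is a Borel probability measure on \<open>'a \<times> real\<close>, and operators are elements
  of \<open>'a \<Rightarrow>\<^sub>L 'a\<close>, whose \<open>norm\<close> is the spectral norm.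
\<close>

subsection \<open>Operators on a Hilbert space\<close>

definition orthonormal_basis :: "'a::real_inner set \<Rightarrow> bool" where
  "orthonormal_basis B \<longleftrightarrow>
     pairwise orthogonal B \<and> (\<forall>b\<in>B. norm b = 1) \<and> closure (span B) = UNIV"

definition eigenbasis ::
  "('a::real_inner \<Rightarrow>\<^sub>L 'a) \<Rightarrow> nat set \<Rightarrow> (nat \<Rightarrow> real) \<Rightarrow> (nat \<Rightarrow> 'a) \<Rightarrow> bool" where
  "eigenbasis A I l v \<longleftrightarrow>
     inj_on v I \<and> orthonormal_basis (v ` I) \<and> (\<forall>i\<in>I. blinfun_apply A (v i) = l i *\<^sub>R v i)"

definition symmetric_op :: "('a::real_inner \<Rightarrow>\<^sub>L 'a) \<Rightarrow> bool" where
  "symmetric_op A \<longleftrightarrow> (\<forall>u v. blinfun_apply A u \<bullet> v = u \<bullet> blinfun_apply A v)"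

definition psd :: "('a::real_inner \<Rightarrow>\<^sub>L 'a) \<Rightarrow> bool" where
  "psd A \<longleftrightarrow> symmetric_op A \<and> (\<forall>v. 0 \<le> v \<bullet> blinfun_apply A v)"

definition strictly_pd :: "('a::real_inner \<Rightarrow>\<^sub>L 'a) \<Rightarrow> bool" where
  "strictly_pd A \<longleftrightarrow> symmetric_op A \<and> (\<forall>v. v \<noteq> 0 \<longrightarrow> 0 < v \<bullet> blinfun_apply A v)"

definition loewner_le :: "('a::real_inner \<Rightarrow>\<^sub>L 'a) \<Rightarrow> ('a \<Rightarrow>\<^sub>L 'a) \<Rightarrow> bool"
    (infix \<open>\<preceq>\<^sub>L\<close> 50) where
  "A \<preceq>\<^sub>L B \<longleftrightarrow> psd (B - A)"

text \<open>
  The trace is the common value of \<open>\<Sum>e\<in>B. \<langle>e, A e\<rangle>\<close> over all orthonormal bases \<open>B\<close>; it is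
  meaningful for trace-class operators.
\<close>

definition op_trace :: "('a::real_inner \<Rightarrow>\<^sub>L 'a) \<Rightarrow> real" where
  "op_trace A = (THE t. \<forall>B. orthonormal_basis B \<longrightarrow>
                   ((\<lambda>e. e \<bullet> blinfun_apply A e) has_sum t) B)"

definition op_inner :: "('a::real_inner \<Rightarrow>\<^sub>L 'a) \<Rightarrow> ('a \<Rightarrow>\<^sub>L 'a) \<Rightarrow> real" where
  "op_inner A B = op_trace (Blinfun (adjoint (blinfun_apply A)) o\<^sub>L B)"

definition sq_wnorm :: "('a::real_inner \<Rightarrow>\<^sub>L 'a) \<Rightarrow> 'a \<Rightarrow> real" where
  "sq_wnorm A v = v \<bullet> blinfun_apply A v"

definition outer :: "'a::real_inner \<Rightarrow> 'a \<Rightarrow> 'a \<Rightarrow>\<^sub>L 'a" where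
  "outer u w = Blinfun (\<lambda>v. (w \<bullet> v) *\<^sub>R u)"

definition spectral_op :: "nat set \<Rightarrow> (nat \<Rightarrow> real) \<Rightarrow> (nat \<Rightarrow> 'a::real_inner) \<Rightarrow> 'a \<Rightarrow>\<^sub>L 'a" where
  "spectral_op J a v = (\<Sum>\<^sub>\<infinity>i\<in>J. a i *\<^sub>R outer (v i) (v i))"

primrec op_prod :: "(nat \<Rightarrow> ('a::real_normed_vector \<Rightarrow>\<^sub>L 'a)) \<Rightarrow> nat \<Rightarrow> 'a \<Rightarrow>\<^sub>L 'a" where
  "op_prod F 0 = id_blinfun"
| "op_prod F (Suc n) = F n o\<^sub>L op_prod F n"

subsection \<open>Moments and risk of a distribution of covariates and responses\<close>

type_synonym 'a law = "('a \<times> real) measure"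

definition second_moment ::
  "'a::{real_inner, banach, second_countable_topology} law \<Rightarrow> 'a \<Rightarrow>\<^sub>L 'a" where
  "second_moment D = Blinfun (\<lambda>v. LINT z|D. (fst z \<bullet> v) *\<^sub>R fst z)"

text \<open>The operator \<open>E[x x\<^sup>T A x x\<^sup>T]\<close>, using \<open>(x x\<^sup>T A x x\<^sup>T) v = \<langle>x, A x\<rangle> \<langle>x, v\<rangle> x\<close>.\<close>

definition fourth_moment ::
  "'a::{real_inner, banach, second_countable_topology} law \<Rightarrow> ('a \<Rightarrow>\<^sub>L 'a) \<Rightarrow> 'a \<Rightarrow>\<^sub>L 'a" where
  "fourth_moment D A =
     Blinfun (\<lambda>v. LINT z|D. ((fst z \<bullet> blinfun_apply A (fst z)) * (fst z \<bullet> v)) *\<^sub>R fst z)"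

definition noise_cov ::
  "'a::{real_inner, banach, second_countable_topology} law \<Rightarrow> 'a \<Rightarrow> 'a \<Rightarrow>\<^sub>L 'a" where
  "noise_cov D w = Blinfun (\<lambda>v. LINT z|D. ((snd z - w \<bullet> fst z)\<^sup>2 * (fst z \<bullet> v)) *\<^sub>R fst z)"

definition risk ::
  "'a::{real_inner, banach, second_countable_topology} law \<Rightarrow> 'a \<Rightarrow> real" where
  "risk D w = (1/2) * (LINT z|D. (snd z - w \<bullet> fst z)\<^sup>2)"

definition excess_risk ::
  "'a::{real_inner, banach, second_countable_topology} law \<Rightarrow> 'a \<Rightarrow> 'a \<Rightarrow> real" where
  "excess_risk D w_star w = risk D w - risk D w_star"

text \<open>
  Finiteness of the fourth moment of \<open>x\<close> is Bochner integrability of \<open>x \<otimes> x \<otimes> x \<otimes> x\<close>, that is,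
  \<open>E \<parallel>x\<parallel>\<^sup>4 < \<infinity>\<close>.
\<close>

definition fourth_moment_lower ::
  "'a::{real_inner, banach, second_countable_topology} law \<Rightarrow> real \<Rightarrow> bool" where
  "fourth_moment_lower D \<beta> \<longleftrightarrow>
     integrable D (\<lambda>z. norm (fst z) ^ 4) \<and>
     (\<forall>A. psd A \<longrightarrow>
        (\<beta> * op_trace (second_moment D o\<^sub>L A)) *\<^sub>R second_moment D
          \<preceq>\<^sub>L fourth_moment D A - (second_moment D o\<^sub>L A o\<^sub>L second_moment D))"

text \<open>The law \<open>N(0, \<sigma>\<^sup>2)\<close>, including the degenerate noiseless case \<open>\<sigma> = 0\<close>.\<close>

definition centered_normal :: "real \<Rightarrow> real measure" where
  "centered_normal \<sigma> =
     (if \<sigma> = 0 then return borel 0 else density lborel (\<lambda>t. ennreal (normal_density 0 \<sigma> t)))"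

definition well_specified ::
  "'a::{real_inner, banach, second_countable_topology} law \<Rightarrow> 'a \<Rightarrow> real \<Rightarrow> bool" where
  "well_specified D w_star \<sigma> \<longleftrightarrow>
     prob_space.indep_set D
       {fst -` S \<inter> space D |S. S \<in> sets borel}
       {(\<lambda>z. snd z - fst z \<bullet> w_star) -` T \<inter> space D |T. T \<in> sets borel} \<and>
     distr D borel (\<lambda>z. snd z - fst z \<bullet> w_star) = centered_normal \<sigma>"

subsection \<open>Pretraining-finetuning SGD and its error iterates\<close>

definition eff_size :: "nat \<Rightarrow> real" where
  "eff_size M = real M / log 2 (real M)"

definition stepsize :: "nat \<Rightarrow> nat \<Rightarrow> real \<Rightarrow> real \<Rightarrow> nat \<Rightarrow> real" where
  "stepsize M N \<gamma>0 \<gamma>M t =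
     (if t < M then \<gamma>0 / 2 ^ nat \<lfloor>real t / eff_size M\<rfloor>
      else \<gamma>M / 2 ^ nat \<lfloor>real (t - M) / eff_size N\<rfloor>)"

text \<open>The data are \<open>z 1, z 2, \<dots>\<close>; the value \<open>z 0\<close> is not used.\<close>

primrec sgd :: "(nat \<Rightarrow> real) \<Rightarrow> 'a::real_inner \<Rightarrow> (nat \<Rightarrow> 'a \<times> real) \<Rightarrow> nat \<Rightarrow> 'a" where
  "sgd \<gamma> w0 z 0 = w0"
| "sgd \<gamma> w0 z (Suc t) =
     (let x = fst (z (Suc t)); y = snd (z (Suc t)); w = sgd \<gamma> w0 z t
      in w - \<gamma> t *\<^sub>R ((x \<bullet> w) *\<^sub>R x - y *\<^sub>R x))"

definition error_step ::
  "'a::{real_inner, banach, second_countable_topology} law \<Rightarrow> real \<Rightarrow> ('a \<Rightarrow>\<^sub>L 'a) \<Rightarrow> 'a \<Rightarrow>\<^sub>L 'a" where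
  "error_step D \<gamma> A =
     A - \<gamma> *\<^sub>R ((second_moment D o\<^sub>L A) + (A o\<^sub>L second_moment D)) + \<gamma>\<^sup>2 *\<^sub>R fourth_moment D A"

primrec bias_iter ::
  "(nat \<Rightarrow> 'a::{real_inner, banach, second_countable_topology} law) \<Rightarrow> (nat \<Rightarrow> real) \<Rightarrow>
   ('a \<Rightarrow>\<^sub>L 'a) \<Rightarrow> nat \<Rightarrow> 'a \<Rightarrow>\<^sub>L 'a" where
  "bias_iter D \<gamma> B0 0 = B0"
| "bias_iter D \<gamma> B0 (Suc t) = error_step (D (Suc t)) (\<gamma> t) (bias_iter D \<gamma> B0 t)"

primrec var_iter ::
  "(nat \<Rightarrow> 'a::{real_inner, banach, second_countable_topology} law) \<Rightarrow> (nat \<Rightarrow> real) \<Rightarrow>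
   'a \<Rightarrow> nat \<Rightarrow> 'a \<Rightarrow>\<^sub>L 'a" where
  "var_iter D \<gamma> w_star 0 = 0"
| "var_iter D \<gamma> w_star (Suc t) =
     error_step (D (Suc t)) (\<gamma> t) (var_iter D \<gamma> w_star t)
     + (\<gamma> t)\<^sup>2 *\<^sub>R noise_cov (D (Suc t)) w_star"

text \<open>The law of the sample used in step \<open>t \<ge> 1\<close>: the source for \<open>t \<le> M\<close>, then the target.\<close>

definition sample_law :: "'a law \<Rightarrow> 'a law \<Rightarrow> nat \<Rightarrow> nat \<Rightarrow> 'a law" where
  "sample_law Dsrc Dtgt M t = (if t \<le> M then Dsrc else Dtgt)"

definition bias_err ::
  "'a::{real_inner, banach, second_countable_topology} law \<Rightarrow> 'a law \<Rightarrow> nat \<Rightarrow> nat \<Rightarrow>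
   (nat \<Rightarrow> real) \<Rightarrow> 'a \<Rightarrow> 'a \<Rightarrow> real" where
  "bias_err Dsrc Dtgt M N \<gamma> w0 w_star =
     (1/2) * op_inner (second_moment Dtgt)
       (bias_iter (sample_law Dsrc Dtgt M) \<gamma> (outer (w0 - w_star) (w0 - w_star)) (M + N))"

definition var_err ::
  "'a::{real_inner, banach, second_countable_topology} law \<Rightarrow> 'a law \<Rightarrow> nat \<Rightarrow> nat \<Rightarrow>
   (nat \<Rightarrow> real) \<Rightarrow> 'a \<Rightarrow> real" where
  "var_err Dsrc Dtgt M N \<gamma> w_star =
     (1/2) * op_inner (second_moment Dtgt)
       (var_iter (sample_law Dsrc Dtgt M) \<gamma> w_star (M + N))"

text \<open>
  The absolute constant hidden in the relation \<open>\<greatersim>\<close>. It is a fixed numeral because an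
  existentially quantified constant in a statement that is polymorphic in the Hilbert space
  could depend on the type \<open>'a\<close>, hence on the dimension. Its size is not meant to be sharp.
\<close>

definition abs_const :: real where
  "abs_const = 1 / 10 ^ 6"

definition gtrsim :: "real \<Rightarrow> real \<Rightarrow> bool" (infix "\<greatersim>" 50) where
  "f \<greatersim> g \<longleftrightarrow> abs_const * g \<le> f"

end

theory Submission
  imports Defs
begin

text \<open>
  The law of the error \<open>\<eta> = w - w_star\<close> evolves by \<open>\<eta> \<mapsto> \<eta> - g \<langle>x, \<eta>\<rangle> x + s g \<epsilon> x\<close>: SGD is the
  case \<open>s = 1\<close> started at \<open>w0 - w_star\<close>, the bias iterates are the second moments for \<open>s = 0\<close>, and the
  variance iterates are those for \<open>s = 1\<close> started at \<open>0\<close>. Dually, one step acts on quadratic forms by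
  \<open>E \<langle>\<eta>', A \<eta>'\<rangle> = E \<langle>\<eta>, T A \<eta>\<rangle> + s\<^sup>2 g\<^sup>2 \<sigma>\<^sup>2 E \<langle>x, A x\<rangle>\<close>, where \<open>T\<close> is the error step.
  As this is affine in \<open>s\<^sup>2\<close> and in the initial form, the decomposition into bias and variance follows by
  induction over all symmetric \<open>A\<close>. For the lower bounds, the fourth moment condition gives
  \<open>T A \<succeq> (I - g G) A (I - g G) + g\<^sup>2 \<beta> tr (G A) G\<close>; unrolling one phase and diagonalizing
  \<open>G\<close> reduces the claim to one inequality for each eigenvalue.
\<close>

subsection \<open>Geometrically decaying step sizes\<close>

text \<open>Operator recursions are awkward in infinite dimension: traces are limits over bases, and
  \<open>op_trace\<close> has a value only once all bases are shown to agree. Following laws turns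
  every quantity into a real integral of \<open>\<eta> \<bullet> A \<eta>\<close>; traces return
  only at the ends, through \<open>weak_cov_trace_has_sum\<close>. G and H need not commute, so no
  basis diagonalizes both phases. A phase is therefore bounded against an arbitrary positive form A:
  H for the target phase, \<open>Ptgt o\<^sub>L H o\<^sub>L Ptgt\<close> for the source phase. Only
  the diagonal entries of A in the eigenbasis of the phase's own covariance enter, and
  \<open>Deff\<close> and \<open>Dft\<close> are weighted sums of these. Constants: a direction
  whose step times eigenvalue is at most 1 / L keeps a squared contraction of at least exp (-5) >= 1
  / 150 over all remaining steps, since the steps decay geometrically. A factor 4 lost in the choice
  of the step level and one step lost by rounding turn 150 into 700. The variance then carries 1 /
  1400 and the drift terms 1 / (2 * 150 * 700), both above 10 ^ -6.\<close>

definition decayed :: "real \<Rightarrow> real \<Rightarrow> nat \<Rightarrow> real" where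
  "decayed L x t = x / 2 ^ nat \<lfloor>real t / L\<rfloor>"

lemma decayed_nonneg: "0 \<le> x \<Longrightarrow> 0 \<le> decayed L x t"
  by (simp add: decayed_def)

lemma phase_index_iff:
  assumes "L > 0"
  shows "nat \<lfloor>real s / L\<rfloor> = p \<longleftrightarrow> real p * L \<le> real s \<and> real s < (real p + 1) * L"
proof -
  have "nat \<lfloor>real s / L\<rfloor> = p \<longleftrightarrow> \<lfloor>real s / L\<rfloor> = int p"
    using assms by (simp add: nat_eq_iff)
  also have "\<dots> \<longleftrightarrow> real p \<le> real s / L \<and> real s / L < real p + 1"
    by (simp add: floor_eq_iff)
  finally show ?thesis
    using assms by (simp add: pos_le_divide_eq pos_divide_less_eq)
qed

text \<open>The length L need not be an integer, so the phase is an interval between rounded-up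
  endpoints. Both ends round the same way, hence consecutive phases tile the steps.\<close>

lemma phase_as_interval:
  assumes "L > 0"
  shows "{s::nat. nat \<lfloor>real s / L\<rfloor> = p} = {nat \<lceil>real p * L\<rceil>..<nat \<lceil>(real p + 1) * L\<rceil>}"
proof -
  have "real p * L \<le> real s \<longleftrightarrow> nat \<lceil>real p * L\<rceil> \<le> s" for s
    by (simp add: nat_le_iff ceiling_le_iff)
  moreover have "real s < (real p + 1) * L \<longleftrightarrow> s < nat \<lceil>(real p + 1) * L\<rceil>" for s
    by (simp add: zless_nat_eq_int_zless less_ceiling_iff)
  ultimately show ?thesis
    unfolding phase_index_iff[OF assms] set_eq_iff mem_Collect_eq atLeastLessThan_iff by blast
qed

text \<open>Rounding moves each endpoint by less than one in the same direction, which changes the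
  count by at most one either way.\<close>

lemma phase_card:
  assumes "L > 0"
  shows "finite {s::nat. nat \<lfloor>real s / L\<rfloor> = p}"
    and "L - 1 \<le> real (card {s::nat. nat \<lfloor>real s / L\<rfloor> = p})"
    and "real (card {s::nat. nat \<lfloor>real s / L\<rfloor> = p}) \<le> L + 1"
proof -
  show "finite {s::nat. nat \<lfloor>real s / L\<rfloor> = p}"
    by (simp add: phase_as_interval[OF assms])
  have a: "real (nat \<lceil>real p * L\<rceil>) = of_int \<lceil>real p * L\<rceil>"
    using assms by (simp add: less_imp_le)
  have b: "real (nat \<lceil>(real p + 1) * L\<rceil>) = of_int \<lceil>(real p + 1) * L\<rceil>"
    using assms by (simp add: less_imp_le del: ceiling_add_one)
  have "nat \<lceil>real p * L\<rceil> \<le> nat \<lceil>(real p + 1) * L\<rceil>"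
    using assms by (intro nat_mono ceiling_mono) simp
  then have c: "real (card {s::nat. nat \<lfloor>real s / L\<rfloor> = p})
      = of_int \<lceil>(real p + 1) * L\<rceil> - of_int \<lceil>real p * L\<rceil>"
    by (simp only: phase_as_interval[OF assms] card_atLeastLessThan of_nat_diff a b)
  have d: "(real p + 1) * L = real p * L + L" by (simp add: algebra_simps)
  show "L - 1 \<le> real (card {s::nat. nat \<lfloor>real s / L\<rfloor> = p})"
    unfolding c d by linarith
  show "real (card {s::nat. nat \<lfloor>real s / L\<rfloor> = p}) \<le> L + 1"
    unfolding c d by linarith
qed

lemma geometric_tail_le: "(\<Sum>p\<in>{k..n}. 1 / 2 ^ p) \<le> (2::real) / 2 ^ k"
proof (cases "k \<le> n")
  case True
  then have "(\<Sum>p\<in>{k..n}. 1 / 2 ^ p) = (2::real) / 2 ^ k - 1 / 2 ^ n"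
  proof (induction n rule: dec_induct)
    case base
    then show ?case by (simp add: field_simps)
  next
    case (step n)
    then show ?case by simp
  qed
  then show ?thesis by simp
qed simp

lemma phase_tail_sum_le:
  assumes L: "L \<ge> 1"
  shows "(\<Sum>s\<in>{s. s < n \<and> k \<le> nat \<lfloor>real s / L\<rfloor>}. 1 / 2 ^ nat \<lfloor>real s / L\<rfloor>) \<le> (L + 1) * (2 / 2 ^ k)"
proof -
  let ?S = "{s. s < n \<and> k \<le> nat \<lfloor>real s / L\<rfloor>}" and ?p = "\<lambda>s. nat \<lfloor>real s / L\<rfloor>"
  \<comment> \<open>Since L >= 1, a step below n also has phase index below n, so grouping over the
    phases \<open>{k..n}\<close> loses nothing.\<close>
  have p_le: "?p s \<le> s" for s
  proof -
    have "real s / L \<le> real s"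
      using L by (simp add: divide_le_eq mult_le_cancel_left1)
    then have "\<lfloor>real s / L\<rfloor> \<le> int s" by linarith
    then show ?thesis by simp
  qed
  have "(\<Sum>s\<in>?S. 1 / 2 ^ ?p s) = (\<Sum>p\<in>{k..n}. \<Sum>s | s \<in> ?S \<and> ?p s = p. (1::real) / 2 ^ ?p s)"
    using p_le by (subst sum.group) (auto intro: order_trans[OF p_le less_imp_le])
  also have "\<dots> \<le> (\<Sum>p\<in>{k..n}. (L + 1) * (1 / 2 ^ p))"
  proof (intro sum_mono)
    fix p
    have "(\<Sum>s | s \<in> ?S \<and> ?p s = p. (1::real) / 2 ^ ?p s) = real (card {s \<in> ?S. ?p s = p}) * (1 / 2 ^ p)"
      by simp
    also have "\<dots> \<le> (L + 1) * (1 / 2 ^ p)"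
    proof (intro mult_right_mono)
      have "card {s \<in> ?S. ?p s = p} \<le> card {s. ?p s = p}"
        using L by (intro card_mono phase_card) auto
      then show "real (card {s \<in> ?S. ?p s = p}) \<le> L + 1"
        using phase_card(3)[of L p] L by linarith
    qed simp
    finally show "(\<Sum>s | s \<in> ?S \<and> ?p s = p. (1::real) / 2 ^ ?p s) \<le> (L + 1) * (1 / 2 ^ p)" .
  qed
  also have "\<dots> \<le> (L + 1) * (2 / 2 ^ k)"
    unfolding sum_distrib_left[symmetric] using L by (intro mult_left_mono geometric_tail_le) auto
  finally show ?thesis .
qed

section \<open>Lower bounds for products of contraction factors\<close>

lemma one_minus_ge_exp:
  fixes x :: real
  assumes "0 \<le> x" "x \<le> 1 / 10"
  shows "exp (- (10/9) * x) \<le> 1 - x"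
proof -
  have "0 \<le> x * (1/10 - x)" using assms by simp
  then have "1 \<le> (1 - x) * (1 + (10/9) * x)" by (simp add: algebra_simps)
  also have "\<dots> \<le> (1 - x) * exp ((10/9) * x)"
    using assms exp_ge_add_one_self[of "(10/9) * x"] by (intro mult_left_mono) auto
  finally show ?thesis by (simp add: exp_minus divide_simps mult.commute)
qed

text \<open>For x <= 1/10 the logarithm of 1 - x is at least -(10/9) x, where 10/9 is 1 / (1 -
  1/10). The exponent of the square thus adds up to at most 2 * (10/9) * (11/5) < 5, and e < 2.72
  gives exp 5 <= 150.\<close>

lemma prod_one_minus_sq_ge:
  fixes x :: "nat \<Rightarrow> real"
  assumes "\<And>s. s \<in> S \<Longrightarrow> 0 \<le> x s" "\<And>s. s \<in> S \<Longrightarrow> x s \<le> 1 / 10" "sum x S \<le> 11 / 5" "finite S"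
  shows "1 / 150 \<le> (\<Prod>s\<in>S. 1 - x s)\<^sup>2"
proof -
  have "exp 5 = exp (1::real) ^ 5" by (simp flip: exp_of_nat_mult)
  also have "\<dots> \<le> (272/100) ^ 5" using e_less_272 by (intro power_mono) auto
  also have "\<dots> \<le> 150" by (simp add: power_divide)
  finally have "1 / 150 \<le> exp (- 5 :: real)" by (simp add: exp_minus divide_simps)
  also have "\<dots> \<le> exp (2 * (- (10/9) * sum x S))" using assms(3) by simp
  also have "\<dots> = (exp (- (10/9) * sum x S))\<^sup>2" by (rule exp_double)
  also have "\<dots> = (\<Prod>s\<in>S. exp (- (10/9) * x s))\<^sup>2"
    unfolding sum_distrib_left by (simp add: exp_sum assms(4))
  also have "\<dots> \<le> (\<Prod>s\<in>S. 1 - x s)\<^sup>2"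
    using assms by (intro power_mono prod_mono conjI one_minus_ge_exp prod_nonneg) auto
  finally show ?thesis .
qed

text \<open>In use \<open>x\<close> is the initial step size times an eigenvalue, and the product is
  the contraction of that eigendirection over the steps in \<open>S\<close>. From phase k on, the
  terms sum to at most (x / 2 ^ k) * 2 * (L + 1) <= 2 * (L + 1) / L, which is at most 11/5 for L >=
  10.\<close>

lemma decayed_prod_ge:
  assumes L: "L \<ge> 10" and y: "0 \<le> x" "x / 2 ^ k \<le> 1 / L"
    and S: "S \<subseteq> {s. s < n \<and> k \<le> nat \<lfloor>real s / L\<rfloor>}"
  shows "1 / 150 \<le> (\<Prod>s\<in>S. 1 - decayed L x s)\<^sup>2"
proof (intro prod_one_minus_sq_ge)
  let ?T = "{s. s < n \<and> k \<le> nat \<lfloor>real s / L\<rfloor>}"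
  have y10: "x / 2 ^ k \<le> 1 / 10"
    using y(2) L by (rule_tac order_trans[OF y(2)]) (simp add: divide_simps)
  show "0 \<le> decayed L x s" for s using y(1) by (rule decayed_nonneg)
  show "decayed L x s \<le> 1 / 10" if "s \<in> S" for s
  proof -
    have "decayed L x s \<le> x / 2 ^ k"
      unfolding decayed_def using that S y(1) by (intro divide_left_mono power_increasing) auto
    then show ?thesis using y10 by linarith
  qed
  show "finite S" by (rule finite_subset[OF S]) simp
  have "sum (decayed L x) S \<le> sum (decayed L x) ?T"
    using S y(1) by (intro sum_mono2) (auto simp: decayed_nonneg)
  also have "\<dots> = x * (\<Sum>s\<in>?T. 1 / 2 ^ nat \<lfloor>real s / L\<rfloor>)"
    by (simp add: decayed_def sum_distrib_left)
  also have "\<dots> \<le> x * ((L + 1) * (2 / 2 ^ k))"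
    using y(1) L by (intro mult_left_mono phase_tail_sum_le) auto
  also have "\<dots> = (x / 2 ^ k) * (2 * (L + 1))" by simp
  also have "\<dots> \<le> (1 / L) * (2 * (L + 1))" using y(2) L by (intro mult_right_mono) auto
  also have "\<dots> \<le> 11 / 5" using L by (simp add: field_simps)
  finally show "sum (decayed L x) S \<le> 11 / 5" .
qed

text \<open>The bound bootstraps: log >= 1 forces n >= 10, hence log >= 3, hence n >= 30, hence log
  >= 4. For n = 0 and n = 1 totalized division makes \<open>eff_size\<close> zero, which the
  hypothesis excludes.\<close>

lemma eff_size_ge_10_imp:
  assumes "eff_size n \<ge> 10"
  shows "16 \<le> n" "eff_size n = real n / log 2 (real n)" "4 \<le> log 2 (real n)"
proof -
  have n2: "n \<ge> 2"
  proof (rule ccontr)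
    assume "\<not> n \<ge> 2"
    then have "n = 0 \<or> n = 1" by linarith
    then show False using assms by (auto simp: eff_size_def)
  qed
  then have "log 2 2 \<le> log 2 (real n)" by (subst log_le_cancel_iff) auto
  then have l1: "1 \<le> log 2 (real n)" by simp
  then have le: "10 * log 2 (real n) \<le> real n"
    using assms by (simp add: eff_size_def pos_le_divide_eq)
  then have "10 \<le> real n" using l1 by linarith
  then have "log 2 (2 ^ 3) \<le> log 2 (real n)" by (subst log_le_cancel_iff) auto
  then have "3 \<le> log 2 (real n)" using log_pow_cancel[of 2 3] by simp
  then have *: "30 \<le> real n" using le by linarith
  then show "16 \<le> n" by linarith
  have "log 2 (2 ^ 4) \<le> log 2 (real n)" using * by (subst log_le_cancel_iff) auto
  then show "4 \<le> log 2 (real n)" using log_pow_cancel[of 2 4] by simp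
qed (simp add: eff_size_def)

text \<open>
  Only one phase is needed: the first one in which the decayed step \<open>x / 2 ^ k\<close> drops below
  \<open>1 / L\<close>. As \<open>x \<le> 1\<close>, it ends before step \<open>n\<close>.
\<close>

lemma decayed_variance_sum_ge:
  assumes L: "L = eff_size n" "L \<ge> 10" and x: "0 < x" "x \<le> 1"
  shows "min 1 ((L * x)\<^sup>2) / (700 * L) \<le>
    (\<Sum>t<n. (decayed L x t)\<^sup>2 * (\<Prod>s\<in>{t+1..<n}. 1 - decayed L x s)\<^sup>2)"
proof -
  note n = eff_size_ge_10_imp[OF L(2)[unfolded L(1)]]
  have Ln: "L * log 2 (real n) = real n" using n L(1) by simp
  obtain k0 :: nat where "x * L < 2 ^ k0" using real_arch_pow[of 2 "x * L"] by auto
  then have ex: "\<exists>k. x * L \<le> 2 ^ k" by (intro exI[of _ k0]) linarith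
  define k where "k = (LEAST k. x * L \<le> 2 ^ k)"
  have k: "x * L \<le> 2 ^ k" unfolding k_def using ex by (rule LeastI_ex)
  \<comment> \<open>Minimality of k: either the first phase is already small enough, or the previous
    power of two fails, so that \<open>x / 2 ^ k\<close> stays above
    \<open>1 / (2 * L)\<close>.\<close>
  have kcase: "k = 0 \<or> 2 ^ k < 2 * (x * L)"
  proof (cases k)
    case (Suc m)
    then have "\<not> x * L \<le> 2 ^ m" using not_less_Least[of m "\<lambda>k. x * L \<le> 2 ^ k"] by (auto simp: k_def)
    then show ?thesis using Suc by simp
  qed simp
  define y where "y = x / 2 ^ k"
  have y: "y \<le> 1 / L" "0 < y"
    using k x L(2) by (auto simp: y_def divide_simps mult.commute)
  \<comment> \<open>The chosen phase ends in time: for k > 0, 2 ^ (k + 1) < 4 * x * L <= 4 * L <= n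
    because log n >= 4. Taking logarithms gives k + 1 <= log n, and this logarithm is n / L.\<close>
  have fits: "(real k + 1) * L \<le> real n"
  proof -
    have "(2::real) ^ (k + 1) \<le> real n"
    proof (cases "k = 0")
      case False
      then have "2 ^ k < 2 * (x * L)" using kcase by auto
      moreover have "x * L \<le> L" using x L(2) by (simp add: mult_le_cancel_right1)
      moreover have "4 * L \<le> L * log 2 (real n)" using n(3) L(2) by simp
      ultimately show ?thesis using Ln by simp
    qed (use n(1) in simp)
    then have "log 2 (2 ^ (k + 1)) \<le> log 2 (real n)" using n(1) by (subst log_le_cancel_iff) auto
    then have "real k + 1 \<le> log 2 (real n)" by (subst (asm) log_nat_power) (auto simp: algebra_simps)
    then have "(real k + 1) * L \<le> log 2 (real n) * L" using L(2) by (intro mult_right_mono) auto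
    then show ?thesis using Ln by (simp add: mult.commute)
  qed
  let ?P = "{s::nat. nat \<lfloor>real s / L\<rfloor> = k}"
  have P_lt: "s < n" if "s \<in> ?P" for s
    using that fits phase_index_iff[of L s k] L(2) by auto
  \<comment> \<open>Every step of the chosen phase has size y, and all later steps lie in phases of
    index at least k, where the remaining contraction is under control.\<close>
  have term_ge: "y\<^sup>2 * (1 / 150) \<le> (decayed L x t)\<^sup>2 * (\<Prod>s\<in>{t+1..<n}. 1 - decayed L x s)\<^sup>2"
    if t: "t \<in> ?P" for t
  proof -
    have eq: "decayed L x t = y" using t by (simp add: decayed_def y_def)
    have mono: "k \<le> nat \<lfloor>real s / L\<rfloor>" if "t < s" for s
    proof -
      have "\<lfloor>real t / L\<rfloor> \<le> \<lfloor>real s / L\<rfloor>"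
        using that L(2) by (intro floor_mono divide_right_mono) auto
      then show ?thesis using t by auto
    qed
    have "1 / 150 \<le> (\<Prod>s\<in>{t+1..<n}. 1 - decayed L x s)\<^sup>2"
      by (rule decayed_prod_ge[OF L(2), of x k _ n]) (use x y mono in \<open>auto simp: y_def\<close>)
    then show ?thesis unfolding eq by (intro mult_left_mono) auto
  qed
  \<comment> \<open>Rounding to a power of two costs less than a factor 2 in the step, hence 4 in
    its square; for k = 0 nothing is lost, as y = x.\<close>
  have ym: "min 1 ((L * x)\<^sup>2) \<le> 4 * (L * y)\<^sup>2"
  proof (cases "k = 0")
    case True
    have "0 \<le> (L * x)\<^sup>2" by simp
    then show ?thesis using True by (simp add: y_def min_le_iff_disj)
  next
    case False
    then have "2 ^ k < 2 * (x * L)" using kcase by auto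
    then have "1 \<le> 2 * (L * y)" using L(2) by (simp add: y_def field_simps)
    then have "1 \<le> (2 * (L * y))\<^sup>2" by (rule one_le_power)
    then show ?thesis by (simp add: power_mult_distrib)
  qed
  have "min 1 ((L * x)\<^sup>2) / (700 * L) \<le> 4 * (L * y)\<^sup>2 / (700 * L)"
    using ym L(2) by (intro divide_right_mono) auto
  also have "\<dots> = L * y\<^sup>2 * (4 / 700)" using L(2) by (simp add: power2_eq_square field_simps)
  \<comment> \<open>Origin of 700: 4 * 150 = 600, and the phase may have only L - 1 steps, which is
    still at least 6/7 of L.\<close>
  also have "\<dots> \<le> (L - 1) * (y\<^sup>2 * (1 / 150))"
  proof -
    have "L * (4 / 700) \<le> (L - 1) * (1 / 150)" using L(2) by (simp add: field_simps)
    from mult_right_mono[OF this zero_le_power2[of y]] show ?thesis by (simp add: algebra_simps)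
  qed
  also have "\<dots> \<le> real (card ?P) * (y\<^sup>2 * (1 / 150))"
    using phase_card(2)[of L k] L(2) by (intro mult_right_mono) auto
  also have "\<dots> = (\<Sum>t\<in>?P. y\<^sup>2 * (1 / 150))" by simp
  also have "\<dots> \<le> (\<Sum>t\<in>?P. (decayed L x t)\<^sup>2 * (\<Prod>s\<in>{t+1..<n}. 1 - decayed L x s)\<^sup>2)"
    by (intro sum_mono term_ge)
  also have "\<dots> \<le> (\<Sum>t<n. (decayed L x t)\<^sup>2 * (\<Prod>s\<in>{t+1..<n}. 1 - decayed L x s)\<^sup>2)"
    using P_lt by (intro sum_mono2) auto
  finally show ?thesis .
qed

subsection \<open>Hilbert space operators, covariances and traces\<close>

text \<open>The coefficients are left free: Fourier coefficients kill the last sum and give Bessel's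
  inequality, arbitrary ones give the best approximation property behind the expansion.\<close>

lemma norm_sq_diff_orthonormal_sum:
  fixes x :: "'a::real_inner"
  assumes "finite Y" "pairwise orthogonal Y" "\<And>e. e \<in> Y \<Longrightarrow> norm e = 1"
  shows "(norm (x - (\<Sum>e\<in>Y. c e *\<^sub>R e)))\<^sup>2
    = (norm x)\<^sup>2 - (\<Sum>e\<in>Y. (x \<bullet> e)\<^sup>2) + (\<Sum>e\<in>Y. (c e - x \<bullet> e)\<^sup>2)"
proof -
  have ee: "e \<bullet> e = 1" if "e \<in> Y" for e
    using assms(3)[OF that] by (simp add: dot_square_norm)
  have "(\<Sum>e\<in>Y. c e *\<^sub>R e) \<bullet> (\<Sum>e\<in>Y. c e *\<^sub>R e) = (\<Sum>e\<in>Y. \<Sum>f\<in>Y. c e * c f * (e \<bullet> f))"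
    unfolding inner_sum_left inner_sum_right
    by (intro sum.cong refl) (simp add: sum_distrib_left inner_commute mult_ac)
  also have "\<dots> = (\<Sum>e\<in>Y. (c e)\<^sup>2)"
  proof (intro sum.cong refl)
    fix e assume e: "e \<in> Y"
    have "(\<Sum>f\<in>Y. c e * c f * (e \<bullet> f)) = (\<Sum>f\<in>Y. if f = e then (c e)\<^sup>2 else 0)"
      using e assms(2) ee
      by (intro sum.cong) (auto simp: pairwise_def orthogonal_def power2_eq_square)
    then show "(\<Sum>f\<in>Y. c e * c f * (e \<bullet> f)) = (c e)\<^sup>2"
      using e assms(1) by simp
  qed
  finally have *: "(\<Sum>e\<in>Y. c e *\<^sub>R e) \<bullet> (\<Sum>e\<in>Y. c e *\<^sub>R e) = (\<Sum>e\<in>Y. (c e)\<^sup>2)" .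
  have "(norm (x - (\<Sum>e\<in>Y. c e *\<^sub>R e)))\<^sup>2
      = x \<bullet> x - 2 * (\<Sum>e\<in>Y. c e * (x \<bullet> e)) + (\<Sum>e\<in>Y. (c e)\<^sup>2)"
    unfolding power2_norm_eq_inner inner_diff_left inner_diff_right *
    by (simp add: inner_sum_right inner_sum_left inner_commute)
  also have "\<dots> = (norm x)\<^sup>2 - (\<Sum>e\<in>Y. (x \<bullet> e)\<^sup>2) + (\<Sum>e\<in>Y. (c e - x \<bullet> e)\<^sup>2)"
    by (simp add: power2_norm_eq_inner power2_diff sum.distrib sum_subtractf sum_distrib_left algebra_simps)
  finally show ?thesis .
qed

lemma bessel_inequality:
  fixes x :: "'a::real_inner"
  assumes "orthonormal_basis B" "finite Y" "Y \<subseteq> B"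
  shows "(\<Sum>e\<in>Y. (x \<bullet> e)\<^sup>2) \<le> (norm x)\<^sup>2"
proof -
  have "(norm (x - (\<Sum>e\<in>Y. (x \<bullet> e) *\<^sub>R e)))\<^sup>2 = (norm x)\<^sup>2 - (\<Sum>e\<in>Y. (x \<bullet> e)\<^sup>2)"
    using assms by (subst norm_sq_diff_orthonormal_sum)
      (auto simp: orthonormal_basis_def intro: pairwise_subset)
  then show ?thesis using zero_le_power2[of "norm (x - (\<Sum>e\<in>Y. (x \<bullet> e) *\<^sub>R e))"] by linarith
qed

text \<open>The bound is uniform in \<open>Y\<close>, so it can serve as a dominating function when
  sums over a basis are exchanged with expectations. For that purpose the crude inequality between
  product and squares is enough.\<close>

lemma bessel_inequality_abs_inner:
  fixes x :: "'a::real_inner"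
  assumes "orthonormal_basis B" "finite Y" "Y \<subseteq> B"
  shows "(\<Sum>e\<in>Y. \<bar>(x \<bullet> e) * (e \<bullet> y)\<bar>) \<le> (norm x)\<^sup>2 + (norm y)\<^sup>2"
proof -
  have "\<bar>(x \<bullet> e) * (e \<bullet> y)\<bar> \<le> (x \<bullet> e)\<^sup>2 + (y \<bullet> e)\<^sup>2" for e
  proof -
    have "2 * (\<bar>x \<bullet> e\<bar> * \<bar>y \<bullet> e\<bar>) \<le> \<bar>x \<bullet> e\<bar>\<^sup>2 + \<bar>y \<bullet> e\<bar>\<^sup>2"
      using sum_squares_bound[of "\<bar>x \<bullet> e\<bar>" "\<bar>y \<bullet> e\<bar>"] by simp
    moreover have "0 \<le> \<bar>x \<bullet> e\<bar> * \<bar>y \<bullet> e\<bar>" by simp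
    ultimately show ?thesis unfolding abs_mult power2_abs inner_commute[of e y] by linarith
  qed
  then have "(\<Sum>e\<in>Y. \<bar>(x \<bullet> e) * (e \<bullet> y)\<bar>) \<le> (\<Sum>e\<in>Y. (x \<bullet> e)\<^sup>2) + (\<Sum>e\<in>Y. (y \<bullet> e)\<^sup>2)"
    by (simp add: sum_mono flip: sum.distrib)
  then show ?thesis
    using bessel_inequality[OF assms, of x] bessel_inequality[OF assms, of y] by linarith
qed

lemma orthonormal_expansion:
  fixes x :: "'a::real_inner"
  assumes B: "orthonormal_basis B"
  shows "((\<lambda>e. (x \<bullet> e) *\<^sub>R e) has_sum x) B"
  unfolding has_sum_def tendsto_iff eventually_finite_subsets_at_top
proof (intro allI impI)
  fix \<epsilon> :: real assume "\<epsilon> > 0"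
  have "x \<in> closure (span B)" using B by (simp add: orthonormal_basis_def)
  then obtain s where s: "s \<in> span B" "dist s x < \<epsilon>"
    using \<open>\<epsilon> > 0\<close> by (auto simp: closure_approachable)
  then obtain t r where t: "finite t" "t \<subseteq> B" "s = (\<Sum>a\<in>t. r a *\<^sub>R a)"
    by (auto simp: span_explicit)
  have "dist (\<Sum>e\<in>Y. (x \<bullet> e) *\<^sub>R e) x < \<epsilon>" if Y: "finite Y" "t \<subseteq> Y" "Y \<subseteq> B" for Y
  proof -
    have on: "finite Y" "pairwise orthogonal Y" "\<And>e. e \<in> Y \<Longrightarrow> norm e = 1"
      using Y B by (auto simp: orthonormal_basis_def intro: pairwise_subset)
    \<comment> \<open>The approximant \<open>s\<close> from the dense span gets zero coefficients on
      the rest of \<open>Y\<close>; the Fourier sum over \<open>Y\<close> is then at least as close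
      to \<open>x\<close> as \<open>s\<close> is.\<close>
    let ?c = "\<lambda>a. if a \<in> t then r a else 0"
    have "s = (\<Sum>a\<in>Y. ?c a *\<^sub>R a)"
      unfolding t(3) using Y by (intro sum.mono_neutral_cong_left) auto
    then have "(norm (x - s))\<^sup>2
        = (norm x)\<^sup>2 - (\<Sum>e\<in>Y. (x \<bullet> e)\<^sup>2) + (\<Sum>e\<in>Y. (?c e - x \<bullet> e)\<^sup>2)"
      using norm_sq_diff_orthonormal_sum[OF on] by simp
    moreover have "(norm (x - (\<Sum>e\<in>Y. (x \<bullet> e) *\<^sub>R e)))\<^sup>2 = (norm x)\<^sup>2 - (\<Sum>e\<in>Y. (x \<bullet> e)\<^sup>2)"
      using norm_sq_diff_orthonormal_sum[OF on, of x "\<lambda>e. x \<bullet> e"] by simp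
    moreover have "0 \<le> (\<Sum>e\<in>Y. (?c e - x \<bullet> e)\<^sup>2)" by (intro sum_nonneg) simp
    ultimately have "(norm (x - (\<Sum>e\<in>Y. (x \<bullet> e) *\<^sub>R e)))\<^sup>2 \<le> (norm (x - s))\<^sup>2"
      by linarith
    then have "norm (x - (\<Sum>e\<in>Y. (x \<bullet> e) *\<^sub>R e)) \<le> norm (x - s)"
      by (rule power2_le_imp_le) simp
    then show ?thesis using s(2) by (simp add: dist_norm norm_minus_commute)
  qed
  with t show "\<exists>X. finite X \<and> X \<subseteq> B \<and>
      (\<forall>Y. finite Y \<and> X \<subseteq> Y \<and> Y \<subseteq> B \<longrightarrow> dist (\<Sum>e\<in>Y. (x \<bullet> e) *\<^sub>R e) x < \<epsilon>)"
    by blast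
qed

lemma parseval:
  fixes x y :: "'a::real_inner"
  assumes "orthonormal_basis B"
  shows "((\<lambda>e. (x \<bullet> e) * (e \<bullet> y)) has_sum (x \<bullet> y)) B"
  using has_sum_bounded_linear[OF bounded_linear_inner_left orthonormal_expansion[OF assms]]
  by (simp add: o_def)

text \<open>Distinct basis vectors are at distance sqrt 2, so the balls of radius 1/2 around them
  are disjoint open sets, of which a separable space has only countably many. Countability permits
  dominated convergence along a sequence of partial sums.\<close>

lemma orthonormal_basis_countable:
  fixes B :: "'a::{real_inner, second_countable_topology} set"
  assumes B: "orthonormal_basis B"
  shows "countable B"
proof -
  have dist: "dist a b \<ge> 1" if "a \<in> B" "b \<in> B" "a \<noteq> b" for a b
  proof -
    have "a \<bullet> a = 1" "b \<bullet> b = 1" "a \<bullet> b = 0"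
      using that B by (auto simp: orthonormal_basis_def pairwise_def orthogonal_def dot_square_norm)
    then have "(dist a b)\<^sup>2 = 2"
      by (simp add: dist_norm power2_norm_eq_inner inner_diff_left inner_diff_right inner_commute)
    then show ?thesis by (intro power2_le_imp_le[of 1]) auto
  qed
  let ?U = "\<lambda>e. ball e (1/2)"
  have inj: "inj_on ?U B"
  proof (rule inj_onI, rule ccontr)
    fix a b assume ab: "a \<in> B" "b \<in> B" "?U a = ?U b" "a \<noteq> b"
    then have "a \<in> ?U b" by (metis centre_in_ball half_gt_zero_iff zero_less_one)
    then show False using dist[of b a] ab by simp
  qed
  have "countable (?U ` B)"
  proof (rule countable_disjoint_open_subsets)
    show "disjoint (?U ` B)"
    proof (rule pairwiseI)
      fix S T assume "S \<in> ?U ` B" "T \<in> ?U ` B" "S \<noteq> T"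
      then obtain a b where ab: "a \<in> B" "b \<in> B" "a \<noteq> b" "S = ?U a" "T = ?U b" by auto
      have False if "z \<in> S" "z \<in> T" for z
        using that ab dist[OF ab(1-3)] dist_triangle[of a b z] by (auto simp: dist_commute)
      then show "disjnt S T" by (auto simp: disjnt_def)
    qed
  qed auto
  then show ?thesis using inj by (rule countable_image_inj_on)
qed

section \<open>Symmetric and positive operators\<close>

lemma symmetric_opD: "symmetric_op A \<Longrightarrow> blinfun_apply A x \<bullet> y = x \<bullet> blinfun_apply A y"
  by (simp add: symmetric_op_def)

lemma symmetric_op_id [simp]: "symmetric_op id_blinfun"
  by (simp add: symmetric_op_def)

lemma symmetric_op_add: "symmetric_op A \<Longrightarrow> symmetric_op B \<Longrightarrow> symmetric_op (A + B)"
  by (simp add: symmetric_op_def plus_blinfun.rep_eq inner_add_left inner_add_right)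

lemma symmetric_op_diff: "symmetric_op A \<Longrightarrow> symmetric_op B \<Longrightarrow> symmetric_op (A - B)"
  by (simp add: symmetric_op_def minus_blinfun.rep_eq inner_diff_left inner_diff_right)

lemma symmetric_op_scaleR: "symmetric_op A \<Longrightarrow> symmetric_op (c *\<^sub>R A)"
  by (simp add: symmetric_op_def scaleR_blinfun.rep_eq)

lemma symmetric_op_sandwich: "symmetric_op A \<Longrightarrow> symmetric_op P \<Longrightarrow> symmetric_op (P o\<^sub>L A o\<^sub>L P)"
  by (simp add: symmetric_op_def)

lemma symmetric_op_anticommutator:
  assumes "symmetric_op A" "symmetric_op B"
  shows "symmetric_op ((A o\<^sub>L B) + (B o\<^sub>L A))"
proof -
  have "A (B x) \<bullet> y = x \<bullet> B (A y)" "B (A x) \<bullet> y = x \<bullet> A (B y)" for x y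
    using assms by (simp_all add: symmetric_op_def)
  then show ?thesis
    by (simp add: symmetric_op_def plus_blinfun.rep_eq inner_add_left inner_add_right)
qed

text \<open>Polarization: for symmetric operators the quadratic form determines the bilinear form.
  This is why a covariance needs checking on the diagonal only.\<close>

lemma symmetric_op_eqI:
  fixes A B :: "'a::real_inner \<Rightarrow>\<^sub>L 'a"
  assumes A: "symmetric_op A" and B: "symmetric_op B" and q: "\<And>v. v \<bullet> A v = v \<bullet> B v"
  shows "A = B"
proof (rule blinfun_eqI)
  fix v
  have "u \<bullet> A v = u \<bullet> B v" for u
  proof -
    have *: "(u + v) \<bullet> C (u + v) = u \<bullet> C u + v \<bullet> C v + 2 * (u \<bullet> C v)" if "symmetric_op C" for C
      using that by (simp add: symmetric_op_def blinfun.add_right inner_add_left inner_add_right)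
        (simp add: inner_commute)
    show ?thesis using *[OF A] *[OF B] q[of "u + v"] q[of u] q[of v] by simp
  qed
  then show "A v = B v" by (metis vector_eq_rdot inner_commute)
qed

lemma psdD: "psd A \<Longrightarrow> symmetric_op A" "psd A \<Longrightarrow> 0 \<le> v \<bullet> blinfun_apply A v"
  by (auto simp: psd_def)

lemma psd_sandwich:
  assumes "psd A" "symmetric_op P"
  shows "psd (P o\<^sub>L A o\<^sub>L P)"
  unfolding psd_def
proof (intro conjI allI)
  show "symmetric_op (P o\<^sub>L A o\<^sub>L P)" using assms by (intro symmetric_op_sandwich) (auto simp: psd_def)
  fix v
  have "v \<bullet> P (A (P v)) = P v \<bullet> A (P v)" using symmetric_opD[OF assms(2)] by simp
  then show "0 \<le> v \<bullet> blinfun_apply (P o\<^sub>L A o\<^sub>L P) v" using assms(1) by (simp add: psd_def)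
qed

lemma outer_apply: "blinfun_apply (outer u w) v = (w \<bullet> v) *\<^sub>R u"
  unfolding outer_def
  by (subst bounded_linear_Blinfun_apply) (auto intro!: bounded_linear_intros)

lemma symmetric_op_outer: "symmetric_op (outer v v)"
  by (simp add: symmetric_op_def outer_apply inner_commute)

lemma norm_outer_le: "norm (outer u w) \<le> norm u * norm w"
proof (rule norm_blinfun_bound)
  fix v
  have "norm ((w \<bullet> v) *\<^sub>R u) \<le> (norm w * norm v) * norm u"
    by (simp add: Cauchy_Schwarz_ineq2 mult_right_mono)
  then show "norm (outer u w v) \<le> norm u * norm w * norm v"
    by (simp add: outer_apply mult_ac)
qed simp

section \<open>Second moment operators with a scalar weight\<close>

context
  fixes M :: "'m measure" and X :: "'m \<Rightarrow> 'a::{real_inner, banach, second_countable_topology}"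
    and c :: "'m \<Rightarrow> real"
  assumes X[measurable]: "X \<in> borel_measurable M" and c[measurable]: "c \<in> borel_measurable M"
    and int: "integrable M (\<lambda>z. c z * (norm (X z))\<^sup>2)"
begin

lemma weighted_moment_integrable: "integrable M (\<lambda>z. (c z * (X z \<bullet> v)) *\<^sub>R X z)"
proof (rule Bochner_Integration.integrable_bound)
  show "integrable M (\<lambda>z. norm (c z * (norm (X z))\<^sup>2) * norm v)"
    using int by (intro integrable_mult_left integrable_norm)
  show "AE z in M. norm ((c z * (X z \<bullet> v)) *\<^sub>R X z) \<le> norm (norm (c z * (norm (X z))\<^sup>2) * norm v)"
  proof (rule AE_I2)
    fix z
    have "\<bar>c z\<bar> * \<bar>X z \<bullet> v\<bar> * norm (X z) \<le> \<bar>c z\<bar> * (norm (X z) * norm v) * norm (X z)"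
      by (intro mult_right_mono mult_left_mono Cauchy_Schwarz_ineq2) auto
    then show "norm ((c z * (X z \<bullet> v)) *\<^sub>R X z) \<le> norm (norm (c z * (norm (X z))\<^sup>2) * norm v)"
      by (simp add: abs_mult power2_eq_square mult_ac)
  qed
qed measurable

text \<open>\<open>Blinfun\<close> is meaningful only on bounded linear maps, so this fact gives
  access to \<open>second_moment\<close> (weight 1), \<open>fourth_moment\<close> (weight the form
  of \<open>A\<close> at the covariate) and \<open>noise_cov\<close> (weight the squared
  noise).\<close>

lemma weighted_moment_bounded_linear: "bounded_linear (\<lambda>v. LINT z|M. (c z * (X z \<bullet> v)) *\<^sub>R X z)"
proof (rule bounded_linear_intro)
  fix v w :: 'a and r :: real
  show "(LINT z|M. (c z * (X z \<bullet> (v + w))) *\<^sub>R X z)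
      = (LINT z|M. (c z * (X z \<bullet> v)) *\<^sub>R X z) + (LINT z|M. (c z * (X z \<bullet> w)) *\<^sub>R X z)"
    by (subst Bochner_Integration.integral_add[symmetric])
      (simp_all add: weighted_moment_integrable inner_add_right scaleR_add_left distrib_left)
  show "(LINT z|M. (c z * (X z \<bullet> (r *\<^sub>R v))) *\<^sub>R X z) = r *\<^sub>R (LINT z|M. (c z * (X z \<bullet> v)) *\<^sub>R X z)"
    by (subst integral_scaleR_right[symmetric]) (simp add: mult_ac)
  show "norm (LINT z|M. (c z * (X z \<bullet> v)) *\<^sub>R X z) \<le> norm v * (LINT z|M. norm (c z * (norm (X z))\<^sup>2))"
  proof -
    have "norm (LINT z|M. (c z * (X z \<bullet> v)) *\<^sub>R X z) \<le> (LINT z|M. norm ((c z * (X z \<bullet> v)) *\<^sub>R X z))"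
      by (rule integral_norm_bound)
    also have "\<dots> \<le> (LINT z|M. norm v * norm (c z * (norm (X z))\<^sup>2))"
    proof (rule integral_mono)
      show "integrable M (\<lambda>z. norm ((c z * (X z \<bullet> v)) *\<^sub>R X z))"
        by (intro integrable_norm weighted_moment_integrable)
      show "integrable M (\<lambda>z. norm v * norm (c z * (norm (X z))\<^sup>2))"
        using int by (intro integrable_mult_right integrable_norm)
      fix z
      have "\<bar>c z\<bar> * \<bar>X z \<bullet> v\<bar> * norm (X z) \<le> \<bar>c z\<bar> * (norm (X z) * norm v) * norm (X z)"
        by (intro mult_right_mono mult_left_mono Cauchy_Schwarz_ineq2) auto
      then show "norm ((c z * (X z \<bullet> v)) *\<^sub>R X z) \<le> norm v * norm (c z * (norm (X z))\<^sup>2)"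
        by (simp add: abs_mult power2_eq_square mult_ac)
    qed
    finally show ?thesis by simp
  qed
qed

lemma weighted_moment_inner:
  "u \<bullet> blinfun_apply (Blinfun (\<lambda>v. LINT z|M. (c z * (X z \<bullet> v)) *\<^sub>R X z)) v
    = (LINT z|M. c z * (X z \<bullet> u) * (X z \<bullet> v))"
proof -
  have "u \<bullet> (LINT z|M. (c z * (X z \<bullet> v)) *\<^sub>R X z) = (LINT z|M. u \<bullet> ((c z * (X z \<bullet> v)) *\<^sub>R X z))"
    by (rule integral_inner_right[symmetric]) (rule weighted_moment_integrable)
  then show ?thesis
    unfolding bounded_linear_Blinfun_apply[OF weighted_moment_bounded_linear]
    by (simp add: inner_commute mult_ac)
qed

lemma weighted_moment_inner_integrable: "integrable M (\<lambda>z. c z * (X z \<bullet> u) * (X z \<bullet> v))"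
  using integrable_inner_right[OF weighted_moment_integrable, of u v]
  by (simp add: inner_commute mult_ac)

end

text \<open>The uncentred covariance, fixed by its bilinear form. It covers the covariates, with
  \<open>X\<close> the first projection, and the error laws, with \<open>X\<close> the
  identity.\<close>

definition weak_cov :: "'m measure \<Rightarrow> ('m \<Rightarrow> 'a) \<Rightarrow> ('a::real_inner \<Rightarrow>\<^sub>L 'a) \<Rightarrow> bool" where
  "weak_cov M X C \<longleftrightarrow> (\<forall>u v. u \<bullet> blinfun_apply C v = (LINT z|M. (X z \<bullet> u) * (X z \<bullet> v)))"

lemma weak_cov_symmetric: "weak_cov M X C \<Longrightarrow> symmetric_op C"
  unfolding weak_cov_def symmetric_op_def by (metis (no_types, lifting) inner_commute mult.commute Bochner_Integration.integral_cong)

lemma weak_covI: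
  fixes X :: "'m \<Rightarrow> 'a::{real_inner, banach, second_countable_topology}"
  assumes X[measurable]: "X \<in> borel_measurable M" and int: "integrable M (\<lambda>z. (norm (X z))\<^sup>2)"
    and C: "symmetric_op C" and q: "\<And>v. v \<bullet> C v = (LINT z|M. (X z \<bullet> v)\<^sup>2)"
  shows "weak_cov M X C"
proof -
  have one: "integrable M (\<lambda>z. 1 * (norm (X z))\<^sup>2)" using int by simp
  let ?C = "Blinfun (\<lambda>v. LINT z|M. (1 * (X z \<bullet> v)) *\<^sub>R X z)"
  have C': "weak_cov M X ?C"
    using weighted_moment_inner[OF X _ one] by (simp add: weak_cov_def)
  have "C = ?C"
  proof (rule symmetric_op_eqI[OF C weak_cov_symmetric[OF C']])
    show "v \<bullet> C v = v \<bullet> ?C v" for v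
      using C' q[of v] unfolding weak_cov_def by (simp add: power2_eq_square)
  qed
  then show ?thesis using C' by simp
qed

text \<open>Parseval holds inside the expectation, and sum and expectation are exchanged. As the
  value on the right does not mention the basis, all bases agree, which is what gives
  \<open>op_trace\<close> a value.\<close>

lemma weak_cov_trace_has_sum:
  fixes X :: "'m \<Rightarrow> 'a::{real_inner, banach, second_countable_topology}"
  assumes X[measurable]: "X \<in> borel_measurable M" and int: "integrable M (\<lambda>z. (norm (X z))\<^sup>2)"
    and C: "weak_cov M X C" and A: "symmetric_op A" and E: "symmetric_op E"
    and B: "orthonormal_basis B"
  shows "((\<lambda>e. e \<bullet> A (C (E e))) has_sum (LINT z|M. A (X z) \<bullet> E (X z))) B"
proof -
  define f where "f e z = (A (X z) \<bullet> e) * (e \<bullet> E (X z))" for e z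
  have [measurable]: "(\<lambda>z. blinfun_apply A (X z)) \<in> borel_measurable M"
    "(\<lambda>z. blinfun_apply E (X z)) \<in> borel_measurable M"
    by (rule borel_measurable_continuous_on[OF _ X]; intro continuous_intros)+
  have [measurable]: "f e \<in> borel_measurable M" for e unfolding f_def by measurable
  \<comment> \<open>By Bessel this one function dominates the partial sums over all finite subsets
    of the basis; it is integrable because \<open>X\<close> is square integrable.\<close>
  define g where "g z = ((norm A)\<^sup>2 + (norm E)\<^sup>2) * (norm (X z))\<^sup>2" for z
  have g: "integrable M g" unfolding g_def using int by simp
  have bound: "(\<Sum>e\<in>Y. \<bar>f e z\<bar>) \<le> g z" if "finite Y" "Y \<subseteq> B" for Y z
  proof -
    have "(\<Sum>e\<in>Y. \<bar>f e z\<bar>) \<le> (norm (A (X z)))\<^sup>2 + (norm (E (X z)))\<^sup>2"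
      unfolding f_def by (rule bessel_inequality_abs_inner[OF B that])
    also have "\<dots> \<le> (norm A * norm (X z))\<^sup>2 + (norm E * norm (X z))\<^sup>2"
      by (intro add_mono power_mono norm_blinfun) auto
    finally show ?thesis by (simp add: g_def power_mult_distrib algebra_simps)
  qed
  have fint: "integrable M (f e)" if "e \<in> B" for e
  proof (rule Bochner_Integration.integrable_bound[OF g])
    have "norm (f e z) \<le> norm (g z)" for z using bound[of "{e}" z] that by simp
    then show "AE z in M. norm (f e z) \<le> norm (g z)" by simp
  qed measurable
  have eq: "e \<bullet> A (C (E e)) = (LINT z|M. f e z)" for e
  proof -
    have "e \<bullet> A (C (E e)) = A e \<bullet> C (E e)" using A by (simp add: symmetric_op_def)
    also have "\<dots> = (LINT z|M. (X z \<bullet> A e) * (X z \<bullet> E e))"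
      using C by (simp add: weak_cov_def)
    also have "\<dots> = (LINT z|M. f e z)"
      using A E by (intro Bochner_Integration.integral_cong)
        (simp_all add: f_def symmetric_op_def inner_commute[of e])
    finally show ?thesis .
  qed
  have pointwise: "((\<lambda>e. f e z) has_sum (A (X z) \<bullet> E (X z))) B" for z
    unfolding f_def by (rule parseval[OF B])
  \<comment> \<open>Absolute summability first provides some sum S; its value is identified
    afterwards along a sequence.\<close>
  have "(\<lambda>e. norm (LINT z|M. f e z)) summable_on B"
  proof (rule nonneg_bounded_partial_sums_imp_summable_on[where C = "integral\<^sup>L M g"])
    show "eventually (\<lambda>Y. (\<Sum>e\<in>Y. norm (LINT z|M. f e z)) \<le> integral\<^sup>L M g) (finite_subsets_at_top B)"
    proof (rule eventually_finite_subsets_at_top_weakI)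
      fix Y assume Y: "finite Y" "Y \<subseteq> B"
      have "(\<Sum>e\<in>Y. norm (LINT z|M. f e z)) \<le> (\<Sum>e\<in>Y. LINT z|M. \<bar>f e z\<bar>)"
        by (intro sum_mono) (use integral_norm_bound[of M] in simp)
      also have "\<dots> = (LINT z|M. (\<Sum>e\<in>Y. \<bar>f e z\<bar>))"
        using Y fint by (intro Bochner_Integration.integral_sum[symmetric]) auto
      also have "\<dots> \<le> integral\<^sup>L M g"
        using Y fint g bound
        by (intro integral_mono Bochner_Integration.integrable_sum integrable_abs) auto
      finally show "(\<Sum>e\<in>Y. norm (LINT z|M. f e z)) \<le> integral\<^sup>L M g" .
    qed
  qed simp
  then have "(\<lambda>e. LINT z|M. f e z) summable_on B" by (rule abs_summable_summable)
  then obtain S where S: "((\<lambda>e. LINT z|M. f e z) has_sum S) B" by (auto simp: summable_on_def)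
  \<comment> \<open>\<open>has_sum\<close> is a limit along the net of finite subsets, whereas
    dominated convergence runs along sequences. The sets \<open>F n\<close> exhaust the countable
    basis and are cofinal in that net.\<close>
  define F where "F n = {e \<in> B. to_nat_on B e \<le> n}" for n
  have cB: "countable B" using B by (rule orthonormal_basis_countable)
  have F: "finite (F n)" "F n \<subseteq> B" for n
  proof -
    show "F n \<subseteq> B" by (auto simp: F_def)
    have "inj_on (to_nat_on B) (F n)"
      using inj_on_to_nat_on[OF cB] by (rule inj_on_subset) (auto simp: F_def)
    moreover have "to_nat_on B ` F n \<subseteq> {..n}" by (auto simp: F_def)
    ultimately show "finite (F n)" by (meson finite_atMost inj_on_finite)
  qed
  have lim: "filterlim F (finite_subsets_at_top B) sequentially"
    unfolding filterlim_iff eventually_finite_subsets_at_top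
  proof (intro allI impI, elim exE conjE)
    fix P Y assume Y: "finite Y" "Y \<subseteq> B" and P: "\<forall>Z. finite Z \<and> Y \<subseteq> Z \<and> Z \<subseteq> B \<longrightarrow> P Z"
    obtain n where n: "\<forall>k\<in>to_nat_on B ` Y. k \<le> n"
      using Y(1) finite_nat_set_iff_bounded_le by blast
    show "eventually (\<lambda>n. P (F n)) sequentially"
    proof (rule eventually_sequentiallyI[of n])
      fix m assume "n \<le> m"
      then have "Y \<subseteq> F m" using n Y by (force simp: F_def)
      then show "P (F m)" using P F by blast
    qed
  qed
  have "(\<lambda>n. LINT z|M. (\<Sum>e\<in>F n. f e z)) \<longlonglongrightarrow> (LINT z|M. A (X z) \<bullet> E (X z))"
  proof (rule integral_dominated_convergence[OF _ _ g])
    show "AE z in M. (\<lambda>n. \<Sum>e\<in>F n. f e z) \<longlonglongrightarrow> A (X z) \<bullet> E (X z)"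
      by (rule AE_I2) (rule filterlim_compose[OF pointwise[unfolded has_sum_def] lim])
    show "AE z in M. norm (\<Sum>e\<in>F n. f e z) \<le> g z" for n
      using bound[OF F] by (intro AE_I2) (metis order_trans real_norm_def sum_abs)
  qed measurable
  moreover have "(LINT z|M. (\<Sum>e\<in>F n. f e z)) = (\<Sum>e\<in>F n. LINT z|M. f e z)" for n
    using F[of n] fint by (intro Bochner_Integration.integral_sum) auto
  moreover have "(\<lambda>n. \<Sum>e\<in>F n. LINT z|M. f e z) \<longlonglongrightarrow> S"
    by (rule filterlim_compose[OF S[unfolded has_sum_def] lim])
  ultimately have "S = (LINT z|M. A (X z) \<bullet> E (X z))" by (simp add: LIMSEQ_unique)
  then show ?thesis using S eq by simp
qed

text \<open>\<open>op_trace\<close> is a definite description quantified over all bases, so at least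
  one basis \<open>B0\<close> must exist for its value to be unique.\<close>

lemma op_trace_eqI:
  fixes A :: "'a::real_inner \<Rightarrow>\<^sub>L 'a"
  assumes "\<And>B. orthonormal_basis B \<Longrightarrow> ((\<lambda>e. e \<bullet> blinfun_apply A e) has_sum t) B"
    and "orthonormal_basis (B0 :: 'a set)"
  shows "op_trace A = t"
  unfolding op_trace_def
proof (rule the_equality)
  fix s assume "\<forall>B. orthonormal_basis B \<longrightarrow> ((\<lambda>e. e \<bullet> blinfun_apply A e) has_sum s) B"
  then have "((\<lambda>e. e \<bullet> blinfun_apply A e) has_sum s) B0" using assms(2) by blast
  then show "s = t" using assms by (blast intro: has_sum_unique)
qed (use assms(1) in blast)

lemma op_inner_symmetric:
  assumes "symmetric_op (A :: 'a::real_inner \<Rightarrow>\<^sub>L 'a)"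
  shows "op_inner A B = op_trace (A o\<^sub>L B)"
proof -
  have "adjoint (blinfun_apply A) = blinfun_apply A"
    using assms by (intro adjoint_unique) (simp add: symmetric_op_def)
  then show ?thesis by (simp add: op_inner_def blinfun_apply_inverse)
qed

lemma op_trace_weak_cov:
  fixes X :: "'m \<Rightarrow> 'a::{real_inner, banach, second_countable_topology}"
  assumes "X \<in> borel_measurable M" "integrable M (\<lambda>z. (norm (X z))\<^sup>2)"
    and "weak_cov M X C" "symmetric_op A" "symmetric_op E" "orthonormal_basis (B :: 'a set)"
  shows "op_trace (A o\<^sub>L C o\<^sub>L E) = (LINT z|M. A (X z) \<bullet> E (X z))"
  using weak_cov_trace_has_sum[OF assms(1-5)] assms(6) by (intro op_trace_eqI) auto

subsection \<open>Moments of a well-specified law\<close>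

lemma integrable_pair_mult:
  fixes f :: "'c \<Rightarrow> real" and h :: "'d \<Rightarrow> real"
  assumes L: "prob_space L" and D: "prob_space D" and f: "integrable L f" and h: "integrable D h"
  shows "integrable (L \<Otimes>\<^sub>M D) (\<lambda>p. f (fst p) * h (snd p))"
proof -
  interpret L: prob_space L by fact
  interpret D: prob_space D by fact
  interpret pair_sigma_finite L D ..
  have [measurable]: "f \<in> borel_measurable L" "h \<in> borel_measurable D" using f h by auto
  show ?thesis
  proof (rule Fubini_integrable)
    show "integrable L (\<lambda>x. \<integral> y. norm (f (fst (x, y)) * h (snd (x, y))) \<partial>D)"
      using f by (simp add: abs_mult)
    show "AE x in L. integrable D (\<lambda>y. f (fst (x, y)) * h (snd (x, y)))"
      using h by simp
  qed measurable
qed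

lemma integrable_return_borel:
  fixes f :: "'c::topological_space \<Rightarrow> real"
  assumes f: "f \<in> borel_measurable borel"
  shows "integrable (return borel x) f"
proof -
  interpret prob_space "return borel x" by (rule prob_space_return) simp
  have [measurable]: "f \<in> borel_measurable (return borel x)" using f by simp
  have "AE y in return borel x. norm (f y) \<le> \<bar>f x\<bar>"
    using f by (subst AE_return) auto
  then show ?thesis by (rule integrable_const_bound) measurable
qed

lemma centered_normal_moments:
  assumes "\<sigma> \<ge> 0"
  shows "integrable (centered_normal \<sigma>) (\<lambda>t. t)" "(LINT t|centered_normal \<sigma>. t) = 0"
    and "integrable (centered_normal \<sigma>) (\<lambda>t. t\<^sup>2)" "(LINT t|centered_normal \<sigma>. t\<^sup>2) = \<sigma>\<^sup>2"
proof -
  have "integrable (centered_normal \<sigma>) (\<lambda>t. t) \<and> (LINT t|centered_normal \<sigma>. t) = 0 \<and>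
    integrable (centered_normal \<sigma>) (\<lambda>t. t\<^sup>2) \<and> (LINT t|centered_normal \<sigma>. t\<^sup>2) = \<sigma>\<^sup>2"
  proof (cases "\<sigma> = 0")
    case True
    have "integrable (return borel 0) (\<lambda>t::real. t)" "integrable (return borel 0) (\<lambda>t::real. t\<^sup>2)"
      by (rule integrable_return_borel; measurable)+
    moreover have "(LINT t|return borel 0. t) = (0::real)" "(LINT t|return borel 0. t\<^sup>2) = (0::real)"
      by (subst integral_return; simp)+
    ultimately show ?thesis using True by (simp add: centered_normal_def)
  next
    case False
    then have s: "\<sigma> > 0" using assms by simp
    have cn: "centered_normal \<sigma> = density lborel (\<lambda>t. ennreal (normal_density 0 \<sigma> t))"
      using False by (simp add: centered_normal_def)
    have "integrable lborel (\<lambda>t. normal_density 0 \<sigma> t * t)"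
      using integrable_normal_moment_nz_1[OF s, of 0] .
    moreover have "(LINT t|lborel. normal_density 0 \<sigma> t * t) = 0"
      using integral_normal_moment_nz_1[OF s, of 0] .
    moreover have "integrable lborel (\<lambda>t. normal_density 0 \<sigma> t * t\<^sup>2)"
      using integrable_normal_moment[OF s, of 0 2] by simp
    moreover have "(LINT t|lborel. normal_density 0 \<sigma> t * t\<^sup>2) = \<sigma>\<^sup>2"
      using integral_normal_moment_even[OF s, of 0 1] by simp
    ultimately show ?thesis
      unfolding cn by (simp add: integrable_real_density integral_real_density)
  qed
  then show "integrable (centered_normal \<sigma>) (\<lambda>t. t)" "(LINT t|centered_normal \<sigma>. t) = 0"
    "integrable (centered_normal \<sigma>) (\<lambda>t. t\<^sup>2)" "(LINT t|centered_normal \<sigma>. t\<^sup>2) = \<sigma>\<^sup>2"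
    by auto
qed

locale data_law = prob_space D
  for D :: "('a::{real_inner, banach, second_countable_topology} \<times> real) measure" +
  fixes w_star :: 'a and \<sigma> :: real
  assumes sets_D: "sets D = sets borel"
    and fourth: "integrable D (\<lambda>z. norm (fst z) ^ 4)"
    and well_spec: "well_specified D w_star \<sigma>"
    and sigma_nonneg: "\<sigma> \<ge> 0"
begin

abbreviation noise :: "'a \<times> real \<Rightarrow> real" where
  "noise z \<equiv> snd z - fst z \<bullet> w_star"

lemma measurable_continuous: "continuous_on UNIV f \<Longrightarrow> f \<in> borel_measurable D"
  using borel_measurable_continuous_onI measurable_cong_sets[OF sets_D refl] by blast

lemma measurable_fst_D [measurable]: "fst \<in> borel_measurable D"
  and measurable_snd_D [measurable]: "snd \<in> borel_measurable D"
  by (intro measurable_continuous continuous_intros)+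

text \<open>Lower powers of the norm are absorbed by 1 + norm ^ 4, so the assumption
  \<open>fourth\<close> covers terms of every degree up to four.\<close>

lemma integrable_covariate_poly:
  assumes [measurable]: "f \<in> borel_measurable borel"
    and k: "k \<le> 4" and f: "\<And>x. \<bar>f x\<bar> \<le> C * norm x ^ k"
  shows "integrable D (\<lambda>z. f (fst z) :: real)"
proof (rule Bochner_Integration.integrable_bound)
  show "integrable D (\<lambda>z. \<bar>C\<bar> * (1 + norm (fst z) ^ 4))"
    using fourth by simp
  have "norm (f x) \<le> norm (\<bar>C\<bar> * (1 + norm x ^ 4))" for x
  proof -
    have "norm x ^ k \<le> 1 + norm x ^ 4"
    proof (cases "norm x \<le> 1")
      case True
      then have "norm x ^ k \<le> 1" by (simp add: power_le_one)
      then show ?thesis by (simp add: add_increasing2)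
    next
      case False
      then have "norm x ^ k \<le> norm x ^ 4" using k by (intro power_increasing) auto
      then show ?thesis by simp
    qed
    then have "\<bar>C\<bar> * norm x ^ k \<le> \<bar>C\<bar> * (1 + norm x ^ 4)" by (intro mult_left_mono) auto
    moreover have "C * norm x ^ k \<le> \<bar>C\<bar> * norm x ^ k" by (intro mult_right_mono) auto
    ultimately show ?thesis using f[of x] by (simp add: abs_mult)
  qed
  then show "AE z in D. norm (f (fst z)) \<le> norm (\<bar>C\<bar> * (1 + norm (fst z) ^ 4))" by simp
qed measurable

lemma integrable_norm_sq: "integrable D (\<lambda>z. (norm (fst z))\<^sup>2)"
  by (rule integrable_covariate_poly[of _ 2 1]) auto

text \<open>\<open>well_specified\<close> states independence for families of preimages. Both
  families are stable under intersection, so it extends to the generated sigma-algebras that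
  \<open>indep_var\<close> asks for.\<close>

lemma indep_noise:
  assumes [measurable]: "f \<in> borel_measurable borel"
  shows "indep_var borel (\<lambda>z. f (fst z) :: real) borel noise"
  unfolding indep_var_eq
proof (intro conjI)
  let ?N = "{noise -` T \<inter> space D |T. T \<in> sets borel}"
  let ?F = "{(\<lambda>z. f (fst z)) -` S \<inter> space D |S. S \<in> sets borel}"
  have "?F \<subseteq> {fst -` S \<inter> space D |S. S \<in> sets borel}"
  proof safe
    fix S :: "real set" assume "S \<in> sets borel"
    then have "f -` S \<in> sets borel" using measurable_sets_borel[OF assms] by simp
    then show "\<exists>T. (\<lambda>z. f (fst z)) -` S \<inter> space D = fst -` T \<inter> space D \<and> T \<in> sets borel"
      by (intro exI[of _ "f -` S"]) auto
  qed
  note sub = this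
  have "indep_set ?F ?N"
    unfolding indep_set_def
  proof (rule indep_sets_mono_sets)
    show "indep_sets (case_bool {fst -` S \<inter> space D |S. S \<in> sets borel} ?N) UNIV"
      using well_spec by (simp only: well_specified_def indep_set_def)
    show "case_bool ?F ?N i \<subseteq> case_bool {fst -` S \<inter> space D |S. S \<in> sets borel} ?N i" for i
      by (cases i) (simp_all only: bool.case sub order_refl)
  qed
  then show "indep_set (sigma_sets (space D) ?F) (sigma_sets (space D) ?N)"
  proof (rule indep_set_sigma_sets)
    show "Int_stable ?F"
    proof (rule Int_stableI)
      fix a b assume "a \<in> ?F" "b \<in> ?F"
      then obtain S T where "S \<in> sets borel" "T \<in> sets borel"
        "a = (\<lambda>z. f (fst z)) -` S \<inter> space D" "b = (\<lambda>z. f (fst z)) -` T \<inter> space D" by blast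
      then show "a \<inter> b \<in> ?F" by (intro CollectI exI[of _ "S \<inter> T"]) auto
    qed
    show "Int_stable ?N"
    proof (rule Int_stableI)
      fix a b assume "a \<in> ?N" "b \<in> ?N"
      then obtain S T where "S \<in> sets borel" "T \<in> sets borel"
        "a = noise -` S \<inter> space D" "b = noise -` T \<inter> space D" by blast
      then show "a \<inter> b \<in> ?N" by (intro CollectI exI[of _ "S \<inter> T"]) auto
    qed
  qed
qed measurable

lemma distr_noise: "distr D borel noise = centered_normal \<sigma>"
  using well_spec by (simp add: well_specified_def)

lemma noise_moments:
  "integrable D noise" "(LINT z|D. noise z) = 0"
  "integrable D (\<lambda>z. (noise z)\<^sup>2)" "(LINT z|D. (noise z)\<^sup>2) = \<sigma>\<^sup>2"
proof -
  note m = centered_normal_moments[OF sigma_nonneg, folded distr_noise]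
  have n: "noise \<in> borel_measurable D" by measurable
  show "integrable D noise" using m(1) integrable_distr_eq[OF n, of "\<lambda>t. t"] by simp
  show "(LINT z|D. noise z) = 0" using m(2) integral_distr[OF n, of "\<lambda>t. t"] by simp
  show "integrable D (\<lambda>z. (noise z)\<^sup>2)" using m(3) integrable_distr_eq[OF n, of "\<lambda>t. t\<^sup>2"] by simp
  show "(LINT z|D. (noise z)\<^sup>2) = \<sigma>\<^sup>2" using m(4) integral_distr[OF n, of "\<lambda>t. t\<^sup>2"] by simp
qed

text \<open>Independence factors the expectations: a term linear in the noise vanishes, a quadratic
  one acquires the factor \<open>\<sigma>\<^sup>2\<close>.\<close>

lemma noise_mult:
  assumes [measurable]: "f \<in> borel_measurable borel" and f: "integrable D (\<lambda>z. f (fst z) :: real)"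
  shows "integrable D (\<lambda>z. noise z * f (fst z))" "(LINT z|D. noise z * f (fst z)) = 0"
    and "integrable D (\<lambda>z. (noise z)\<^sup>2 * f (fst z))"
    and "(LINT z|D. (noise z)\<^sup>2 * f (fst z)) = \<sigma>\<^sup>2 * (LINT z|D. f (fst z))"
proof -
  note 1 = indep_noise[OF assms(1)]
  have 2: "indep_var borel ((\<lambda>t. t) \<circ> (\<lambda>z. f (fst z))) borel ((\<lambda>t. t\<^sup>2) \<circ> noise)"
    by (rule indep_var_compose[OF 1]) auto
  show "integrable D (\<lambda>z. noise z * f (fst z))"
    using indep_var_integrable[OF 1] f noise_moments by (simp add: o_def mult.commute)
  show "(LINT z|D. noise z * f (fst z)) = 0"
    using indep_var_lebesgue_integral[OF 1] f noise_moments by (simp add: o_def mult.commute)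
  show "integrable D (\<lambda>z. (noise z)\<^sup>2 * f (fst z))"
    using indep_var_integrable[OF 2] f noise_moments by (simp add: o_def mult.commute)
  show "(LINT z|D. (noise z)\<^sup>2 * f (fst z)) = \<sigma>\<^sup>2 * (LINT z|D. f (fst z))"
    using indep_var_lebesgue_integral[OF 2] f noise_moments by (simp add: o_def mult.commute)
qed

lemma weak_cov_second_moment: "weak_cov D fst (second_moment D)"
  using weighted_moment_inner[of fst D "\<lambda>_. 1"] integrable_norm_sq
  by (simp add: weak_cov_def second_moment_def)

lemma second_moment_inner: "u \<bullet> second_moment D v = (LINT z|D. (fst z \<bullet> u) * (fst z \<bullet> v))"
  using weak_cov_second_moment by (simp add: weak_cov_def)

lemma symmetric_second_moment: "symmetric_op (second_moment D)"
  using weak_cov_second_moment by (rule weak_cov_symmetric)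

lemma borel_measurable_blinfun_apply [measurable]: "blinfun_apply (A :: 'a \<Rightarrow>\<^sub>L 'a) \<in> borel_measurable borel"
  by (intro borel_measurable_continuous_onI continuous_intros)

lemma quadratic_form_le: "\<bar>x \<bullet> blinfun_apply A x\<bar> \<le> norm A * (norm (x::'a))\<^sup>2"
proof -
  have "\<bar>x \<bullet> A x\<bar> \<le> norm x * norm (A x)" by (rule Cauchy_Schwarz_ineq2)
  also have "\<dots> \<le> norm x * (norm A * norm x)" by (intro mult_left_mono norm_blinfun) auto
  finally show ?thesis by (simp add: power2_eq_square mult_ac)
qed

lemma integrable_quadratic: "integrable D (\<lambda>z. fst z \<bullet> blinfun_apply A (fst z))"
  by (rule integrable_covariate_poly[of _ 2 "norm A"]) (measurable, auto intro: quadratic_form_le)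

lemma integrable_fourth:
  "integrable D (\<lambda>z. (fst z \<bullet> blinfun_apply A (fst z)) * (norm (fst z))\<^sup>2)"
proof (rule integrable_covariate_poly[of _ 4 "norm A"])
  fix x
  have "\<bar>x \<bullet> A x\<bar> * (norm x)\<^sup>2 \<le> norm A * (norm x)\<^sup>2 * (norm x)\<^sup>2"
    by (intro mult_right_mono quadratic_form_le) auto
  then show "\<bar>(x \<bullet> A x) * (norm x)\<^sup>2\<bar> \<le> norm A * norm x ^ 4"
    by (simp add: abs_mult mult.assoc flip: power_add)
  show "(\<lambda>x. (x \<bullet> blinfun_apply A x) * (norm x)\<^sup>2) \<in> borel_measurable borel" by measurable
qed simp

lemma fourth_moment_inner:
  "u \<bullet> fourth_moment D A v = (LINT z|D. (fst z \<bullet> A (fst z)) * (fst z \<bullet> u) * (fst z \<bullet> v))"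
  unfolding fourth_moment_def by (rule weighted_moment_inner) (measurable, rule integrable_fourth)

lemma fourth_moment_inner_integrable:
  "integrable D (\<lambda>z. (fst z \<bullet> blinfun_apply A (fst z)) * (fst z \<bullet> u) * (fst z \<bullet> v))"
  by (rule weighted_moment_inner_integrable) (measurable, rule integrable_fourth)

lemma symmetric_fourth_moment: "symmetric_op (fourth_moment D A)"
  unfolding symmetric_op_def inner_commute[of "blinfun_apply (fourth_moment D A) _"] fourth_moment_inner
  by (simp add: mult_ac)

lemma noise_cov_inner:
  "u \<bullet> noise_cov D w_star v = (LINT z|D. (noise z)\<^sup>2 * (fst z \<bullet> u) * (fst z \<bullet> v))"
proof -
  have int: "integrable D (\<lambda>z. (noise z)\<^sup>2 * (norm (fst z))\<^sup>2)"
    by (rule noise_mult(3)) (measurable, rule integrable_norm_sq)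
  show ?thesis
    unfolding noise_cov_def inner_commute[of w_star]
    by (rule weighted_moment_inner) (measurable, rule int)
qed

lemma symmetric_noise_cov: "symmetric_op (noise_cov D w_star)"
  unfolding symmetric_op_def inner_commute[of "blinfun_apply (noise_cov D w_star) _"] noise_cov_inner
  by (simp add: mult_ac)

lemma symmetric_error_step: "symmetric_op A \<Longrightarrow> symmetric_op (error_step D g A)"
  unfolding error_step_def
  by (intro symmetric_op_add symmetric_op_diff symmetric_op_scaleR symmetric_op_anticommutator
      symmetric_second_moment symmetric_fourth_moment)

text \<open>The products of \<open>A\<close> and the covariance in the two orders have the same
  quadratic form, both factors being symmetric; hence the 2.\<close>

lemma error_step_inner:
  assumes "symmetric_op A"
  shows "v \<bullet> error_step D g A v
    = v \<bullet> A v - 2 * g * (v \<bullet> second_moment D (A v)) + g\<^sup>2 * (v \<bullet> fourth_moment D A v)"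
proof -
  have "v \<bullet> A (second_moment D v) = v \<bullet> second_moment D (A v)"
    using assms symmetric_second_moment by (metis inner_commute symmetric_op_def)
  then show ?thesis
    by (simp add: error_step_def plus_blinfun.rep_eq minus_blinfun.rep_eq scaleR_blinfun.rep_eq
        inner_add_right inner_diff_right algebra_simps)
qed

end

subsection \<open>One step of the error recursion\<close>

definition sgd_error_step :: "real \<Rightarrow> real \<Rightarrow> 'a::real_inner \<Rightarrow> 'a \<Rightarrow> 'a \<times> real \<Rightarrow> 'a" where
  "sgd_error_step s g w_star \<eta> z =
     \<eta> - (g * (fst z \<bullet> \<eta>)) *\<^sub>R fst z + (g * s * (snd z - fst z \<bullet> w_star)) *\<^sub>R fst z"

text \<open>The product measure encodes that the fresh sample is independent of the current error;
  \<open>distr_sgd\<close> identifies the resulting law with that of actual SGD.\<close>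

definition step_law ::
  "('a::{real_inner, second_countable_topology} \<times> real) measure \<Rightarrow> 'a \<Rightarrow> real \<Rightarrow> real \<Rightarrow> 'a measure \<Rightarrow> 'a measure" where
  "step_law D w_star s g L = distr (L \<Otimes>\<^sub>M D) borel (\<lambda>p. sgd_error_step s g w_star (fst p) (snd p))"

definition sq_integrable_law :: "'a::real_normed_vector measure \<Rightarrow> bool" where
  "sq_integrable_law L \<longleftrightarrow> prob_space L \<and> sets L = sets borel \<and> integrable L (\<lambda>\<eta>. (norm \<eta>)\<^sup>2)"

lemma integrable_quadratic_form:
  fixes A :: "'a::{real_inner, second_countable_topology} \<Rightarrow>\<^sub>L 'a"
  assumes "sq_integrable_law L"
  shows "integrable L (\<lambda>\<eta>. \<eta> \<bullet> A \<eta>)"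
proof (rule Bochner_Integration.integrable_bound)
  show "integrable L (\<lambda>\<eta>. norm A * (norm \<eta>)\<^sup>2)"
    using assms by (simp add: sq_integrable_law_def)
  have "(\<lambda>\<eta>. \<eta> \<bullet> A \<eta>) \<in> borel_measurable borel"
    by (intro borel_measurable_continuous_onI continuous_intros)
  then show "(\<lambda>\<eta>. \<eta> \<bullet> A \<eta>) \<in> borel_measurable L"
    using assms measurable_cong_sets unfolding sq_integrable_law_def by blast
  have "\<bar>\<eta> \<bullet> A \<eta>\<bar> \<le> norm A * (norm \<eta>)\<^sup>2" for \<eta>
  proof -
    have "\<bar>\<eta> \<bullet> A \<eta>\<bar> \<le> norm \<eta> * norm (A \<eta>)" by (rule Cauchy_Schwarz_ineq2)
    also have "\<dots> \<le> norm \<eta> * (norm A * norm \<eta>)" by (intro mult_left_mono norm_blinfun) auto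
    finally show ?thesis by (simp add: power2_eq_square mult_ac)
  qed
  then show "AE \<eta> in L. norm (\<eta> \<bullet> A \<eta>) \<le> norm (norm A * (norm \<eta>)\<^sup>2)" by (simp add: abs_mult)
qed

lemma quadratic_form_add_scaleR:
  assumes "symmetric_op A"
  shows "(u + d *\<^sub>R x) \<bullet> blinfun_apply A (u + d *\<^sub>R x)
    = u \<bullet> A u + 2 * d * (x \<bullet> A u) + d\<^sup>2 * (x \<bullet> A x)"
proof -
  have "u \<bullet> A x = x \<bullet> A u" using assms by (metis inner_commute symmetric_op_def)
  then show ?thesis
    by (simp add: blinfun.add_right blinfun.scaleR_right inner_add_left inner_add_right power2_eq_square distrib_left)
qed

context data_law
begin

context
  fixes L :: "'a measure" and s g :: real
  assumes L: "sq_integrable_law L"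
begin

interpretation L: prob_space L using L by (simp add: sq_integrable_law_def)
interpretation LD: pair_prob_space L D ..

lemma sets_L [measurable_cong]: "sets L = sets borel"
  using L by (simp add: sq_integrable_law_def)

lemma measurable_pair_components [measurable]:
  "(\<lambda>p. fst p) \<in> borel_measurable (L \<Otimes>\<^sub>M D)"
  "(\<lambda>p. fst (snd p)) \<in> borel_measurable (L \<Otimes>\<^sub>M D)"
  "(\<lambda>p. snd (snd p)) \<in> borel_measurable (L \<Otimes>\<^sub>M D)"
proof -
  have "fst \<in> L \<Otimes>\<^sub>M D \<rightarrow>\<^sub>M L" by (rule measurable_fst)
  then show "(\<lambda>p. fst p) \<in> borel_measurable (L \<Otimes>\<^sub>M D)"
    using measurable_cong_sets[OF refl sets_L] by blast
  show "(\<lambda>p. fst (snd p)) \<in> borel_measurable (L \<Otimes>\<^sub>M D)"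
    by (rule measurable_compose[OF measurable_snd measurable_fst_D])
  show "(\<lambda>p. snd (snd p)) \<in> borel_measurable (L \<Otimes>\<^sub>M D)"
    by (rule measurable_compose[OF measurable_snd measurable_snd_D])
qed

lemma measurable_sgd_error_step [measurable]:
  "(\<lambda>p. sgd_error_step s g w_star (fst p) (snd p)) \<in> borel_measurable (L \<Otimes>\<^sub>M D)"
  unfolding sgd_error_step_def
  by (intro borel_measurable_add borel_measurable_diff borel_measurable_scaleR borel_measurable_times
      borel_measurable_inner borel_measurable_const measurable_pair_components)

text \<open>After bounding the square of a sum of three terms by three times the sum of squares,
  each summand is a function of the error times a function of the sample, so integrability factors.
  The fourth moment enters through the term quadratic in the covariate.\<close>

lemma integrable_norm_sgd_error_step:
  "integrable (L \<Otimes>\<^sub>M D) (\<lambda>p. (norm (sgd_error_step s g w_star (fst p) (snd p)))\<^sup>2)"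
proof (rule Bochner_Integration.integrable_bound)
  let ?b = "\<lambda>p. 3 * ((norm (fst p))\<^sup>2 * (1 + g\<^sup>2 * norm (fst (snd p)) ^ 4)
    + 1 * (g\<^sup>2 * s\<^sup>2 * ((noise (snd p))\<^sup>2 * (norm (fst (snd p)))\<^sup>2)))"
  have i1: "integrable (L \<Otimes>\<^sub>M D) (\<lambda>p. (norm (fst p))\<^sup>2 * (1 + g\<^sup>2 * norm (fst (snd p)) ^ 4))"
    using L fourth
    by (intro integrable_pair_mult[of L D "\<lambda>\<eta>. (norm \<eta>)\<^sup>2" "\<lambda>z. 1 + g\<^sup>2 * norm (fst z) ^ 4"])
      (auto simp: sq_integrable_law_def intro: prob_space_axioms)
  have "integrable D (\<lambda>z. (noise z)\<^sup>2 * (norm (fst z))\<^sup>2)"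
    by (rule noise_mult(3)) (measurable, rule integrable_norm_sq)
  then have i2: "integrable (L \<Otimes>\<^sub>M D)
      (\<lambda>p. 1 * (g\<^sup>2 * s\<^sup>2 * ((noise (snd p))\<^sup>2 * (norm (fst (snd p)))\<^sup>2)))"
    by (intro integrable_pair_mult[of L D "\<lambda>_. 1" "\<lambda>z. g\<^sup>2 * s\<^sup>2 * ((noise z)\<^sup>2 * (norm (fst z))\<^sup>2)"])
      (auto intro: prob_space_axioms L.prob_space_axioms)
  show "integrable (L \<Otimes>\<^sub>M D) ?b"
    by (rule integrable_mult_right) (rule Bochner_Integration.integrable_add[OF i1 i2])
  have "(norm (sgd_error_step s g w_star \<eta> z))\<^sup>2 \<le> \<bar>?b (\<eta>, z)\<bar>" for \<eta> z
  proof -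
    let ?a = "norm \<eta>" and ?x = "norm (fst z)" and ?e = "noise z"
    have "norm (sgd_error_step s g w_star \<eta> z)
        \<le> norm \<eta> + norm ((g * (fst z \<bullet> \<eta>)) *\<^sub>R fst z) + norm ((g * s * ?e) *\<^sub>R fst z)"
      unfolding sgd_error_step_def
      by (rule order_trans[OF norm_triangle_ineq add_right_mono[OF norm_triangle_ineq4]])
    also have "norm ((g * (fst z \<bullet> \<eta>)) *\<^sub>R fst z) \<le> \<bar>g\<bar> * (?x * ?a) * ?x"
      unfolding norm_scaleR abs_mult by (intro mult_right_mono mult_left_mono Cauchy_Schwarz_ineq2) auto
    also have "norm ((g * s * ?e) *\<^sub>R fst z) = \<bar>g * s * ?e\<bar> * ?x" by simp
    finally have "norm (sgd_error_step s g w_star \<eta> z) \<le> ?a + \<bar>g\<bar> * (?x * ?a) * ?x + \<bar>g * s * ?e\<bar> * ?x"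
      by simp
    then have "(norm (sgd_error_step s g w_star \<eta> z))\<^sup>2
        \<le> (?a + \<bar>g\<bar> * (?x * ?a) * ?x + \<bar>g * s * ?e\<bar> * ?x)\<^sup>2"
      by (rule power_mono) simp
    also have "\<dots> \<le> 3 * (?a\<^sup>2 + (\<bar>g\<bar> * (?x * ?a) * ?x)\<^sup>2 + (\<bar>g * s * ?e\<bar> * ?x)\<^sup>2)"
    proof -
      have "(a + b + c)\<^sup>2 \<le> 3 * (a\<^sup>2 + b\<^sup>2 + c\<^sup>2)" for a b c :: real
        using zero_le_power2[of "a - b"] zero_le_power2[of "b - c"] zero_le_power2[of "a - c"]
        by (simp add: power2_eq_square algebra_simps)
      then show ?thesis by blast
    qed
    also have "(\<bar>g\<bar> * (?x * ?a) * ?x)\<^sup>2 = ?a\<^sup>2 * (g\<^sup>2 * ?x ^ 4)"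
      unfolding power_mult_distrib power2_abs by (simp add: power4_eq_xxxx power2_eq_square mult_ac)
    also have "(\<bar>g * s * ?e\<bar> * ?x)\<^sup>2 = g\<^sup>2 * s\<^sup>2 * (?e\<^sup>2 * ?x\<^sup>2)"
      unfolding power_mult_distrib power2_abs by (simp only: mult_ac)
    also have "3 * (?a\<^sup>2 + ?a\<^sup>2 * (g\<^sup>2 * ?x ^ 4) + g\<^sup>2 * s\<^sup>2 * (?e\<^sup>2 * ?x\<^sup>2)) = ?b (\<eta>, z)"
      by (simp only: distrib_left mult_1_right mult_1_left fst_conv snd_conv)
    finally show ?thesis by linarith
  qed
  then show "AE p in L \<Otimes>\<^sub>M D. norm ((norm (sgd_error_step s g w_star (fst p) (snd p)))\<^sup>2) \<le> norm (?b p)"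
    by (intro AE_I2) (metis abs_of_nonneg prod.collapse real_norm_def zero_le_power2)
qed measurable

lemma sq_integrable_step_law: "sq_integrable_law (step_law D w_star s g L)"
  unfolding sq_integrable_law_def step_law_def
proof (intro conjI)
  show "prob_space (distr (L \<Otimes>\<^sub>M D) borel (\<lambda>p. sgd_error_step s g w_star (fst p) (snd p)))"
    by (rule LD.prob_space_distr) measurable
  show "integrable (distr (L \<Otimes>\<^sub>M D) borel (\<lambda>p. sgd_error_step s g w_star (fst p) (snd p))) (\<lambda>\<eta>. (norm \<eta>)\<^sup>2)"
    by (subst integrable_distr_eq) (measurable, rule integrable_norm_sgd_error_step)
qed simp

lemma sgd_error_step_quadratic:
  assumes A: "symmetric_op A"
  shows "(LINT z|D. sgd_error_step s g w_star \<eta> z \<bullet> A (sgd_error_step s g w_star \<eta> z))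
    = \<eta> \<bullet> error_step D g A \<eta> + (s * g * \<sigma>)\<^sup>2 * (LINT z|D. fst z \<bullet> A (fst z))"
proof -
  let ?q = "\<lambda>x. x \<bullet> A x"
  \<comment> \<open>The coefficient of the first power of the noise. For fixed \<open>\<eta>\<close>
    it depends on the covariate only, so its contribution integrates to zero.\<close>
  define c where "c x = 2 * g * s * (x \<bullet> A \<eta> - g * ((x \<bullet> \<eta>) * ?q x))" for x
  have expand: "sgd_error_step s g w_star \<eta> z \<bullet> A (sgd_error_step s g w_star \<eta> z) =
      (?q \<eta> - 2 * g * ((fst z \<bullet> \<eta>) * (fst z \<bullet> A \<eta>)) + g\<^sup>2 * (?q (fst z) * (fst z \<bullet> \<eta>) * (fst z \<bullet> \<eta>)))
      + (noise z * c (fst z) + (s * g)\<^sup>2 * ((noise z)\<^sup>2 * ?q (fst z)))" for z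
  proof -
    let ?x = "fst z"
    define d where "d = g * s * noise z - g * (?x \<bullet> \<eta>)"
    have "sgd_error_step s g w_star \<eta> z = \<eta> + d *\<^sub>R ?x"
      by (simp add: sgd_error_step_def d_def algebra_simps)
    then have *: "sgd_error_step s g w_star \<eta> z \<bullet> A (sgd_error_step s g w_star \<eta> z)
        = ?q \<eta> + 2 * d * (?x \<bullet> A \<eta>) + d\<^sup>2 * ?q ?x"
      using quadratic_form_add_scaleR[OF A] by simp
    \<comment> \<open>The expansion as a polynomial identity sorted by powers of the noise e, with
      y, a and p standing for the inner products.\<close>
    have ring: "q + 2 * (g * s * e - g * y) * a + (g * s * e - g * y)\<^sup>2 * p
        = (q - 2 * g * (y * a) + g\<^sup>2 * (p * y * y)) + (e * (2 * g * s * (a - g * (y * p))) + (s * g)\<^sup>2 * (e\<^sup>2 * p))"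
      for q e y a p :: real
      by (simp add: power2_eq_square algebra_simps)
    show ?thesis unfolding * c_def d_def by (rule ring)
  qed
  have c_meas: "c \<in> borel_measurable borel" unfolding c_def by measurable
  have "integrable D (\<lambda>z. (fst z \<bullet> \<eta>) * ?q (fst z))"
  proof (rule integrable_covariate_poly[of _ 3 "norm A * norm \<eta>"])
    fix x
    have "\<bar>x \<bullet> \<eta>\<bar> * \<bar>?q x\<bar> \<le> (norm x * norm \<eta>) * (norm A * (norm x)\<^sup>2)"
      by (intro mult_mono quadratic_form_le Cauchy_Schwarz_ineq2) auto
    then show "\<bar>(x \<bullet> \<eta>) * ?q x\<bar> \<le> norm A * norm \<eta> * norm x ^ 3"
      by (simp add: abs_mult power2_eq_square power3_eq_cube mult_ac)
    show "(\<lambda>x. (x \<bullet> \<eta>) * (x \<bullet> A x)) \<in> borel_measurable borel" by measurable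
  qed simp
  moreover have "integrable D (\<lambda>z. fst z \<bullet> A \<eta>)"
    by (rule integrable_covariate_poly[of _ 1 "norm (A \<eta>)"])
      (auto simp: mult.commute Cauchy_Schwarz_ineq2)
  ultimately have c_int: "integrable D (\<lambda>z. c (fst z))"
    unfolding c_def by simp
  have q_meas: "?q \<in> borel_measurable borel" by measurable
  note [simp] = noise_mult[OF c_meas c_int] noise_mult[OF q_meas integrable_quadratic]
    fourth_moment_inner_integrable
  have [simp]: "integrable D (\<lambda>z. (fst z \<bullet> \<eta>) * (fst z \<bullet> A \<eta>))"
    using weighted_moment_inner_integrable[of fst D "\<lambda>_. 1" \<eta> "A \<eta>"] integrable_norm_sq by simp
  have i1: "integrable D (\<lambda>z. ?q \<eta> - 2 * g * ((fst z \<bullet> \<eta>) * (fst z \<bullet> A \<eta>)))"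
    by (intro Bochner_Integration.integrable_diff integrable_mult_right) simp_all
  have i2: "integrable D (\<lambda>z. ?q \<eta> - 2 * g * ((fst z \<bullet> \<eta>) * (fst z \<bullet> A \<eta>))
      + g\<^sup>2 * (?q (fst z) * (fst z \<bullet> \<eta>) * (fst z \<bullet> \<eta>)))"
    by (intro Bochner_Integration.integrable_add i1 integrable_mult_right) simp
  have i3: "integrable D (\<lambda>z. noise z * c (fst z) + (s * g)\<^sup>2 * ((noise z)\<^sup>2 * ?q (fst z)))"
    by (intro Bochner_Integration.integrable_add integrable_mult_right) simp_all
  have "(LINT z|D. sgd_error_step s g w_star \<eta> z \<bullet> A (sgd_error_step s g w_star \<eta> z)) =
      (?q \<eta> - 2 * g * (LINT z|D. (fst z \<bullet> \<eta>) * (fst z \<bullet> A \<eta>))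
        + g\<^sup>2 * (LINT z|D. ?q (fst z) * (fst z \<bullet> \<eta>) * (fst z \<bullet> \<eta>)))
      + (0 + (s * g)\<^sup>2 * (\<sigma>\<^sup>2 * (LINT z|D. ?q (fst z))))"
    unfolding expand
    by (subst Bochner_Integration.integral_add[OF i2 i3])
      (simp add: Bochner_Integration.integral_add[OF i1] prob_space)
  also have "\<dots> = \<eta> \<bullet> error_step D g A \<eta> + (s * g * \<sigma>)\<^sup>2 * (LINT z|D. ?q (fst z))"
    unfolding error_step_inner[OF A] second_moment_inner fourth_moment_inner
    by (simp add: power_mult_distrib mult_ac)
  finally show ?thesis .
qed

lemma step_law_quadratic:
  assumes A: "symmetric_op A"
  shows "(LINT \<eta>|step_law D w_star s g L. \<eta> \<bullet> A \<eta>)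
    = (LINT \<eta>|L. \<eta> \<bullet> error_step D g A \<eta>) + (s * g * \<sigma>)\<^sup>2 * (LINT z|D. fst z \<bullet> A (fst z))"
proof -
  let ?f = "\<lambda>p. sgd_error_step s g w_star (fst p) (snd p) \<bullet> A (sgd_error_step s g w_star (fst p) (snd p))"
  have int: "integrable (L \<Otimes>\<^sub>M D) ?f"
  proof -
    have "integrable (step_law D w_star s g L) (\<lambda>\<eta>. \<eta> \<bullet> A \<eta>)"
      by (rule integrable_quadratic_form[OF sq_integrable_step_law])
    then show ?thesis unfolding step_law_def by (subst (asm) integrable_distr_eq) measurable
  qed
  have "(LINT \<eta>|step_law D w_star s g L. \<eta> \<bullet> A \<eta>) = integral\<^sup>L (L \<Otimes>\<^sub>M D) ?f"
    unfolding step_law_def by (subst integral_distr) measurable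
  also have "\<dots> = (LINT \<eta>|L. LINT z|D. ?f (\<eta>, z))"
    by (rule LD.integral_fst'[OF int, symmetric])
  also have "\<dots> = (LINT \<eta>|L. \<eta> \<bullet> error_step D g A \<eta> + (s * g * \<sigma>)\<^sup>2 * (LINT z|D. fst z \<bullet> A (fst z)))"
    by (simp add: sgd_error_step_quadratic[OF A])
  also have "\<dots> = (LINT \<eta>|L. \<eta> \<bullet> error_step D g A \<eta>) + (s * g * \<sigma>)\<^sup>2 * (LINT z|D. fst z \<bullet> A (fst z))"
    by (subst Bochner_Integration.integral_add) (simp_all add: integrable_quadratic_form[OF L] L.prob_space)
  finally show ?thesis .
qed

text \<open>The error step is self-dual: the expected value of the transformed rank-one form
  \<open>outer v v\<close> is the value at v of the transformed covariance. By
  \<open>weak_covI\<close> the rank-one forms are the only ones to test.\<close>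

lemma weak_cov_step_law:
  assumes B: "weak_cov L (\<lambda>\<eta>. \<eta>) B"
  shows "weak_cov (step_law D w_star s g L) (\<lambda>\<eta>. \<eta>)
    (error_step D g B + (s * g)\<^sup>2 *\<^sub>R noise_cov D w_star)"
proof (rule weak_covI)
  have symB: "symmetric_op B" using B by (rule weak_cov_symmetric)
  show "symmetric_op (error_step D g B + (s * g)\<^sup>2 *\<^sub>R noise_cov D w_star)"
    by (intro symmetric_op_add symmetric_op_scaleR symmetric_error_step symmetric_noise_cov symB)
  show "integrable (step_law D w_star s g L) (\<lambda>\<eta>. (norm \<eta>)\<^sup>2)"
    using sq_integrable_step_law by (simp add: sq_integrable_law_def)
  show "(\<lambda>\<eta>. \<eta>) \<in> borel_measurable (step_law D w_star s g L)" by (simp add: step_law_def)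
  fix v :: 'a
  let ?V = "outer v v"
  have B_inner: "u \<bullet> B w = (LINT \<eta>|L. (\<eta> \<bullet> u) * (\<eta> \<bullet> w))" for u w
    using B by (simp add: weak_cov_def)
  have V: "x \<bullet> ?V y = (x \<bullet> v) * (y \<bullet> v)" for x y by (simp add: outer_apply inner_commute mult.commute)
  have quad: "integrable L (\<lambda>\<eta>. (\<eta> \<bullet> u) * (\<eta> \<bullet> w))" for u w
    using weighted_moment_inner_integrable[of "\<lambda>\<eta>. \<eta>" L "\<lambda>_. 1" u w] L
    by (simp add: sq_integrable_law_def measurable_ident_sets)
  \<comment> \<open>The only term whose duality is not immediate. Both sides are the double
    expectation of the product of the squared inner products of the covariate with v and with
    \<open>\<eta>\<close>, taken in opposite orders.\<close>
  have fourth: "(LINT \<eta>|L. \<eta> \<bullet> fourth_moment D ?V \<eta>) = v \<bullet> fourth_moment D B v"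
  proof -
    let ?h = "\<lambda>\<eta> z. (fst z \<bullet> v)\<^sup>2 * (fst z \<bullet> \<eta>)\<^sup>2"
    have int: "integrable (L \<Otimes>\<^sub>M D) (case_prod ?h)"
    proof (rule Bochner_Integration.integrable_bound)
      show "integrable (L \<Otimes>\<^sub>M D) (\<lambda>p. (norm (fst p))\<^sup>2 * ((norm v)\<^sup>2 * norm (fst (snd p)) ^ 4))"
        using L fourth
        by (intro integrable_pair_mult[of L D "\<lambda>\<eta>. (norm \<eta>)\<^sup>2" "\<lambda>z. (norm v)\<^sup>2 * norm (fst z) ^ 4"])
          (auto simp: sq_integrable_law_def intro: prob_space_axioms)
      have "?h \<eta> z \<le> (norm \<eta>)\<^sup>2 * ((norm v)\<^sup>2 * norm (fst z) ^ 4)" for \<eta> z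
      proof -
        have "\<bar>fst z \<bullet> w\<bar>\<^sup>2 \<le> (norm (fst z) * norm w)\<^sup>2" for w
          by (intro power_mono Cauchy_Schwarz_ineq2) simp
        then have "?h \<eta> z \<le> (norm (fst z) * norm v)\<^sup>2 * (norm (fst z) * norm \<eta>)\<^sup>2"
          by (intro mult_mono) (simp_all add: power2_abs)
        then show ?thesis by (simp add: power_mult_distrib power2_eq_square power4_eq_xxxx mult_ac)
      qed
      then show "AE p in L \<Otimes>\<^sub>M D. norm (case_prod ?h p)
          \<le> norm ((norm (fst p))\<^sup>2 * ((norm v)\<^sup>2 * norm (fst (snd p)) ^ 4))"
        by (intro AE_I2) (auto simp: abs_mult split: prod.splits)
    qed measurable
    have "(LINT \<eta>|L. \<eta> \<bullet> fourth_moment D ?V \<eta>) = (LINT \<eta>|L. LINT z|D. ?h \<eta> z)"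
      unfolding fourth_moment_inner V
      by (intro Bochner_Integration.integral_cong refl) (simp add: power2_eq_square mult_ac)
    also have "\<dots> = (LINT z|D. LINT \<eta>|L. ?h \<eta> z)"
      by (rule LD.Fubini_integral[OF int, symmetric])
    also have "\<dots> = v \<bullet> fourth_moment D B v"
      unfolding fourth_moment_inner
    proof (intro Bochner_Integration.integral_cong refl)
      fix z
      have "?h \<eta> z = ((fst z \<bullet> v) * (fst z \<bullet> v)) * ((\<eta> \<bullet> fst z) * (\<eta> \<bullet> fst z))" for \<eta>
        by (simp add: power2_eq_square inner_commute)
      then show "(LINT \<eta>|L. ?h \<eta> z) = (fst z \<bullet> B (fst z)) * (fst z \<bullet> v) * (fst z \<bullet> v)"
        unfolding B_inner by simp
    qed
    finally show ?thesis .
  qed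
  have "(LINT \<eta>|step_law D w_star s g L. (\<eta> \<bullet> v)\<^sup>2) = (LINT \<eta>|step_law D w_star s g L. \<eta> \<bullet> ?V \<eta>)"
    by (simp add: V power2_eq_square)
  also have "\<dots> = (LINT \<eta>|L. \<eta> \<bullet> error_step D g ?V \<eta>) + (s * g * \<sigma>)\<^sup>2 * (LINT z|D. fst z \<bullet> ?V (fst z))"
    by (rule step_law_quadratic[OF symmetric_op_outer])
  also have "(s * g * \<sigma>)\<^sup>2 * (LINT z|D. fst z \<bullet> ?V (fst z)) = (s * g)\<^sup>2 * (v \<bullet> noise_cov D w_star v)"
  proof -
    have "v \<bullet> noise_cov D w_star v = (LINT z|D. (noise z)\<^sup>2 * (fst z \<bullet> ?V (fst z)))"
      unfolding noise_cov_inner V by (simp add: mult.assoc)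
    also have "\<dots> = \<sigma>\<^sup>2 * (LINT z|D. fst z \<bullet> ?V (fst z))"
      by (rule noise_mult(4)) (measurable, rule integrable_quadratic)
    finally show ?thesis by (simp add: power_mult_distrib)
  qed
  also have "(LINT \<eta>|L. \<eta> \<bullet> error_step D g ?V \<eta>) = v \<bullet> error_step D g B v"
  proof -
    have "\<eta> \<bullet> error_step D g ?V \<eta> = (\<eta> \<bullet> v) * (\<eta> \<bullet> v) - 2 * g * ((\<eta> \<bullet> second_moment D v) * (\<eta> \<bullet> v))
        + g\<^sup>2 * (\<eta> \<bullet> fourth_moment D ?V \<eta>)" for \<eta>
      unfolding error_step_inner[OF symmetric_op_outer] V
      by (simp add: outer_apply blinfun.scaleR_right inner_commute)
    then have "(LINT \<eta>|L. \<eta> \<bullet> error_step D g ?V \<eta>) =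
        (LINT \<eta>|L. (\<eta> \<bullet> v) * (\<eta> \<bullet> v)) - 2 * g * (LINT \<eta>|L. (\<eta> \<bullet> second_moment D v) * (\<eta> \<bullet> v))
        + g\<^sup>2 * (LINT \<eta>|L. \<eta> \<bullet> fourth_moment D ?V \<eta>)"
      using quad integrable_quadratic_form[OF L, of "fourth_moment D ?V"]
      by (simp add: Bochner_Integration.integral_add Bochner_Integration.integral_diff)
    also have "\<dots> = v \<bullet> error_step D g B v"
      unfolding error_step_inner[OF symB] fourth B_inner[symmetric]
      using symmetric_opD[OF symmetric_second_moment] by simp
    finally show ?thesis .
  qed
  finally show "v \<bullet> blinfun_apply (error_step D g B + (s * g)\<^sup>2 *\<^sub>R noise_cov D w_star) v =
      (LINT \<eta>|step_law D w_star s g L. (\<eta> \<bullet> v)\<^sup>2)"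
    by (simp add: plus_blinfun.rep_eq scaleR_blinfun.rep_eq inner_add_right)
qed

text \<open>The trace in the fourth moment condition equals the expectation of
  \<open>fst z \<bullet> A (fst z)\<close>, the very scalar that multiplies the noise. Noise and
  excess fourth moment therefore merge into one injected amount per step.\<close>

lemma step_law_quadratic_ge:
  assumes low: "fourth_moment_lower D \<beta>" and A: "psd A" and basis: "orthonormal_basis (U :: 'a set)"
  shows "(LINT \<eta>|L. \<eta> \<bullet> ((id_blinfun - g *\<^sub>R second_moment D) o\<^sub>L A o\<^sub>L (id_blinfun - g *\<^sub>R second_moment D)) \<eta>)
      + g\<^sup>2 * (s\<^sup>2 * \<sigma>\<^sup>2 + \<beta> * (LINT \<eta>|L. \<eta> \<bullet> second_moment D \<eta>)) * (LINT z|D. fst z \<bullet> A (fst z))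
    \<le> (LINT \<eta>|step_law D w_star s g L. \<eta> \<bullet> A \<eta>)"
proof -
  let ?G = "second_moment D" and ?t = "LINT z|D. fst z \<bullet> A (fst z)"
  let ?R = "(id_blinfun - g *\<^sub>R second_moment D) o\<^sub>L A o\<^sub>L (id_blinfun - g *\<^sub>R second_moment D)"
  have symA: "symmetric_op A" using A by (rule psdD)
  have "op_trace (?G o\<^sub>L A) = op_trace (id_blinfun o\<^sub>L ?G o\<^sub>L A)"
    by (intro arg_cong[of _ _ op_trace] blinfun_eqI) simp
  also have "\<dots> = ?t"
    using op_trace_weak_cov[OF _ integrable_norm_sq weak_cov_second_moment symmetric_op_id symA basis] by simp
  finally have tr: "op_trace (?G o\<^sub>L A) = ?t" .
  have "psd (fourth_moment D A - (?G o\<^sub>L A o\<^sub>L ?G) - (\<beta> * ?t) *\<^sub>R ?G)"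
    using low A unfolding fourth_moment_lower_def loewner_le_def tr[symmetric] by blast
  from psdD(2)[OF this] have F: "\<beta> * ?t * (\<eta> \<bullet> ?G \<eta>) \<le> \<eta> \<bullet> fourth_moment D A \<eta> - \<eta> \<bullet> ?G (A (?G \<eta>))" for \<eta>
    by (simp add: minus_blinfun.rep_eq scaleR_blinfun.rep_eq inner_diff_right)
  have pt: "\<eta> \<bullet> ?R \<eta> + (g\<^sup>2 * \<beta> * ?t) * (\<eta> \<bullet> ?G \<eta>) \<le> \<eta> \<bullet> error_step D g A \<eta>" for \<eta>
  proof -
    have s1: "\<eta> \<bullet> A (?G \<eta>) = \<eta> \<bullet> ?G (A \<eta>)"
      using symA symmetric_second_moment by (metis inner_commute symmetric_op_def)
    have "\<eta> \<bullet> ?R \<eta> = \<eta> \<bullet> A \<eta> - 2 * g * (\<eta> \<bullet> ?G (A \<eta>)) + g\<^sup>2 * (\<eta> \<bullet> ?G (A (?G \<eta>)))"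
      by (simp add: minus_blinfun.rep_eq scaleR_blinfun.rep_eq inner_diff_right blinfun.diff_right
          blinfun.scaleR_right s1 power2_eq_square algebra_simps)
    moreover have "g\<^sup>2 * (\<beta> * ?t * (\<eta> \<bullet> ?G \<eta>)) \<le> g\<^sup>2 * (\<eta> \<bullet> fourth_moment D A \<eta> - \<eta> \<bullet> ?G (A (?G \<eta>)))"
      by (intro mult_left_mono F) simp
    ultimately show ?thesis unfolding error_step_inner[OF symA] by (simp add: algebra_simps)
  qed
  note int = integrable_quadratic_form[OF L]
  have "(LINT \<eta>|L. \<eta> \<bullet> ?R \<eta>) + (g\<^sup>2 * \<beta> * ?t) * (LINT \<eta>|L. \<eta> \<bullet> ?G \<eta>)
      = (LINT \<eta>|L. \<eta> \<bullet> ?R \<eta> + (g\<^sup>2 * \<beta> * ?t) * (\<eta> \<bullet> ?G \<eta>))"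
    by (subst Bochner_Integration.integral_add) (intro int integrable_mult_right | simp)+
  also have "\<dots> \<le> (LINT \<eta>|L. \<eta> \<bullet> error_step D g A \<eta>)"
    using pt by (intro integral_mono int Bochner_Integration.integrable_add integrable_mult_right)
  finally show ?thesis
    unfolding step_law_quadratic[OF symA] by (simp add: power_mult_distrib algebra_simps)
qed

end

end

subsection \<open>One phase of the recursion\<close>

lemma has_sum_finite_sum:
  fixes f :: "'i \<Rightarrow> 'j \<Rightarrow> real"
  assumes "finite T" "\<And>t. t \<in> T \<Longrightarrow> (f t has_sum s t) I"
  shows "((\<lambda>j. \<Sum>t\<in>T. f t j) has_sum (\<Sum>t\<in>T. s t)) I"
  using assms by (induction T rule: finite_induct) (auto intro: has_sum_add)

lemma parseval_indexed:
  fixes x y :: "'a::real_inner"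
  assumes "orthonormal_basis (v ` I)" "inj_on v I"
  shows "((\<lambda>i. (x \<bullet> v i) * (v i \<bullet> y)) has_sum (x \<bullet> y)) I"
  using parseval[OF assms(1), of x y] by (simp add: has_sum_reindex[OF assms(2)] o_def)

lemma norm_orthonormal: "orthonormal_basis (v ` I) \<Longrightarrow> i \<in> I \<Longrightarrow> norm (v i) = 1"
  by (simp add: orthonormal_basis_def)

lemma inner_orthonormal:
  assumes "orthonormal_basis (v ` I)" "inj_on v I" "i \<in> I" "j \<in> I"
  shows "v i \<bullet> v j = (if i = j then 1 else 0)"
  using assms norm_orthonormal[OF assms(1,3)]
  by (auto simp: orthonormal_basis_def pairwise_def orthogonal_def inj_on_def dot_square_norm)

context
  fixes I J :: "nat set" and a :: "nat \<Rightarrow> real"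
    and v :: "nat \<Rightarrow> 'a::{real_inner, banach}"
  assumes v: "orthonormal_basis (v ` I)" "inj_on v I" and J: "J \<subseteq> I"
    and summ: "(\<lambda>i. norm (a i)) summable_on J"
begin

text \<open>Each rank-one projection has norm at most 1, so absolutely summable coefficients make
  the series converge in operator norm. The infinite sum is then genuine rather than the default 0,
  and continuous functionals pass through it.\<close>

lemma spectral_op_inner_has_sum:
  "((\<lambda>i. a i * ((x \<bullet> v i) * (v i \<bullet> y))) has_sum (x \<bullet> spectral_op J a v y)) J"
proof -
  have "(\<lambda>i. norm (a i *\<^sub>R outer (v i) (v i))) summable_on J"
  proof (rule summable_on_comparison_test[OF summ])
    fix i assume "i \<in> J"
    then have "norm (outer (v i) (v i)) \<le> 1"
      using norm_outer_le[of "v i" "v i"] norm_orthonormal[OF v(1)] J by (metis mult_1 subsetD)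
    then show "norm (a i *\<^sub>R outer (v i) (v i)) \<le> norm (a i)"
      by (simp add: mult_left_le)
  qed simp
  then have "(\<lambda>i. a i *\<^sub>R outer (v i) (v i)) summable_on J" by (rule abs_summable_summable)
  then have hs: "((\<lambda>i. a i *\<^sub>R outer (v i) (v i)) has_sum spectral_op J a v) J"
    unfolding spectral_op_def by (rule has_sum_infsum)
  have bl: "bounded_linear (\<lambda>T. x \<bullet> blinfun_apply T y)"
    by (intro bounded_linear_inner_right_comp blinfun.bounded_linear_left)
  show ?thesis
    using has_sum_bounded_linear[OF bl hs] by (simp add: o_def scaleR_blinfun.rep_eq outer_apply mult_ac)
qed

lemma symmetric_spectral_op: "symmetric_op (spectral_op J a v)"
  unfolding symmetric_op_def
proof (intro allI)
  fix x y
  have "((\<lambda>i. a i * ((x \<bullet> v i) * (v i \<bullet> y))) has_sum (y \<bullet> spectral_op J a v x)) J"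
    using spectral_op_inner_has_sum[of y x] by (simp add: inner_commute mult_ac)
  then show "spectral_op J a v x \<bullet> y = x \<bullet> spectral_op J a v y"
    using spectral_op_inner_has_sum[of x y] by (metis has_sum_unique inner_commute)
qed

lemma spectral_op_eigenvector:
  assumes j: "j \<in> I"
  shows "spectral_op J a v (v j) = (if j \<in> J then a j else 0) *\<^sub>R v j"
proof -
  have "x \<bullet> spectral_op J a v (v j) = x \<bullet> ((if j \<in> J then a j else 0) *\<^sub>R v j)" for x
  proof -
    have "((\<lambda>i. a i * ((x \<bullet> v i) * (v i \<bullet> v j))) has_sum
        (\<Sum>i\<in>J \<inter> {j}. a i * ((x \<bullet> v i) * (v i \<bullet> v j)))) (J \<inter> {j})"
      by (rule has_sum_finite) simp
    also have "?this \<longleftrightarrow> ((\<lambda>i. a i * ((x \<bullet> v i) * (v i \<bullet> v j))) has_sum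
        (\<Sum>i\<in>J \<inter> {j}. a i * ((x \<bullet> v i) * (v i \<bullet> v j)))) J"
      using J j inner_orthonormal[OF v] by (intro has_sum_cong_neutral) auto
    finally have "x \<bullet> spectral_op J a v (v j) = (\<Sum>i\<in>J \<inter> {j}. a i * ((x \<bullet> v i) * (v i \<bullet> v j)))"
      using spectral_op_inner_has_sum[of x "v j"] has_sum_unique by blast
    then show ?thesis
      using inner_orthonormal[OF v j j] by (auto simp: Int_insert_right)
  qed
  then show ?thesis by (metis vector_eq_rdot inner_commute)
qed

lemma psd_spectral_op:
  assumes "\<And>i. i \<in> J \<Longrightarrow> 0 \<le> a i"
  shows "psd (spectral_op J a v)"
  unfolding psd_def
proof (intro conjI allI symmetric_spectral_op)
  fix x
  have "0 \<le> a i * ((x \<bullet> v i) * (v i \<bullet> x))" if "i \<in> J" for i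
    using assms[OF that] by (simp add: inner_commute[of "v i"])
  then show "0 \<le> x \<bullet> spectral_op J a v x"
    by (rule has_sum_nonneg[OF spectral_op_inner_has_sum])
qed

end

lemma eigenvalue_eq:
  assumes "eigenbasis A I l v" "i \<in> I"
  shows "v i \<bullet> blinfun_apply A (v i) = l i"
  using assms norm_orthonormal[of v I i] by (simp add: eigenbasis_def dot_square_norm)

lemma eigenvalue_pos:
  assumes "strictly_pd A" "eigenbasis A I l v" "i \<in> I"
  shows "0 < l i"
proof -
  have "v i \<noteq> 0" using assms(2,3) norm_orthonormal[of v I i] by (auto simp: eigenbasis_def)
  then show ?thesis using assms(1) eigenvalue_eq[OF assms(2,3)] by (auto simp: strictly_pd_def)
qed

lemma eigenvalue_le_norm:
  assumes "eigenbasis A I l v" "i \<in> I"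
  shows "l i \<le> norm A"
proof -
  have n: "norm (v i) = 1" and e: "A (v i) = l i *\<^sub>R v i"
    using assms norm_orthonormal[of v I i] by (auto simp: eigenbasis_def)
  have "norm (A (v i)) \<le> norm A" using norm_blinfun[of A "v i"] n by simp
  then show ?thesis using n by (simp add: e)
qed

section \<open>Products of the factors I - g A\<close>

lemma op_prod_commute:
  assumes "\<And>t x. blinfun_apply A (blinfun_apply (F t) x) = F t (A x)"
  shows "blinfun_apply A (op_prod F n x) = op_prod F n (A x)"
  using assms by (induction n) auto

lemma symmetric_op_prod:
  assumes sym: "\<And>t. symmetric_op (F t)" and comm: "\<And>s t x. blinfun_apply (F s) (blinfun_apply (F t) x) = F t (F s x)"
  shows "symmetric_op (op_prod F n)"
proof (induction n)
  case (Suc n)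
  have "F n (op_prod F n x) \<bullet> y = x \<bullet> F n (op_prod F n y)" for x y
    using sym[of n] Suc op_prod_commute[of "F n" F n y] comm by (simp add: symmetric_op_def)
  then show ?case by (simp add: symmetric_op_def)
qed simp

text \<open>These are the products \<open>Psrc\<close> and \<open>Ptgt\<close> of the theorem, with
  the step sequence as a parameter so that it can be shifted to describe the contraction after a
  given step.\<close>

definition decay_prod :: "('a::real_normed_vector \<Rightarrow>\<^sub>L 'a) \<Rightarrow> (nat \<Rightarrow> real) \<Rightarrow> nat \<Rightarrow> 'a \<Rightarrow>\<^sub>L 'a" where
  "decay_prod A g n = op_prod (\<lambda>t. id_blinfun - g t *\<^sub>R A) n"

lemma decay_prod_0 [simp]: "decay_prod A g 0 = id_blinfun"
  by (simp add: decay_prod_def)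

lemma decay_prod_Suc_apply [simp]:
  "decay_prod A g (Suc n) x = (id_blinfun - g n *\<^sub>R A) (decay_prod A g n x)"
  by (simp add: decay_prod_def)

lemma decay_prod_commute: "blinfun_apply A (decay_prod A g n x) = decay_prod A g n (A x)"
  unfolding decay_prod_def
  by (rule op_prod_commute) (simp add: minus_blinfun.rep_eq scaleR_blinfun.rep_eq blinfun.diff_right blinfun.scaleR_right)

lemma symmetric_decay_prod:
  assumes "symmetric_op A"
  shows "symmetric_op (decay_prod A g n)"
  unfolding decay_prod_def
  by (rule symmetric_op_prod)
    (simp_all add: assms symmetric_op_diff symmetric_op_scaleR minus_blinfun.rep_eq scaleR_blinfun.rep_eq
      blinfun.diff_right blinfun.scaleR_right algebra_simps)

lemma decay_prod_eigenvector:
  assumes "blinfun_apply A e = l *\<^sub>R e"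
  shows "decay_prod A g n e = (\<Prod>t<n. 1 - g t * l) *\<^sub>R e"
proof (induction n)
  case (Suc n)
  show ?case
    by (simp add: Suc minus_blinfun.rep_eq scaleR_blinfun.rep_eq blinfun.scaleR_right assms algebra_simps)
qed simp

context data_law
begin

text \<open>The trace taken in the eigenbasis is the expected squared norm of the covariate.\<close>

lemma eigenvalues_summable:
  assumes "eigenbasis (second_moment D) I mu u"
  shows "mu summable_on I"
proof -
  have ob: "orthonormal_basis (u ` I)" and inj: "inj_on u I"
    using assms by (auto simp: eigenbasis_def)
  have "((\<lambda>e. e \<bullet> id_blinfun (second_moment D (id_blinfun e))) has_sum
      (LINT z|D. id_blinfun (fst z) \<bullet> id_blinfun (fst z))) (u ` I)"
    by (rule weak_cov_trace_has_sum[OF measurable_fst_D integrable_norm_sq weak_cov_second_moment _ _ ob]) simp_all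
  then have "((\<lambda>i. u i \<bullet> second_moment D (u i)) has_sum (LINT z|D. fst z \<bullet> fst z)) I"
    by (simp add: has_sum_reindex[OF inj] o_def)
  then have "(mu has_sum (LINT z|D. fst z \<bullet> fst z)) I"
    by (rule has_sum_cong[THEN iffD1, rotated]) (rule eigenvalue_eq[OF assms])
  then show ?thesis by (auto simp: summable_on_def)
qed

text \<open>The last step is peeled off. It replaces the test form \<open>A\<close> by (I - g G) A
  (I - g G), hence an induction over all positive \<open>A\<close>. What step t injects is
  contracted only by the steps t + 1, ..., n - 1, which are \<open>n - Suc t\<close> in
  number.\<close>

lemma phase_unroll:
  fixes L :: "nat \<Rightarrow> 'a measure" and g :: "nat \<Rightarrow> real"
  defines "G \<equiv> second_moment D"
  assumes low: "fourth_moment_lower D \<beta>" and basis: "orthonormal_basis (U :: 'a set)"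
    and L: "\<And>t. t \<le> n \<Longrightarrow> sq_integrable_law (L t)"
    and step: "\<And>t. t < n \<Longrightarrow> L (Suc t) = step_law D w_star s (g t) (L t)"
    and A: "psd A"
  shows "(LINT \<eta>|L 0. decay_prod G g n \<eta> \<bullet> A (decay_prod G g n \<eta>))
    + (\<Sum>t<n. (g t)\<^sup>2 * (s\<^sup>2 * \<sigma>\<^sup>2 + \<beta> * (LINT \<eta>|L t. \<eta> \<bullet> G \<eta>)) *
        (LINT z|D. decay_prod G (\<lambda>i. g (t + 1 + i)) (n - Suc t) (fst z)
          \<bullet> A (decay_prod G (\<lambda>i. g (t + 1 + i)) (n - Suc t) (fst z))))
    \<le> (LINT \<eta>|L n. \<eta> \<bullet> A \<eta>)"
  using A L step
proof (induction n arbitrary: A)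
  case (Suc n)
  let ?R = "id_blinfun - g n *\<^sub>R G"
  let ?A = "?R o\<^sub>L A o\<^sub>L ?R"
  let ?c = "\<lambda>t. (g t)\<^sup>2 * (s\<^sup>2 * \<sigma>\<^sup>2 + \<beta> * (LINT \<eta>|L t. \<eta> \<bullet> G \<eta>))"
  have symR: "symmetric_op ?R"
    unfolding G_def by (intro symmetric_op_diff symmetric_op_scaleR symmetric_second_moment symmetric_op_id)
  have move: "y \<bullet> ?A y = ?R y \<bullet> A (?R y)" for y
    using symmetric_opD[OF symR] by simp
  have IH: "(LINT \<eta>|L 0. decay_prod G g n \<eta> \<bullet> ?A (decay_prod G g n \<eta>))
    + (\<Sum>t<n. ?c t * (LINT z|D. decay_prod G (\<lambda>i. g (t + 1 + i)) (n - Suc t) (fst z)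
          \<bullet> ?A (decay_prod G (\<lambda>i. g (t + 1 + i)) (n - Suc t) (fst z))))
    \<le> (LINT \<eta>|L n. \<eta> \<bullet> ?A \<eta>)"
    by (rule Suc.IH) (use Suc.prems psd_sandwich[OF _ symR] in auto)
  have "(LINT \<eta>|L n. \<eta> \<bullet> ?A \<eta>) + ?c n * (LINT z|D. fst z \<bullet> A (fst z)) \<le> (LINT \<eta>|L (Suc n). \<eta> \<bullet> A \<eta>)"
    using step_law_quadratic_ge[OF _ low Suc.prems(1) basis, of "L n" "g n" s] Suc.prems(2)[of n]
    by (simp add: Suc.prems(3) G_def)
  \<comment> \<open>Step n is appended to the tail after step t; in the shifted sequence its index
    is \<open>n - Suc t\<close>.\<close>
  moreover have "decay_prod G (\<lambda>i. g (t + 1 + i)) (Suc n - Suc t) x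
      = ?R (decay_prod G (\<lambda>i. g (t + 1 + i)) (n - Suc t) x)" if "t < n" for t x
  proof -
    have "Suc n - Suc t = Suc (n - Suc t)" "t + 1 + (n - Suc t) = n" using that by auto
    then show ?thesis by (simp only: decay_prod_Suc_apply)
  qed
  ultimately show ?case
    using IH unfolding move by simp
qed simp

text \<open>
  The drift term \<open>\<beta> * E \<langle>\<eta>, G \<eta>\<rangle>\<close> of step \<open>t\<close> is bounded below along the directions \<open>I - J\<close>
  only: there the contraction factors of the whole phase multiply to at least \<open>1 / 150\<close>.
\<close>

lemma phase_lower_bound:
  fixes L :: "nat \<Rightarrow> 'a measure" and I J :: "nat set" and mu :: "nat \<Rightarrow> real" and u :: "nat \<Rightarrow> 'a"
  defines "G \<equiv> second_moment D"
  assumes low: "fourth_moment_lower D \<beta>" and \<beta>: "\<beta> > 0"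
    and L: "\<And>t. t \<le> n \<Longrightarrow> sq_integrable_law (L t)"
    and step: "\<And>t. t < n \<Longrightarrow> L (Suc t) = step_law D w_star s (g t) (L t)"
    and A: "psd A"
    and pd: "strictly_pd G" and eig: "eigenbasis G I mu u"
    and len: "len = eff_size n" "len \<ge> 10"
    and \<gamma>: "0 < \<gamma>" "\<gamma> < 1 / norm G"
    and g: "\<And>t. t < n \<Longrightarrow> g t = decayed len \<gamma> t"
    and J: "J = {j \<in> I. mu j \<ge> 1 / (\<gamma> * len)}"
    and S: "((\<lambda>j. (if j \<in> J then inverse (mu j) else len\<^sup>2 * \<gamma>\<^sup>2 * mu j) * (u j \<bullet> A (u j))) has_sum S) I"
  shows "(LINT \<eta>|L 0. decay_prod G g n \<eta> \<bullet> A (decay_prod G g n \<eta>))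
    + (s\<^sup>2 * \<sigma>\<^sup>2 + \<beta> / 150 * (LINT \<eta>|L 0. \<eta> \<bullet> spectral_op (I - J) mu u \<eta>)) * (S / (700 * len))
    \<le> (LINT \<eta>|L n. \<eta> \<bullet> A \<eta>)"
proof -
  let ?Q = "\<lambda>t. decay_prod G (\<lambda>i. g (t + 1 + i)) (n - Suc t)"
  let ?\<tau> = "\<lambda>t. LINT z|D. ?Q t (fst z) \<bullet> A (?Q t (fst z))"
  let ?So = "spectral_op (I - J) mu u"
  let ?c = "s\<^sup>2 * \<sigma>\<^sup>2 + \<beta> / 150 * (LINT \<eta>|L 0. \<eta> \<bullet> ?So \<eta>)"
  have ob: "orthonormal_basis (u ` I)" and inj: "inj_on u I"
    and ev: "\<And>i. i \<in> I \<Longrightarrow> G (u i) = mu i *\<^sub>R u i"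
    using eig by (auto simp: eigenbasis_def)
  have symG: "symmetric_op G" unfolding G_def by (rule symmetric_second_moment)
  have symA: "symmetric_op A" using A by (rule psdD)
  have mu_pos: "0 < mu i" if "i \<in> I" for i using eigenvalue_pos[OF pd eig that] .
  have x: "0 < \<gamma> * mu i" "\<gamma> * mu i \<le> 1" if "i \<in> I" for i
  proof -
    show "0 < \<gamma> * mu i" using \<gamma>(1) mu_pos[OF that] by simp
    have "norm G > 0" using eigenvalue_le_norm[OF eig that] mu_pos[OF that] by linarith
    then have "\<gamma> * norm G < 1" using \<gamma>(2) by (simp add: field_simps)
    moreover have "\<gamma> * mu i \<le> \<gamma> * norm G" using eigenvalue_le_norm[OF eig that] \<gamma>(1) by simp
    ultimately show "\<gamma> * mu i \<le> 1" by linarith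
  qed
  have mu_sum: "mu summable_on I" using eigenvalues_summable eig by (simp add: G_def)
  have "(\<lambda>i. norm (mu i)) summable_on I - J"
  proof -
    have "(\<lambda>i. norm (mu i)) summable_on I"
      using mu_sum mu_pos by (auto elim!: summable_on_cong[THEN iffD1, rotated] intro: abs_of_pos[symmetric])
    then show ?thesis by (rule summable_on_subset_banach) auto
  qed
  note So = ob inj _ this
  have So_psd: "psd ?So" by (rule psd_spectral_op[OF So]) (auto intro: less_imp_le mu_pos)

  have q_eq: "?Q t (u j) = (\<Prod>k\<in>{t+1..<n}. 1 - decayed len (\<gamma> * mu j) k) *\<^sub>R u j"
    if "j \<in> I" "t < n" for t j
  proof -
    have "?Q t (u j) = (\<Prod>i<n - Suc t. 1 - g (t + 1 + i) * mu j) *\<^sub>R u j"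
      by (rule decay_prod_eigenvector[OF ev[OF that(1)]])
    also have "(\<Prod>i<n - Suc t. 1 - g (t + 1 + i) * mu j) = (\<Prod>k\<in>{t+1..<n}. 1 - decayed len (\<gamma> * mu j) k)"
      by (rule prod.reindex_bij_witness[of _ "\<lambda>k. k - (t + 1)" "\<lambda>i. t + 1 + i"])
        (auto simp: g decayed_def)
    finally show ?thesis .
  qed
  \<comment> \<open>The trace of G Q A Q in the eigenbasis of G, where Q acts by scalars.
    \<open>A\<close> need not be diagonal there: only its diagonal entries appear.\<close>
  have \<tau>_sum: "((\<lambda>j. (mu j * (\<Prod>k\<in>{t+1..<n}. 1 - decayed len (\<gamma> * mu j) k)\<^sup>2) * (u j \<bullet> A (u j))) has_sum ?\<tau> t) I"
    if "t < n" for t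
  proof -
    have symQ: "symmetric_op (?Q t)" by (rule symmetric_decay_prod[OF symG])
    have "((\<lambda>e. e \<bullet> id_blinfun (G ((?Q t o\<^sub>L A o\<^sub>L ?Q t) e))) has_sum
        (LINT z|D. id_blinfun (fst z) \<bullet> (?Q t o\<^sub>L A o\<^sub>L ?Q t) (fst z))) (u ` I)"
      unfolding G_def
      by (rule weak_cov_trace_has_sum[OF measurable_fst_D integrable_norm_sq weak_cov_second_moment _ _ ob])
        (use symmetric_op_sandwich[OF symA symQ] in \<open>simp_all add: G_def\<close>)
    then have *: "(((\<lambda>e. e \<bullet> G (?Q t (A (?Q t e)))) \<circ> u) has_sum ?\<tau> t) I"
      using symmetric_opD[OF symQ] by (simp add: has_sum_reindex[OF inj])
    show ?thesis
    proof (rule has_sum_cong[THEN iffD1, OF _ *])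
      fix j assume j: "j \<in> I"
      have "u j \<bullet> G (?Q t (A (?Q t (u j)))) = ?Q t (G (u j)) \<bullet> A (?Q t (u j))"
        using symmetric_opD[OF symG] symmetric_opD[OF symQ] by simp
      then show "((\<lambda>e. e \<bullet> G (?Q t (A (?Q t e)))) \<circ> u) j
          = (mu j * (\<Prod>k\<in>{t+1..<n}. 1 - decayed len (\<gamma> * mu j) k)\<^sup>2) * (u j \<bullet> A (u j))"
        unfolding o_def ev[OF j] blinfun.scaleR_right q_eq[OF j \<open>t < n\<close>] inner_scaleR_left
          inner_scaleR_right power2_eq_square
        by (simp only: mult_ac)
    qed
  qed
  have \<tau>_nonneg: "0 \<le> ?\<tau> t" for t by (intro Bochner_Integration.integral_nonneg psdD(2)[OF A])
  \<comment> \<open>The finite sum over steps moves inside the sum over eigenvalues, after which the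
    scalar bound \<open>decayed_variance_sum_ge\<close> at \<open>\<gamma> * mu j\<close> applies
    termwise.\<close>
  have \<tau>_bound: "S / (700 * len) \<le> (\<Sum>t<n. (g t)\<^sup>2 * ?\<tau> t)"
  proof -
    have total: "((\<lambda>j. \<Sum>t<n. (g t)\<^sup>2 * ((mu j * (\<Prod>k\<in>{t+1..<n}. 1 - decayed len (\<gamma> * mu j) k)\<^sup>2) * (u j \<bullet> A (u j))))
        has_sum (\<Sum>t<n. (g t)\<^sup>2 * ?\<tau> t)) I"
      by (intro has_sum_finite_sum has_sum_cmult_right \<tau>_sum) auto
    have weighted: "((\<lambda>j. (1 / (700 * len)) * ((if j \<in> J then inverse (mu j) else len\<^sup>2 * \<gamma>\<^sup>2 * mu j) * (u j \<bullet> A (u j))))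
        has_sum ((1 / (700 * len)) * S)) I"
      using S by (rule has_sum_cmult_right)
    have termwise: "(1 / (700 * len)) * ((if j \<in> J then inverse (mu j) else len\<^sup>2 * \<gamma>\<^sup>2 * mu j) * (u j \<bullet> A (u j)))
        \<le> (\<Sum>t<n. (g t)\<^sup>2 * ((mu j * (\<Prod>k\<in>{t+1..<n}. 1 - decayed len (\<gamma> * mu j) k)\<^sup>2) * (u j \<bullet> A (u j))))"
      if j: "j \<in> I" for j
    proof -
      let ?x = "\<gamma> * mu j"
      \<comment> \<open>Membership in \<open>J\<close> says exactly that \<open>len * ?x\<close> is
        at least 1, so the two cases of the weight are the two branches of the minimum.\<close>
      have "(if j \<in> J then inverse (mu j) else len\<^sup>2 * \<gamma>\<^sup>2 * mu j) \<le> min 1 ((len * ?x)\<^sup>2) / mu j"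
      proof (cases "j \<in> J")
        case True
        then have "1 / (\<gamma> * len) \<le> mu j" using J by auto
        then have "1 \<le> len * ?x" using \<gamma>(1) len(2) by (simp add: field_simps)
        then have "1 \<le> (len * ?x)\<^sup>2" by (rule one_le_power)
        then show ?thesis using True by (simp add: inverse_eq_divide)
      next
        case False
        then have "mu j < 1 / (\<gamma> * len)" using J j by auto
        then have "len * ?x \<le> 1" using \<gamma>(1) len(2) by (simp add: field_simps)
        then have "(len * ?x)\<^sup>2 \<le> 1" using x(1)[OF j] len(2) by (intro power_le_one) auto
        then show ?thesis using False mu_pos[OF j] by (simp add: power_mult_distrib power2_eq_square)
      qed
      then have "(if j \<in> J then inverse (mu j) else len\<^sup>2 * \<gamma>\<^sup>2 * mu j) / (700 * len)
          \<le> (min 1 ((len * ?x)\<^sup>2) / mu j) / (700 * len)"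
        using len(2) by (intro divide_right_mono) auto
      also have "\<dots> = (min 1 ((len * ?x)\<^sup>2) / (700 * len)) / mu j" by simp
      also have "\<dots> \<le> (\<Sum>t<n. (decayed len ?x t)\<^sup>2 * (\<Prod>k\<in>{t+1..<n}. 1 - decayed len ?x k)\<^sup>2) / mu j"
        using mu_pos[OF j] decayed_variance_sum_ge[OF len x[OF j]] by (intro divide_right_mono) auto
      also have "\<dots> = (\<Sum>t<n. (g t)\<^sup>2 * (mu j * (\<Prod>k\<in>{t+1..<n}. 1 - decayed len ?x k)\<^sup>2))"
        unfolding sum_divide_distrib using mu_pos[OF j]
        by (intro sum.cong refl) (simp add: g decayed_def power2_eq_square)
      finally have "(if j \<in> J then inverse (mu j) else len\<^sup>2 * \<gamma>\<^sup>2 * mu j) / (700 * len) * (u j \<bullet> A (u j))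
          \<le> (\<Sum>t<n. (g t)\<^sup>2 * (mu j * (\<Prod>k\<in>{t+1..<n}. 1 - decayed len ?x k)\<^sup>2)) * (u j \<bullet> A (u j))"
        by (intro mult_right_mono psdD(2)[OF A])
      then show ?thesis
        by (simp only: sum_distrib_right mult.assoc times_divide_eq_left mult_1_left)
    qed
    have "(1 / (700 * len)) * S \<le> (\<Sum>t<n. (g t)\<^sup>2 * ?\<tau> t)"
      by (rule has_sum_mono[OF weighted total]) (rule termwise)
    then show ?thesis by simp
  qed

  \<comment> \<open>Dropping everything injected before step t leaves the purely contracted initial
    error, and outside \<open>J\<close> the contraction costs at most the factor 150.\<close>
  have drift: "(LINT \<eta>|L 0. \<eta> \<bullet> ?So \<eta>) / 150 \<le> (LINT \<eta>|L t. \<eta> \<bullet> G \<eta>)" if t: "t < n" for t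
  proof -
    let ?P = "decay_prod G g t"
    have symP: "symmetric_op ?P" by (rule symmetric_decay_prod[OF symG])
    have psdG: "psd G"
      using pd unfolding psd_def strictly_pd_def by (metis inner_zero_left less_eq_real_def)
    have pt: "(\<eta> \<bullet> ?So \<eta>) / 150 \<le> \<eta> \<bullet> (?P o\<^sub>L G o\<^sub>L ?P) \<eta>" for \<eta>
    proof -
      have "((\<lambda>i. (1 / 150) * (mu i * ((\<eta> \<bullet> u i) * (u i \<bullet> \<eta>)))) has_sum ((1 / 150) * (\<eta> \<bullet> ?So \<eta>))) (I - J)"
        by (rule has_sum_cmult_right[OF spectral_op_inner_has_sum[OF So]]) auto
      moreover have "((\<lambda>i. (\<Prod>k<t. 1 - g k * mu i)\<^sup>2 * (mu i * ((\<eta> \<bullet> u i) * (u i \<bullet> \<eta>)))) has_sum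
          (\<eta> \<bullet> (?P o\<^sub>L G o\<^sub>L ?P) \<eta>)) I"
      proof (rule has_sum_cong[THEN iffD1, OF _ parseval_indexed[OF ob inj]])
        fix i assume i: "i \<in> I"
        have "u i \<bullet> (?P o\<^sub>L G o\<^sub>L ?P) \<eta> = ?P (G (?P (u i))) \<bullet> \<eta>"
          using symmetric_opD[OF symG] symmetric_opD[OF symP] by simp
        also have "\<dots> = (\<Prod>k<t. 1 - g k * mu i)\<^sup>2 * (mu i * (u i \<bullet> \<eta>))"
          by (simp add: decay_prod_eigenvector[OF ev[OF i]] ev[OF i] blinfun.scaleR_right power2_eq_square)
        finally show "(\<eta> \<bullet> u i) * (u i \<bullet> (?P o\<^sub>L G o\<^sub>L ?P) \<eta>)
            = (\<Prod>k<t. 1 - g k * mu i)\<^sup>2 * (mu i * ((\<eta> \<bullet> u i) * (u i \<bullet> \<eta>)))" by simp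
      qed
      ultimately have "(1 / 150) * (\<eta> \<bullet> ?So \<eta>) \<le> \<eta> \<bullet> (?P o\<^sub>L G o\<^sub>L ?P) \<eta>"
      proof (rule has_sum_mono_neutral)
        fix i assume i: "i \<in> (I - J) \<inter> I"
        \<comment> \<open>Outside \<open>J\<close> the step times eigenvalue is below 1 / len from
          the very beginning, so phase index 0 is admissible.\<close>
        have "1 / 150 \<le> (\<Prod>k\<in>{..<t}. 1 - decayed len (\<gamma> * mu i) k)\<^sup>2"
        proof (rule decayed_prod_ge[OF len(2), of _ 0 _ n])
          show "0 \<le> \<gamma> * mu i" using x(1)[of i] i by auto
          have "mu i < 1 / (\<gamma> * len)" using i J by auto
          then show "\<gamma> * mu i / 2 ^ 0 \<le> 1 / len" using \<gamma>(1) len(2) by (simp add: field_simps)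
        qed (use t in auto)
        also have "(\<Prod>k\<in>{..<t}. 1 - decayed len (\<gamma> * mu i) k) = (\<Prod>k<t. 1 - g k * mu i)"
          using t by (intro prod.cong refl) (simp add: g decayed_def)
        finally show "(1 / 150) * (mu i * ((\<eta> \<bullet> u i) * (u i \<bullet> \<eta>)))
            \<le> (\<Prod>k<t. 1 - g k * mu i)\<^sup>2 * (mu i * ((\<eta> \<bullet> u i) * (u i \<bullet> \<eta>)))"
          using mu_pos[of i] i by (intro mult_right_mono) (auto simp: inner_commute[of "u i"])
      next
        fix i assume "i \<in> I - (I - J)"
        then have "0 < mu i" using mu_pos by auto
        then show "0 \<le> (\<Prod>k<t. 1 - g k * mu i)\<^sup>2 * (mu i * ((\<eta> \<bullet> u i) * (u i \<bullet> \<eta>)))"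
          by (simp add: inner_commute[of "u i"])
      qed auto
      then show ?thesis by simp
    qed
    have L0: "sq_integrable_law (L 0)" using L by simp
    have "(LINT \<eta>|L 0. \<eta> \<bullet> ?So \<eta>) / 150 = (LINT \<eta>|L 0. (\<eta> \<bullet> ?So \<eta>) / 150)" by simp
    also have "\<dots> \<le> (LINT \<eta>|L 0. \<eta> \<bullet> (?P o\<^sub>L G o\<^sub>L ?P) \<eta>)"
      by (intro integral_mono pt integrable_quadratic_form[OF L0] integrable_divide)
    also have "\<dots> = (LINT \<eta>|L 0. ?P \<eta> \<bullet> G (?P \<eta>))"
      using symmetric_opD[OF symP] by simp
    also have "\<dots> \<le> (LINT \<eta>|L t. \<eta> \<bullet> G \<eta>)"
    proof -
      have "0 \<le> (\<Sum>k<t. (g k)\<^sup>2 * (s\<^sup>2 * \<sigma>\<^sup>2 + \<beta> * (LINT \<eta>|L k. \<eta> \<bullet> G \<eta>)) *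
          (LINT z|D. decay_prod G (\<lambda>i. g (k + 1 + i)) (t - Suc k) (fst z)
            \<bullet> G (decay_prod G (\<lambda>i. g (k + 1 + i)) (t - Suc k) (fst z))))"
        using \<beta> by (intro sum_nonneg mult_nonneg_nonneg add_nonneg_nonneg
            Bochner_Integration.integral_nonneg psdD(2)[OF psdG]) auto
      then show ?thesis
        using phase_unroll[OF low ob, of t L s g G] L step t psdG by (simp add: G_def)
    qed
    finally show ?thesis .
  qed
  \<comment> \<open>The lower bound on the drift is the same for every t, so it factors out of the
    sum that \<open>\<tau>_bound\<close> controls.\<close>
  have "?c * (S / (700 * len)) \<le> ?c * (\<Sum>t<n. (g t)\<^sup>2 * ?\<tau> t)"
    using \<beta> by (intro mult_left_mono \<tau>_bound add_nonneg_nonneg mult_nonneg_nonneg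
        Bochner_Integration.integral_nonneg psdD(2)[OF So_psd]) auto
  also have "\<dots> = (\<Sum>t<n. ((g t)\<^sup>2 * ?\<tau> t) * ?c)"
    unfolding sum_distrib_left by (intro sum.cong refl) (rule mult.commute)
  also have "\<dots> \<le> (\<Sum>t<n. ((g t)\<^sup>2 * ?\<tau> t) * (s\<^sup>2 * \<sigma>\<^sup>2 + \<beta> * (LINT \<eta>|L t. \<eta> \<bullet> G \<eta>)))"
  proof (intro sum_mono mult_left_mono add_left_mono)
    fix t assume "t \<in> {..<n}"
    then have "\<beta> * ((LINT \<eta>|L 0. \<eta> \<bullet> ?So \<eta>) / 150) \<le> \<beta> * (LINT \<eta>|L t. \<eta> \<bullet> G \<eta>)"
      using drift \<beta> by (intro mult_left_mono) auto
    then show "\<beta> / 150 * (LINT \<eta>|L 0. \<eta> \<bullet> ?So \<eta>) \<le> \<beta> * (LINT \<eta>|L t. \<eta> \<bullet> G \<eta>)" by simp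
    show "0 \<le> (g t)\<^sup>2 * ?\<tau> t" by (intro mult_nonneg_nonneg \<tau>_nonneg) simp
  qed
  also have "\<dots> = (\<Sum>t<n. (g t)\<^sup>2 * (s\<^sup>2 * \<sigma>\<^sup>2 + \<beta> * (LINT \<eta>|L t. \<eta> \<bullet> G \<eta>)) * ?\<tau> t)"
    by (intro sum.cong refl) (simp only: mult_ac)
  finally show ?thesis
    using phase_unroll[where L = L and g = g and s = s and n = n, OF low ob L step A] unfolding G_def by linarith
qed

end

subsection \<open>The law of the SGD iterates\<close>

text \<open>Each such eigenvalue contributes at least c to a finite trace. Finiteness of
  \<open>J\<close> makes the inverse eigenvalues summable on it, and finiteness of \<open>K\<close>
  keeps \<open>card K\<close> from being the default 0.\<close>

lemma finite_eigenvalues_ge: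
  fixes l :: "nat \<Rightarrow> real"
  assumes "l summable_on I" "\<And>i. i \<in> I \<Longrightarrow> 0 \<le> l i" "c > 0"
  shows "finite {i \<in> I. c \<le> l i}"
proof (rule ccontr)
  let ?K = "{i \<in> I. c \<le> l i}"
  assume inf: "infinite ?K"
  obtain n :: nat where n: "infsum l I / c < real n" using reals_Archimedean2 by blast
  obtain F where F: "finite F" "card F = n" "F \<subseteq> ?K"
    using infinite_arbitrarily_large[OF inf, of n] by blast
  have "real n * c = (\<Sum>i\<in>F. c)" using F by simp
  also have "\<dots> \<le> sum l F" using F by (intro sum_mono) auto
  also have "\<dots> \<le> infsum l I"
    using F assms by (intro finite_sum_le_infsum) auto
  finally show False using n assms(3) by (simp add: field_simps)
qed

text \<open>Step t uses step size \<open>g t\<close> and sample number \<open>Suc t\<close>, in line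
  with the indexing of \<open>sgd\<close>.\<close>

primrec err_law ::
  "(nat \<Rightarrow> ('a::{real_inner, second_countable_topology} \<times> real) measure) \<Rightarrow> (nat \<Rightarrow> real) \<Rightarrow>
   'a \<Rightarrow> real \<Rightarrow> 'a \<Rightarrow> nat \<Rightarrow> 'a measure" where
  "err_law D g w_star s \<eta>0 0 = return borel \<eta>0"
| "err_law D g w_star s \<eta>0 (Suc t) = step_law (D (Suc t)) w_star s (g t) (err_law D g w_star s \<eta>0 t)"

lemma integral_return_borel:
  fixes f :: "'a::topological_space \<Rightarrow> real"
  assumes "f \<in> borel_measurable borel"
  shows "(LINT x|return borel a. f x) = f a"
  using assms by (intro integral_return) auto

lemma borel_measurable_quadratic_form:
  fixes A B :: "'a::{real_inner, second_countable_topology} \<Rightarrow>\<^sub>L 'a"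
  shows "(\<lambda>\<eta>. A \<eta> \<bullet> B \<eta>) \<in> borel_measurable borel"
  by (intro borel_measurable_continuous_onI continuous_intros)

locale data_laws =
  fixes D :: "nat \<Rightarrow> ('a::{real_inner, banach, second_countable_topology} \<times> real) measure"
    and w_star :: 'a and \<sigma> :: real
  assumes data: "\<And>t. data_law (D t) w_star \<sigma>"
begin

lemma sq_integrable_err_law: "sq_integrable_law (err_law D g w_star s \<eta>0 t)"
proof (induction t)
  case 0
  have "integrable (return borel \<eta>0) (\<lambda>\<eta>. (norm \<eta>)\<^sup>2)" by (rule integrable_return_borel) measurable
  then show ?case by (simp add: sq_integrable_law_def prob_space_return)
next
  case (Suc t)
  then show ?case using data_law.sq_integrable_step_law[OF data] by simp
qed

lemma weak_cov_bias_iter: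
  "weak_cov (err_law D g w_star 0 \<eta>0 t) (\<lambda>\<eta>. \<eta>) (bias_iter D g (outer \<eta>0 \<eta>0) t)"
proof (induction t)
  case 0
  show ?case
    by (simp add: weak_cov_def integral_return_borel outer_apply inner_commute mult.commute)
next
  case (Suc t)
  show ?case
    using data_law.weak_cov_step_law[OF data sq_integrable_err_law Suc, of _ 0] by simp
qed

lemma weak_cov_var_iter: "weak_cov (err_law D g w_star 1 0 t) (\<lambda>\<eta>. \<eta>) (var_iter D g w_star t)"
proof (induction t)
  case 0
  show ?case by (simp add: weak_cov_def integral_return_borel)
next
  case (Suc t)
  show ?case
    using data_law.weak_cov_step_law[OF data sq_integrable_err_law Suc, of _ 1] by simp
qed

lemma err_law_quadratic_split:
  assumes "symmetric_op A"
  shows "(LINT \<eta>|err_law D g w_star 1 \<eta>0 t. \<eta> \<bullet> A \<eta>)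
    = (LINT \<eta>|err_law D g w_star 0 \<eta>0 t. \<eta> \<bullet> A \<eta>) + (LINT \<eta>|err_law D g w_star 1 0 t. \<eta> \<bullet> A \<eta>)"
  using assms
proof (induction t arbitrary: A)
  case 0
  have "(\<lambda>\<eta>. \<eta> \<bullet> A \<eta>) \<in> borel_measurable borel"
    using borel_measurable_quadratic_form[of id_blinfun A] by simp
  then show ?case by (simp add: integral_return_borel)
next
  case (Suc t)
  interpret data_law "D (Suc t)" w_star \<sigma> by (rule data)
  show ?case
    using Suc.IH[OF symmetric_error_step[OF Suc.prems]]
    by (simp add: step_law_quadratic[OF sq_integrable_err_law Suc.prems])
qed

lemma op_inner_weak_cov_err_law:
  assumes "weak_cov (err_law D g w_star s \<eta>0 t) (\<lambda>\<eta>. \<eta>) B" "symmetric_op A"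
    and "orthonormal_basis (U :: 'a set)"
  shows "op_inner A B = (LINT \<eta>|err_law D g w_star s \<eta>0 t. \<eta> \<bullet> A \<eta>)"
proof -
  have L: "sets (err_law D g w_star s \<eta>0 t) = sets borel"
    "integrable (err_law D g w_star s \<eta>0 t) (\<lambda>\<eta>. (norm \<eta>)\<^sup>2)"
    using sq_integrable_err_law by (auto simp: sq_integrable_law_def)
  have "op_inner A B = op_trace (A o\<^sub>L B o\<^sub>L id_blinfun)"
    unfolding op_inner_symmetric[OF assms(2)] by (intro arg_cong[of _ _ op_trace] blinfun_eqI) simp
  also have "\<dots> = (LINT \<eta>|err_law D g w_star s \<eta>0 t. A \<eta> \<bullet> id_blinfun \<eta>)"
    by (rule op_trace_weak_cov[OF measurable_ident_sets[OF L(1)] L(2) assms(1,2) symmetric_op_id assms(3)])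
  finally show ?thesis by (simp add: inner_commute)
qed

end

section \<open>The law of actual SGD\<close>

lemma sgd_cong: "(\<And>i. 1 \<le> i \<Longrightarrow> i \<le> t \<Longrightarrow> z i = z' i) \<Longrightarrow> sgd g w0 z t = sgd g w0 z' t"
  by (induction t) (auto simp: Let_def)

lemma borel_measurable_sgd:
  fixes w0 :: "'a::{real_inner, second_countable_topology}"
  assumes "t \<le> n"
  shows "(\<lambda>z. sgd g w0 z t) \<in> borel_measurable (PiM {1..n} (\<lambda>_. borel))"
  using assms
proof (induction t)
  case (Suc t)
  have "(\<lambda>z. z (Suc t)) \<in> borel_measurable (PiM {1..n} (\<lambda>_. borel :: ('a \<times> real) measure))"
    using Suc.prems by (intro measurable_component_singleton) auto
  then have "(\<lambda>z. fst (z (Suc t))) \<in> borel_measurable (PiM {1..n} (\<lambda>_. borel :: ('a \<times> real) measure))"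
    "(\<lambda>z. snd (z (Suc t))) \<in> borel_measurable (PiM {1..n} (\<lambda>_. borel :: ('a \<times> real) measure))"
    by (rule borel_measurable_continuous_on[rotated], intro continuous_intros)+
  moreover have "(\<lambda>z. sgd g w0 z t) \<in> borel_measurable (PiM {1..n} (\<lambda>_. borel))"
    using Suc by simp
  ultimately show ?case
    unfolding sgd.simps Let_def
    by (intro borel_measurable_diff borel_measurable_scaleR borel_measurable_const borel_measurable_inner)
qed simp

text \<open>Iterate t is a function of the samples 1 to t, hence independent of sample t + 1. The
  joint law is a product, and its image under one error step is \<open>step_law\<close>.\<close>

lemma distr_sgd:
  fixes Z :: "nat \<Rightarrow> 'w \<Rightarrow> 'a::{real_inner, banach, second_countable_topology} \<times> real"
  assumes "prob_space \<Omega>" and indep: "prob_space.indep_vars \<Omega> (\<lambda>_. borel) Z {1..n}"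
    and law: "\<And>t. t \<in> {1..n} \<Longrightarrow> distr \<Omega> borel (Z t) = D t"
    and "t \<le> n"
  shows "(\<lambda>\<omega>. sgd g w0 (\<lambda>t. Z t \<omega>) t - w_star) \<in> borel_measurable \<Omega> \<and>
    distr \<Omega> borel (\<lambda>\<omega>. sgd g w0 (\<lambda>t. Z t \<omega>) t - w_star) = err_law D g w_star 1 (w0 - w_star) t"
  using \<open>t \<le> n\<close>
proof (induction t)
  case 0
  interpret prob_space \<Omega> by fact
  have "distr \<Omega> borel (\<lambda>\<omega>. w0 - w_star) = return borel (w0 - w_star)"
    using distr_const[of "w0 - w_star" borel] by simp
  then show ?case by simp
next
  case (Suc t)
  interpret prob_space \<Omega> by fact
  let ?\<eta> = "\<lambda>\<omega>. sgd g w0 (\<lambda>t. Z t \<omega>) t - w_star" and ?Z = "Z (Suc t)"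
  \<comment> \<open>\<open>indep_var\<close> takes two variables of the same type, so the error is
    padded with a zero response; \<open>fst\<close> removes the padding again.\<close>
  let ?X = "\<lambda>\<omega>. (?\<eta> \<omega>, 0::real)" and ?L = "err_law D g w_star 1 (w0 - w_star) t"
  have \<eta>: "?\<eta> \<in> borel_measurable \<Omega>" and L: "distr \<Omega> borel ?\<eta> = ?L" using Suc by auto
  have pair0: "(\<lambda>\<eta>::'a. (\<eta>, 0::real)) \<in> borel_measurable borel"
    by (intro borel_measurable_continuous_onI continuous_intros)
  have m1: "(\<lambda>z. (sgd g w0 z t - w_star, 0::real)) \<in> borel_measurable (PiM {1..t} (\<lambda>_. borel))"
    using measurable_compose[OF borel_measurable_diff[OF borel_measurable_sgd[OF order_refl] borel_measurable_const] pair0] .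
  have m2: "(\<lambda>z. z (Suc t)) \<in> borel_measurable (PiM {Suc t} (\<lambda>_. borel :: ('a \<times> real) measure))"
    by (intro measurable_component_singleton) simp
  have "indep_var (PiM {1..t} (\<lambda>_. borel)) (\<lambda>\<omega>. restrict (\<lambda>i. Z i \<omega>) {1..t})
      (PiM {Suc t} (\<lambda>_. borel)) (\<lambda>\<omega>. restrict (\<lambda>i. Z i \<omega>) {Suc t})"
    using Suc.prems by (intro indep_var_restrict[OF indep]) auto
  from indep_var_compose[OF this m1 m2]
  have "indep_var borel ((\<lambda>z. (sgd g w0 z t - w_star, 0)) \<circ> (\<lambda>\<omega>. restrict (\<lambda>i. Z i \<omega>) {1..t}))
      borel ((\<lambda>z. z (Suc t)) \<circ> (\<lambda>\<omega>. restrict (\<lambda>i. Z i \<omega>) {Suc t}))" .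
  moreover have "(\<lambda>z. (sgd g w0 z t - w_star, 0)) \<circ> (\<lambda>\<omega>. restrict (\<lambda>i. Z i \<omega>) {1..t}) = ?X"
    by (intro ext) (simp, rule sgd_cong, simp)
  moreover have "(\<lambda>z. z (Suc t)) \<circ> (\<lambda>\<omega>. restrict (\<lambda>i. Z i \<omega>) {Suc t}) = ?Z"
    by (intro ext) simp
  ultimately have "indep_var borel ?X borel ?Z" by simp
  then have XZ: "?X \<in> borel_measurable \<Omega>" "?Z \<in> borel_measurable \<Omega>"
    "distr \<Omega> borel ?X \<Otimes>\<^sub>M distr \<Omega> borel ?Z = distr \<Omega> (borel \<Otimes>\<^sub>M borel) (\<lambda>\<omega>. (?X \<omega>, ?Z \<omega>))"
    unfolding indep_var_distribution_eq by auto
  have Dt: "distr \<Omega> borel ?Z = D (Suc t)" using law Suc.prems by auto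
  have setsD: "sets (D (Suc t)) = sets borel" unfolding Dt[symmetric] by simp
  have fst_m: "(fst :: 'a \<times> real \<Rightarrow> 'a) \<in> borel_measurable borel"
    by (intro borel_measurable_continuous_onI continuous_intros)
  let ?st = "\<lambda>p :: 'a \<times> ('a \<times> real). sgd_error_step 1 (g t) w_star (fst p) (snd p)"
  have st: "?st \<in> borel_measurable (borel \<Otimes>\<^sub>M borel)"
    unfolding borel_prod sgd_error_step_def by (intro borel_measurable_continuous_onI continuous_intros)
  have "?L \<Otimes>\<^sub>M D (Suc t) = distr \<Omega> (borel \<Otimes>\<^sub>M borel) (\<lambda>\<omega>. (?\<eta> \<omega>, ?Z \<omega>))"
  proof -
    have "?L = distr (distr \<Omega> borel ?X) borel fst"
      unfolding L[symmetric] by (subst distr_distr[OF fst_m XZ(1)]) (simp add: o_def)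
    moreover have "D (Suc t) = distr (distr \<Omega> borel ?Z) borel (\<lambda>z. z)"
      unfolding Dt by (rule distr_id2[OF setsD[symmetric], symmetric])
    ultimately have "?L \<Otimes>\<^sub>M D (Suc t) = distr (distr \<Omega> borel ?X) borel fst \<Otimes>\<^sub>M distr (distr \<Omega> borel ?Z) borel (\<lambda>z. z)"
      by simp
    also have "\<dots> = distr (distr \<Omega> borel ?X \<Otimes>\<^sub>M distr \<Omega> borel ?Z) (borel \<Otimes>\<^sub>M borel) (\<lambda>(x, y). (fst x, y))"
    proof (rule pair_measure_distr)
      show "fst \<in> distr \<Omega> borel ?X \<rightarrow>\<^sub>M borel" using fst_m by simp
      have "prob_space (distr (distr \<Omega> borel ?Z) borel (\<lambda>z. z))"
        using XZ(2) by (intro prob_space.prob_space_distr prob_space_distr) auto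
      then show "sigma_finite_measure (distr (distr \<Omega> borel ?Z) borel (\<lambda>z. z))"
        by (rule prob_space_imp_sigma_finite)
    qed simp
    also have "\<dots> = distr \<Omega> (borel \<Otimes>\<^sub>M borel) (\<lambda>\<omega>. (?\<eta> \<omega>, ?Z \<omega>))"
    proof -
      have 1: "(\<lambda>(x :: 'a \<times> real, y :: 'a \<times> real). (fst x, y)) \<in> borel \<Otimes>\<^sub>M borel \<rightarrow>\<^sub>M borel \<Otimes>\<^sub>M borel"
        unfolding borel_prod split_beta by (intro borel_measurable_continuous_onI continuous_intros)
      have 2: "(\<lambda>\<omega>. (?X \<omega>, ?Z \<omega>)) \<in> \<Omega> \<rightarrow>\<^sub>M borel \<Otimes>\<^sub>M borel"
        using XZ by (intro measurable_Pair)
      show ?thesis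
        unfolding XZ(3) distr_distr[OF 1 2] by (simp only: o_def split_conv fst_conv)
    qed
    finally show ?thesis .
  qed
  moreover have pair: "(\<lambda>\<omega>. (?\<eta> \<omega>, ?Z \<omega>)) \<in> \<Omega> \<rightarrow>\<^sub>M borel \<Otimes>\<^sub>M borel"
    using \<eta> XZ(2) by (intro measurable_Pair)
  ultimately have "err_law D g w_star 1 (w0 - w_star) (Suc t) = distr \<Omega> borel (?st \<circ> (\<lambda>\<omega>. (?\<eta> \<omega>, ?Z \<omega>)))"
    by (simp add: step_law_def distr_distr[OF st])
  moreover have eq: "?st \<circ> (\<lambda>\<omega>. (?\<eta> \<omega>, ?Z \<omega>)) = (\<lambda>\<omega>. sgd g w0 (\<lambda>t. Z t \<omega>) (Suc t) - w_star)"
    by (intro ext) (simp add: sgd_error_step_def Let_def inner_diff_right algebra_simps)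
  ultimately have law': "distr \<Omega> borel (\<lambda>\<omega>. sgd g w0 (\<lambda>t. Z t \<omega>) (Suc t) - w_star)
      = err_law D g w_star 1 (w0 - w_star) (Suc t)" by simp
  have "(\<lambda>\<omega>. sgd g w0 (\<lambda>t. Z t \<omega>) (Suc t) - w_star) \<in> borel_measurable \<Omega>"
    unfolding eq[symmetric] by (rule measurable_comp[OF pair st])
  with law' show ?case by simp
qed

text \<open>The residual is the noise minus the inner product of the covariate with
  \<open>w - w_star\<close>. The cross term has mean zero and the noise variance cancels in the
  difference.\<close>

lemma (in data_law) excess_risk_eq:
  "excess_risk D w_star w = (1/2) * ((w - w_star) \<bullet> second_moment D (w - w_star))"
proof -
  let ?d = "w - w_star"
  have eq: "(snd z - w \<bullet> fst z)\<^sup>2 = (noise z)\<^sup>2 + noise z * (- 2 * (fst z \<bullet> ?d)) + (fst z \<bullet> ?d) * (fst z \<bullet> ?d)" for z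
    by (simp add: power2_eq_square inner_diff_right inner_commute[of w] algebra_simps)
  have lin: "integrable D (\<lambda>z. - 2 * (fst z \<bullet> ?d))"
    by (rule integrable_covariate_poly[of _ 1 "2 * norm ?d"])
      (auto simp: abs_mult mult.commute Cauchy_Schwarz_ineq2)
  have lin_m: "(\<lambda>x. - 2 * (x \<bullet> ?d)) \<in> borel_measurable borel" by measurable
  have sq: "integrable D (\<lambda>z. (fst z \<bullet> ?d) * (fst z \<bullet> ?d))"
    using weighted_moment_inner_integrable[of fst D "\<lambda>_. 1"] integrable_norm_sq by simp
  note n = noise_mult[OF lin_m lin] noise_moments
  have "(LINT z|D. (snd z - w \<bullet> fst z)\<^sup>2) = \<sigma>\<^sup>2 + 0 + ?d \<bullet> second_moment D ?d"
    unfolding eq second_moment_inner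
    by (subst Bochner_Integration.integral_add[OF Bochner_Integration.integrable_add[OF n(7) n(1)] sq],
        subst Bochner_Integration.integral_add[OF n(7) n(1)]) (simp only: n(2) n(8))
  moreover have "(LINT z|D. (snd z - w_star \<bullet> fst z)\<^sup>2) = \<sigma>\<^sup>2"
    using n(8) by (simp add: inner_commute)
  ultimately show ?thesis by (simp only: excess_risk_def risk_def) (simp add: field_simps)
qed

theorem theorem2:
  fixes Dsrc Dtgt :: "('a::{real_inner, banach, second_countable_topology} \<times> real) measure"
    and \<Omega> :: "'w measure" and Z :: "nat \<Rightarrow> 'w \<Rightarrow> 'a \<times> real"
    and G H :: "'a \<Rightarrow>\<^sub>L 'a" and w0 w_star :: 'a
    and I J K :: "nat set" and mu lam :: "nat \<Rightarrow> real" and u v :: "nat \<Rightarrow> 'a"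
    and M N :: nat and \<beta> \<sigma> \<gamma>0 \<gamma>M Meff Neff Dft Deff BiasErr VarErr :: real
    and \<gamma> :: "nat \<Rightarrow> real" and Psrc Ptgt :: "'a \<Rightarrow>\<^sub>L 'a"
  assumes "prob_space Dsrc" and "sets Dsrc = sets borel"
    and "prob_space Dtgt" and "sets Dtgt = sets borel"
    and "integrable Dsrc (\<lambda>z. (norm (fst z))\<^sup>2)" and "integrable Dtgt (\<lambda>z. (norm (fst z))\<^sup>2)"
    and G: "G = second_moment Dsrc" and H: "H = second_moment Dtgt"
    and "strictly_pd G" and "strictly_pd H"
    and "eigenbasis G I mu u" and "eigenbasis H I lam v"
    and "{w. (\<forall>w'. risk Dsrc w \<le> risk Dsrc w') \<and> (\<forall>w'. risk Dtgt w \<le> risk Dtgt w')} = {w_star}"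
    and "\<beta> > 0" and "fourth_moment_lower Dsrc \<beta>" and "fourth_moment_lower Dtgt \<beta>"
    and "\<sigma> \<ge> 0" and "well_specified Dsrc w_star \<sigma>" and "well_specified Dtgt w_star \<sigma>"
    and "prob_space \<Omega>" and "prob_space.indep_vars \<Omega> (\<lambda>_. borel) Z {1..M+N}"
    and "\<And>t. t \<in> {1..M} \<Longrightarrow> distr \<Omega> borel (Z t) = Dsrc"
    and "\<And>t. t \<in> {M+1..M+N} \<Longrightarrow> distr \<Omega> borel (Z t) = Dtgt"
    and Meff: "Meff = eff_size M" and Neff: "Neff = eff_size N"
    and "Meff \<ge> 10" and "Neff \<ge> 10"
    and "0 < \<gamma>0" and "\<gamma>0 < 1 / norm G" and "0 < \<gamma>M" and "\<gamma>M < 1 / norm H"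
    and \<gamma>: "\<gamma> = stepsize M N \<gamma>0 \<gamma>M"
    and w0: "w0 = 0"
    and BiasErr: "BiasErr = bias_err Dsrc Dtgt M N \<gamma> w0 w_star"
    and VarErr: "VarErr = var_err Dsrc Dtgt M N \<gamma> w_star"
    and J: "J = {j \<in> I. mu j \<ge> 1 / (\<gamma>0 * Meff)}"
    and K: "K = {k \<in> I. lam k \<ge> 1 / (\<gamma>M * Neff)}"
    and Psrc: "Psrc = op_prod (\<lambda>t. id_blinfun - \<gamma> t *\<^sub>R G) M"
    and Ptgt: "Ptgt = op_prod (\<lambda>t. id_blinfun - \<gamma> (M + t) *\<^sub>R H) N"
    and Dft: "Dft = op_trace
      (op_prod (\<lambda>t. (id_blinfun - \<gamma> (M + t) *\<^sub>R H) o\<^sub>L (id_blinfun - \<gamma> (M + t) *\<^sub>R H)) N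
       o\<^sub>L H
       o\<^sub>L (spectral_op J (\<lambda>i. inverse (mu i)) u + (Meff\<^sup>2 * \<gamma>0\<^sup>2) *\<^sub>R spectral_op (I - J) mu u))"
    and Deff: "Deff = real (card K) + Neff\<^sup>2 * \<gamma>M\<^sup>2 * (\<Sum>\<^sub>\<infinity>i\<in>I - K. (lam i)\<^sup>2)"
  shows "has_bochner_integral \<Omega>
           (\<lambda>\<omega>. excess_risk Dtgt w_star (sgd \<gamma> w0 (\<lambda>t. Z t \<omega>) (M + N))) (BiasErr + VarErr)
       \<and> VarErr \<greatersim> \<sigma>\<^sup>2 * (Dft / Meff + Deff / Neff)
       \<and> BiasErr \<greatersim>
           sq_wnorm H (blinfun_apply (Ptgt o\<^sub>L Psrc) (w0 - w_star))
           + \<beta> * sq_wnorm (spectral_op (I - J) mu u) (w0 - w_star) * (Dft / Meff)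
           + \<beta> * sq_wnorm (spectral_op (I - K) lam v) (blinfun_apply Psrc (w0 - w_star))
               * (Deff / Neff)"
proof -
  define D where "D = sample_law Dsrc Dtgt M"
  note Deff_def = Deff and Dft_def = Dft
  interpret src: data_law Dsrc w_star \<sigma>
    using assms(1,2,15,17,18) by (intro data_law.intro data_law_axioms.intro) (auto simp: fourth_moment_lower_def)
  interpret tgt: data_law Dtgt w_star \<sigma>
    using assms(3,4,16,17,19) by (intro data_law.intro data_law_axioms.intro) (auto simp: fourth_moment_lower_def)
  interpret data_laws D w_star \<sigma>
    by (rule data_laws.intro) (simp add: D_def sample_law_def src.data_law_axioms tgt.data_law_axioms)
  have obu: "orthonormal_basis (u ` I)" "inj_on u I" and obv: "orthonormal_basis (v ` I)" "inj_on v I"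
    and evu: "\<And>i. i \<in> I \<Longrightarrow> G (u i) = mu i *\<^sub>R u i"
    using assms(11,12) by (auto simp: eigenbasis_def)
  have symG: "symmetric_op G" and symH: "symmetric_op H"
    unfolding G H by (rule src.symmetric_second_moment tgt.symmetric_second_moment)+
  have psdH: "psd H"
    using assms(10) unfolding psd_def strictly_pd_def by (metis inner_zero_left less_eq_real_def)
  have mu_pos: "0 < mu i" and lam_pos: "0 < lam i" if "i \<in> I" for i
    using eigenvalue_pos[OF assms(9,11) that] eigenvalue_pos[OF assms(10,12) that] .
  have mu_sum: "mu summable_on I" and lam_sum: "lam summable_on I"
    using src.eigenvalues_summable tgt.eigenvalues_summable assms(11,12) unfolding G H by blast+
  have finJ: "finite J" and finK: "finite K"
    unfolding J K using mu_sum lam_sum mu_pos lam_pos assms(26-28,30)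
    by (auto intro!: finite_eigenvalues_ge intro: less_imp_le)
  have JI: "J \<subseteq> I" and KI: "K \<subseteq> I" by (auto simp: J K)
  have summJ: "(\<lambda>i. norm (inverse (mu i))) summable_on J" using finJ by (rule summable_on_finite)
  have summJc: "(\<lambda>i. norm (mu i)) summable_on I - J"
    using summable_on_subset_banach[OF mu_sum, of "I - J"] mu_pos
    by (subst summable_on_cong[of _ _ mu]) (auto simp: abs_of_pos)
  have summKc: "(\<lambda>i. norm (lam i)) summable_on I - K"
    using summable_on_subset_banach[OF lam_sum, of "I - K"] lam_pos
    by (subst summable_on_cong[of _ _ lam]) (auto simp: abs_of_pos)
  define SJ where "SJ = spectral_op (I - J) mu u"
  define SK where "SK = spectral_op (I - K) lam v"
  have psdSJ: "psd SJ"
    unfolding SJ_def using mu_pos by (intro psd_spectral_op[OF obu _ summJc]) (auto intro: less_imp_le)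
  have psdSK: "psd SK"
    unfolding SK_def using lam_pos by (intro psd_spectral_op[OF obv _ summKc]) (auto intro: less_imp_le)

  let ?g = "\<lambda>t. \<gamma> (M + t)"
  have gsrc: "\<gamma> t = decayed Meff \<gamma>0 t" if "t < M" for t
    using that by (simp add: \<gamma> stepsize_def decayed_def Meff)
  have gtgt: "?g t = decayed Neff \<gamma>M t" for t
    by (simp add: \<gamma> stepsize_def decayed_def Neff)
  have Psrc': "decay_prod G \<gamma> M = Psrc" and Ptgt': "decay_prod H ?g N = Ptgt"
    by (simp_all add: Psrc Ptgt decay_prod_def)
  have symP: "symmetric_op Ptgt" unfolding Ptgt'[symmetric] by (rule symmetric_decay_prod[OF symH])
  have Pcomm: "H (Ptgt x) = Ptgt (H x)" for x
    unfolding Ptgt'[symmetric] by (rule decay_prod_commute)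
  \<comment> \<open>The target phase pulls the final form \<open>H\<close> back to this one, which
    becomes the test form for the source phase.\<close>
  define A where "A = Ptgt o\<^sub>L H o\<^sub>L Ptgt"
  have psdA: "psd A" unfolding A_def by (rule psd_sandwich[OF psdH symP])
  have A_inner: "x \<bullet> A x = Ptgt x \<bullet> H (Ptgt x)" for x
    using symmetric_opD[OF symP] by (simp add: A_def)

  \<comment> \<open>The weighted sum of the target phase for the form \<open>H\<close>: the diagonal
    entries are \<open>lam j\<close>, so the weights yield 1 on \<open>K\<close> and a multiple of
    the squared eigenvalue elsewhere.\<close>
  have Deff_sum: "((\<lambda>j. (if j \<in> K then inverse (lam j) else Neff\<^sup>2 * \<gamma>M\<^sup>2 * lam j) * (v j \<bullet> H (v j)))
      has_sum Deff) I"
  proof -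
    have "((\<lambda>j. 1 :: real) has_sum real (card K)) K"
      using has_sum_finite[OF finK, of "\<lambda>_. 1 :: real"] by simp
    then have 1: "((\<lambda>j. (if j \<in> K then inverse (lam j) else Neff\<^sup>2 * \<gamma>M\<^sup>2 * lam j) * (v j \<bullet> H (v j)))
        has_sum real (card K)) K"
    proof (rule has_sum_cong[THEN iffD1, rotated])
      fix j assume "j \<in> K"
      then show "1 = (if j \<in> K then inverse (lam j) else Neff\<^sup>2 * \<gamma>M\<^sup>2 * lam j) * (v j \<bullet> H (v j))"
        using KI eigenvalue_eq[OF assms(12), of j] lam_pos[of j] by auto
    qed
    have "(\<lambda>i. (lam i)\<^sup>2) summable_on I - K"
    proof (rule summable_on_comparison_test)
      show "(\<lambda>i. norm H * norm (lam i)) summable_on I - K" by (rule summable_on_cmult_right[OF summKc])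
      show "(lam i)\<^sup>2 \<le> norm H * norm (lam i)" if "i \<in> I - K" for i
        using that eigenvalue_le_norm[OF assms(12), of i] lam_pos[of i]
        by (auto simp: power2_eq_square intro: mult_right_mono)
    qed simp
    then have "((\<lambda>i. Neff\<^sup>2 * \<gamma>M\<^sup>2 * (lam i)\<^sup>2) has_sum (Neff\<^sup>2 * \<gamma>M\<^sup>2 * (\<Sum>\<^sub>\<infinity>i\<in>I - K. (lam i)\<^sup>2))) (I - K)"
      by (intro has_sum_cmult_right has_sum_infsum)
    then have 2: "((\<lambda>j. (if j \<in> K then inverse (lam j) else Neff\<^sup>2 * \<gamma>M\<^sup>2 * lam j) * (v j \<bullet> H (v j)))
        has_sum (Neff\<^sup>2 * \<gamma>M\<^sup>2 * (\<Sum>\<^sub>\<infinity>i\<in>I - K. (lam i)\<^sup>2))) (I - K)"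
    proof (rule has_sum_cong[THEN iffD1, rotated])
      fix j assume "j \<in> I - K"
      then show "Neff\<^sup>2 * \<gamma>M\<^sup>2 * (lam j)\<^sup>2
          = (if j \<in> K then inverse (lam j) else Neff\<^sup>2 * \<gamma>M\<^sup>2 * lam j) * (v j \<bullet> H (v j))"
        using eigenvalue_eq[OF assms(12), of j] by (simp add: power2_eq_square)
    qed
    have "K \<union> (I - K) = I" using KI by auto
    then show ?thesis using has_sum_Un_disjoint[OF 1 2] by (simp add: Deff_def)
  qed

  \<comment> \<open>The operator under the trace need not be symmetric. In the eigenbasis of
    \<open>G\<close> its last factor becomes a scalar weight, and since \<open>H\<close> commutes
    with \<open>Ptgt\<close> the remaining factors are the form \<open>A\<close>.\<close>
  have Dft_sum: "((\<lambda>j. (if j \<in> J then inverse (mu j) else Meff\<^sup>2 * \<gamma>0\<^sup>2 * mu j) * (u j \<bullet> A (u j)))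
      has_sum Dft) I"
  proof -
    define S where "S = spectral_op J (\<lambda>i. inverse (mu i)) u + (Meff\<^sup>2 * \<gamma>0\<^sup>2) *\<^sub>R SJ"
    let ?F = "\<lambda>t. id_blinfun - \<gamma> (M + t) *\<^sub>R H"
    let ?P2 = "op_prod (\<lambda>t. ?F t o\<^sub>L ?F t) N"
    have symS: "symmetric_op S"
      unfolding S_def using psdD(1)[OF psdSJ]
      by (intro symmetric_op_add symmetric_op_scaleR symmetric_spectral_op[OF obu JI summJ])
    have S_eig: "S (u j) = (if j \<in> J then inverse (mu j) else Meff\<^sup>2 * \<gamma>0\<^sup>2 * mu j) *\<^sub>R u j" if "j \<in> I" for j
      using spectral_op_eigenvector[OF obu JI summJ that]
        spectral_op_eigenvector[OF obu _ summJc that] that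
      by (simp add: S_def SJ_def plus_blinfun.rep_eq scaleR_blinfun.rep_eq)
    have P2: "?P2 x = Ptgt (Ptgt x)" for x
    proof -
      have "op_prod (\<lambda>t. ?F t o\<^sub>L ?F t) n x = op_prod ?F n (op_prod ?F n x)" for n
      proof (induction n)
        case (Suc n)
        have "?F n (op_prod ?F n y) = op_prod ?F n (?F n y)" for y
          by (rule op_prod_commute)
            (simp add: minus_blinfun.rep_eq scaleR_blinfun.rep_eq blinfun.diff_right blinfun.scaleR_right algebra_simps)
        then show ?case by (simp add: Suc del: minus_blinfun.rep_eq)
      qed simp
      then show ?thesis by (simp add: Ptgt)
    qed
    have symP2: "symmetric_op ?P2"
      using symP by (simp add: symmetric_op_def P2)
    have "Dft = op_trace (?P2 o\<^sub>L H o\<^sub>L S)" unfolding Dft_def S_def SJ_def by simp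
    also have "\<dots> = (LINT z|Dtgt. ?P2 (fst z) \<bullet> S (fst z))"
      unfolding H by (rule op_trace_weak_cov[OF tgt.measurable_fst_D tgt.integrable_norm_sq
            tgt.weak_cov_second_moment symP2[unfolded H] symS obu(1)])
    finally have Dft': "(LINT z|Dtgt. ?P2 (fst z) \<bullet> S (fst z)) = Dft" by simp
    have "((\<lambda>e. e \<bullet> ?P2 (H (S e))) has_sum Dft) (u ` I)"
      unfolding Dft'[symmetric] unfolding H
      by (rule weak_cov_trace_has_sum[OF tgt.measurable_fst_D tgt.integrable_norm_sq
            tgt.weak_cov_second_moment symP2[unfolded H] symS obu(1)])
    then have *: "((\<lambda>j. u j \<bullet> ?P2 (H (S (u j)))) has_sum Dft) I"
      by (simp only: has_sum_reindex[OF obu(2)] o_def)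
    show ?thesis
    proof (rule has_sum_cong[THEN iffD1, OF _ *])
      fix j assume j: "j \<in> I"
      have "u j \<bullet> ?P2 (H x) = u j \<bullet> A x" for x
        unfolding P2 A_def by (simp add: Pcomm)
      then show "u j \<bullet> ?P2 (H (S (u j)))
          = (if j \<in> J then inverse (mu j) else Meff\<^sup>2 * \<gamma>0\<^sup>2 * mu j) * (u j \<bullet> A (u j))"
        by (simp only: S_eig[OF j] blinfun.scaleR_right inner_scaleR_right)
    qed
  qed
  have Deff_nonneg: "0 \<le> Deff"
    by (rule has_sum_nonneg[OF Deff_sum])
      (use psdD(2)[OF psdH] less_imp_le[OF lam_pos] in \<open>auto intro!: mult_nonneg_nonneg\<close>)
  have Dft_nonneg: "0 \<le> Dft"
    by (rule has_sum_nonneg[OF Dft_sum])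
      (use psdD(2)[OF psdA] less_imp_le[OF mu_pos] in \<open>auto intro!: mult_nonneg_nonneg\<close>)

  define q where "q s \<eta>0 = (LINT \<eta>|err_law D \<gamma> w_star s \<eta>0 (M + N). \<eta> \<bullet> H \<eta>)" for s \<eta>0
  \<comment> \<open>One bound for all s and all starting points serves both errors: s = 0 from
    \<open>w0 - w_star\<close> for the bias, s = 1 from 0 for the variance.\<close>
  have bound: "sq_wnorm H ((Ptgt o\<^sub>L Psrc) \<eta>0)
      + (s\<^sup>2 * \<sigma>\<^sup>2 + \<beta> / 150 * sq_wnorm SJ \<eta>0) * (Dft / (700 * Meff))
      + (s\<^sup>2 * \<sigma>\<^sup>2 + \<beta> / 150 * sq_wnorm SK (Psrc \<eta>0)) * (Deff / (700 * Neff)) \<le> q s \<eta>0" for s \<eta>0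
  proof -
    let ?L = "err_law D \<gamma> w_star s \<eta>0"
    have step_src: "?L (Suc t) = step_law Dsrc w_star s (\<gamma> t) (?L t)" if "t < M" for t
      using that by (simp add: D_def sample_law_def)
    have step_tgt: "?L (M + Suc t) = step_law Dtgt w_star s (\<gamma> (M + t)) (?L (M + t))" for t
      by (simp add: D_def sample_law_def)
    have start: "(LINT \<eta>|?L 0. T \<eta> \<bullet> R \<eta>) = T \<eta>0 \<bullet> R \<eta>0" for T R :: "'a \<Rightarrow>\<^sub>L 'a"
      using integral_return_borel[OF borel_measurable_quadratic_form[of T R]] by simp
    have tgt_bound: "(LINT \<eta>|?L M. Ptgt \<eta> \<bullet> H (Ptgt \<eta>))
        + (s\<^sup>2 * \<sigma>\<^sup>2 + \<beta> / 150 * (LINT \<eta>|?L M. \<eta> \<bullet> SK \<eta>)) * (Deff / (700 * Neff)) \<le> q s \<eta>0"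
      using tgt.phase_lower_bound[where L = "\<lambda>t. ?L (M + t)" and g = ?g and n = N and s = s and A = H and J = K,
          folded H, OF assms(16,14) sq_integrable_err_law step_tgt psdH assms(10,12) Neff assms(27,30,31)
            gtgt K Deff_sum]
      by (simp add: Ptgt' q_def SK_def)
    have src_bound: "Ptgt (Psrc \<eta>0) \<bullet> H (Ptgt (Psrc \<eta>0))
        + (s\<^sup>2 * \<sigma>\<^sup>2 + \<beta> / 150 * (\<eta>0 \<bullet> SJ \<eta>0)) * (Dft / (700 * Meff)) \<le> (LINT \<eta>|?L M. Ptgt \<eta> \<bullet> H (Ptgt \<eta>))"
      using src.phase_lower_bound[where L = ?L and g = \<gamma> and n = M and s = s and A = A and J = J,
          folded G, OF assms(15,14) sq_integrable_err_law step_src psdA assms(9,11) Meff assms(26,28,29)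
            gsrc J Dft_sum]
        start[of Psrc "A o\<^sub>L Psrc"] start[of id_blinfun SJ]
      by (simp add: Psrc' A_inner SJ_def)
    \<comment> \<open>The form \<open>SK\<close>, evaluated after the source phase, is at least its
      value at the purely contracted start, as all injected terms are nonnegative.\<close>
    have drift: "Psrc \<eta>0 \<bullet> SK (Psrc \<eta>0) \<le> (LINT \<eta>|?L M. \<eta> \<bullet> SK \<eta>)"
    proof -
      have "psd G"
        using assms(9) unfolding psd_def strictly_pd_def by (metis inner_zero_left less_eq_real_def)
      then have "0 \<le> (\<Sum>t<M. (\<gamma> t)\<^sup>2 * (s\<^sup>2 * \<sigma>\<^sup>2 + \<beta> * (LINT \<eta>|?L t. \<eta> \<bullet> G \<eta>)) *
          (LINT z|Dsrc. decay_prod G (\<lambda>i. \<gamma> (t + 1 + i)) (M - Suc t) (fst z)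
            \<bullet> SK (decay_prod G (\<lambda>i. \<gamma> (t + 1 + i)) (M - Suc t) (fst z))))"
        using assms(14) psdSK
        by (intro sum_nonneg mult_nonneg_nonneg add_nonneg_nonneg
            Bochner_Integration.integral_nonneg psdD(2)) auto
      then show ?thesis
        using src.phase_unroll[where L = ?L and g = \<gamma> and n = M and s = s and A = SK,
            folded G, OF assms(15) obu(1) sq_integrable_err_law step_src psdSK]
          start[of Psrc "SK o\<^sub>L Psrc"]
        by (simp add: Psrc')
    qed
    have "0 \<le> Deff / (700 * Neff)" using Deff_nonneg assms(27) by simp
    then have "(s\<^sup>2 * \<sigma>\<^sup>2 + \<beta> / 150 * (Psrc \<eta>0 \<bullet> SK (Psrc \<eta>0))) * (Deff / (700 * Neff))
        \<le> (s\<^sup>2 * \<sigma>\<^sup>2 + \<beta> / 150 * (LINT \<eta>|?L M. \<eta> \<bullet> SK \<eta>)) * (Deff / (700 * Neff))"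
      using drift assms(14) by (intro mult_right_mono add_left_mono mult_left_mono) auto
    then show ?thesis
      using tgt_bound src_bound by (simp add: sq_wnorm_def)
  qed

  have Bias_q: "BiasErr = (1/2) * q 0 (w0 - w_star)"
    unfolding BiasErr bias_err_def q_def D_def[symmetric] H[symmetric]
    by (subst op_inner_weak_cov_err_law[OF weak_cov_bias_iter symH obu(1)]) simp
  have Var_q: "VarErr = (1/2) * q 1 0"
    unfolding VarErr var_err_def q_def D_def[symmetric] H[symmetric]
    by (subst op_inner_weak_cov_err_law[OF weak_cov_var_iter symH obu(1)]) simp

  have "has_bochner_integral \<Omega>
      (\<lambda>\<omega>. excess_risk Dtgt w_star (sgd \<gamma> w0 (\<lambda>t. Z t \<omega>) (M + N))) (BiasErr + VarErr)"
  proof -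
    let ?\<eta> = "\<lambda>\<omega>. sgd \<gamma> w0 (\<lambda>t. Z t \<omega>) (M + N) - w_star"
    have "distr \<Omega> borel (Z t) = D t" if "t \<in> {1..M + N}" for t
      using that assms(22)[of t] assms(23)[of t] by (auto simp: D_def sample_law_def)
    from distr_sgd[OF assms(20,21) this order_refl]
    have \<eta>: "?\<eta> \<in> borel_measurable \<Omega>"
      and law: "distr \<Omega> borel ?\<eta> = err_law D \<gamma> w_star 1 (w0 - w_star) (M + N)" by auto
    have meas: "(\<lambda>\<eta>. \<eta> \<bullet> H \<eta>) \<in> borel_measurable borel"
      using borel_measurable_quadratic_form[of id_blinfun H] by simp
    have "integrable (distr \<Omega> borel ?\<eta>) (\<lambda>\<eta>. \<eta> \<bullet> H \<eta>)"
      unfolding law by (rule integrable_quadratic_form[OF sq_integrable_err_law])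
    then have "integrable \<Omega> (\<lambda>\<omega>. ?\<eta> \<omega> \<bullet> H (?\<eta> \<omega>))"
      using integrable_distr_eq[OF \<eta> meas] by simp
    moreover have "(LINT \<omega>|\<Omega>. ?\<eta> \<omega> \<bullet> H (?\<eta> \<omega>)) = q 1 (w0 - w_star)"
      unfolding q_def law[symmetric] by (rule integral_distr[OF \<eta> meas, symmetric])
    ultimately have "has_bochner_integral \<Omega> (\<lambda>\<omega>. (1/2) * (?\<eta> \<omega> \<bullet> H (?\<eta> \<omega>))) ((1/2) * q 1 (w0 - w_star))"
      by (intro has_bochner_integral_mult_right) (simp add: has_bochner_integral_iff)
    moreover have "(1/2) * q 1 (w0 - w_star) = BiasErr + VarErr"
      unfolding Bias_q Var_q q_def err_law_quadratic_split[OF symH, of \<gamma> "w0 - w_star"] by simp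
    ultimately show ?thesis unfolding tgt.excess_risk_eq H by metis
  qed
  moreover have "VarErr \<greatersim> \<sigma>\<^sup>2 * (Dft / Meff + Deff / Neff)"
  proof -
    let ?X = "\<sigma>\<^sup>2 * (Dft / Meff + Deff / Neff)"
    have "0 \<le> ?X" using Dft_nonneg Deff_nonneg assms(26,27) by simp
    moreover have "?X / 700 \<le> q 1 0"
      using bound[of 0 1] by (simp add: sq_wnorm_def algebra_simps add_divide_distrib)
    \<comment> \<open>The 1/2 in the definition of the error and the 700 leave 1 / 1400, well above
      10 ^ -6.\<close>
    moreover have "1 / 10 ^ 6 * x \<le> 1 / 2 * y" if "0 \<le> x" "x / 700 \<le> y" for x y :: real
      using that by simp
    ultimately show ?thesis unfolding gtrsim_def abs_const_def Var_q by blast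
  qed
  moreover have "BiasErr \<greatersim>
      sq_wnorm H ((Ptgt o\<^sub>L Psrc) (w0 - w_star))
      + \<beta> * sq_wnorm SJ (w0 - w_star) * (Dft / Meff)
      + \<beta> * sq_wnorm SK (Psrc (w0 - w_star)) * (Deff / Neff)"
  proof -
    let ?w = "w0 - w_star"
    let ?a = "sq_wnorm H ((Ptgt o\<^sub>L Psrc) ?w)" and ?X = "\<beta> * sq_wnorm SJ ?w * (Dft / Meff)"
      and ?Y = "\<beta> * sq_wnorm SK (Psrc ?w) * (Deff / Neff)"
    have "0 \<le> ?a" using psdD(2)[OF psdH] by (simp add: sq_wnorm_def)
    moreover have "0 \<le> ?X" "0 \<le> ?Y"
      using Dft_nonneg Deff_nonneg assms(14,26,27) psdD(2)[OF psdSJ] psdD(2)[OF psdSK]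
      by (simp_all add: sq_wnorm_def)
    \<comment> \<open>Here 105000 is 150 * 700; with the factor 1/2 the smallest coefficient is 1 /
      210000.\<close>
    moreover have "?a + ?X / 105000 + ?Y / 105000 \<le> q 0 ?w"
      using bound[of ?w 0] by simp
    moreover have "1 / 10 ^ 6 * (a + x + y) \<le> 1 / 2 * z"
      if "0 \<le> a" "0 \<le> x" "0 \<le> y" "a + x / 105000 + y / 105000 \<le> z" for a x y z :: real
      using that by simp
    ultimately show ?thesis unfolding gtrsim_def abs_const_def Bias_q by blast
  qed
  ultimately show ?thesis unfolding SJ_def SK_def by blast
qed

end
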